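(* Let $P$ be a centrally symmetric hexagon (so opposite sides are parallel and of equal length), and suppose its three side lengths are pairwise distinct. Then there is, up to isometry of the plane, exactly one side-to-side tiling of the Euclidean plane by congruent copies of $P$ in which every vertex has degree $3$. This tiling is isohedral and periodic, and it covers a minimal torus tiling consisting of a single tile.
   Context: Tiles are congruent copies of $P$ under isometries of the plane. A tiling is side-to-side if its vertices and edges coincide with corners and sides of tiles; the degree of a vertex is the number of tiles meeting there. Isohedral: the symmetry group of the tiling acts transitively on tiles. Periodic: invariant under two linearly independent translations. A plane tiling invariant under a lattice $\Lambda$ of translations induces a tiling of the flat torus $\mathbb{C}/\Lambda$, and for a sublattice $\Lambda'\subset\Lambda$ the induced tiling of $\mathbb{C}/\Lambda'$ covers that of $\mathbb{C}/\Lambda$; the plane tiling itself covers each such torus tiling. A torus tiling $\mathcal{T}$ is minimal if whenever $\mathcal{T}$ covers a torus tiling $\mathcal{T}'$, then $\mathcal{T}=\mathcal{T}'$. *)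

theory Defs
  imports "HOL-Analysis.Analysis"
begin

text \<open>A polygon is given by the cyclic list of its vertices. It is simple, not necessarily convex,
  and has no straight angles.\<close>

definition poly_side :: "complex list \<Rightarrow> nat \<Rightarrow> complex set" where
  "poly_side vs i = closed_segment (vs ! i) (vs ! (Suc i mod length vs))"

definition side_length :: "complex list \<Rightarrow> nat \<Rightarrow> real" where
  "side_length vs i = dist (vs ! i) (vs ! (Suc i mod length vs))"

definition simple_polygon :: "complex list \<Rightarrow> bool" where
  "simple_polygon vs \<longleftrightarrow>
     3 \<le> length vs \<and> distinct vs \<and>
     (\<forall>i<length vs. \<forall>j<length vs. i \<noteq> j \<longrightarrow>
        poly_side vs i \<inter> poly_side vs j
          \<subseteq> {vs ! i, vs ! (Suc i mod length vs)} \<inter> {vs ! j, vs ! (Suc j mod length vs)}) \<and>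
     (\<forall>i<length vs. \<not> collinear {vs ! i, vs ! ((i + 1) mod length vs), vs ! ((i + 2) mod length vs)})"

definition poly_boundary :: "complex list \<Rightarrow> complex set" where
  "poly_boundary vs = (\<Union>i<length vs. poly_side vs i)"

definition poly_region :: "complex list \<Rightarrow> complex set" where
  "poly_region vs = poly_boundary vs \<union> inside (poly_boundary vs)"

text \<open>Tiles are plane regions. Since straight angles are excluded, the corners and sides of a
  polygonal region do not depend on the vertex list used to present it.\<close>

definition corners :: "complex set \<Rightarrow> complex set" where
  "corners t = {x. \<exists>vs. simple_polygon vs \<and> poly_region vs = t \<and> x \<in> set vs}"

definition sides :: "complex set \<Rightarrow> complex set set" where
  "sides t = {s. \<exists>vs i. simple_polygon vs \<and> poly_region vs = t \<and> i < length vs \<and> s = poly_side vs i}"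

definition centrally_symmetric :: "complex set \<Rightarrow> bool" where
  "centrally_symmetric P \<longleftrightarrow> (\<exists>c. (\<lambda>z. 2 * c - z) ` P = P)"

definition plane_isometry :: "(complex \<Rightarrow> complex) \<Rightarrow> bool" where
  "plane_isometry f \<longleftrightarrow> surj f \<and> (\<forall>x y. dist (f x) (f y) = dist x y)"

definition tiling_by :: "complex set \<Rightarrow> complex set set \<Rightarrow> bool" where
  "tiling_by P T \<longleftrightarrow>
     (\<forall>t\<in>T. \<exists>f. plane_isometry f \<and> t = f ` P) \<and>
     \<Union>T = UNIV \<and>
     (\<forall>t\<in>T. \<forall>t'\<in>T. t \<noteq> t' \<longrightarrow> interior t \<inter> interior t' = {})"

text \<open>As in Gruenbaum and Shephard, the vertices and edges of a tiling are the isolated points,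
  respectively the arcs, that make up the intersections of finitely many (at least two) tiles.\<close>

definition tiling_vertices :: "complex set set \<Rightarrow> complex set" where
  "tiling_vertices T =
     {x. \<exists>S\<subseteq>T. finite S \<and> 2 \<le> card S \<and> {x} \<in> components (\<Inter>S)}"

definition tiling_edges :: "complex set set \<Rightarrow> complex set set" where
  "tiling_edges T =
     {e. \<exists>S\<subseteq>T. finite S \<and> 2 \<le> card S \<and> e \<in> components (\<Inter>S) \<and> (\<forall>x. e \<noteq> {x})}"

definition side_to_side :: "complex set set \<Rightarrow> bool" where
  "side_to_side T \<longleftrightarrow>
     tiling_vertices T = (\<Union>t\<in>T. corners t) \<and> tiling_edges T = (\<Union>t\<in>T. sides t)"

definition vertex_degree :: "complex set set \<Rightarrow> complex \<Rightarrow> nat" where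
  "vertex_degree T x = card {t \<in> T. x \<in> t}"

definition trivalent_tiling_by :: "complex set \<Rightarrow> complex set set \<Rightarrow> bool" where
  "trivalent_tiling_by P T \<longleftrightarrow>
     tiling_by P T \<and> side_to_side T \<and> (\<forall>x\<in>tiling_vertices T. vertex_degree T x = 3)"

definition move_tiling :: "(complex \<Rightarrow> complex) \<Rightarrow> complex set set \<Rightarrow> complex set set" where
  "move_tiling f T = (\<lambda>t. f ` t) ` T"

definition isometric_tilings :: "complex set set \<Rightarrow> complex set set \<Rightarrow> bool" where
  "isometric_tilings T T' \<longleftrightarrow> (\<exists>f. plane_isometry f \<and> move_tiling f T = T')"

definition isohedral :: "complex set set \<Rightarrow> bool" where
  "isohedral T \<longleftrightarrow>
     (\<forall>t\<in>T. \<forall>t'\<in>T. \<exists>f. plane_isometry f \<and> move_tiling f T = T \<and> f ` t = t')"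

definition periodic :: "complex set set \<Rightarrow> bool" where
  "periodic T \<longleftrightarrow>
     (\<exists>u w. u \<noteq> w \<and> independent {u, w} \<and>
        move_tiling (\<lambda>z. z + u) T = T \<and> move_tiling (\<lambda>z. z + w) T = T)"

definition plane_lattice :: "complex set \<Rightarrow> bool" where
  "plane_lattice \<Lambda> \<longleftrightarrow>
     (\<exists>u w. u \<noteq> w \<and> independent {u, w} \<and>
        \<Lambda> = {of_int m * u + of_int n * w | m n. True})"

definition lattice_invariant :: "complex set \<Rightarrow> complex set set \<Rightarrow> bool" where
  "lattice_invariant \<Lambda> T \<longleftrightarrow> (\<forall>l\<in>\<Lambda>. move_tiling (\<lambda>z. z + l) T = T)"

text \<open>A tiling of the flat torus is a pair of the lattice and the set of its tiles, where a tile of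
  the torus is the orbit of a plane tile under the lattice. (The image of a plane tile as
  a point set of the torus would lose information: if there is only one tile, that image is the
  whole torus.)\<close>

type_synonym torus_tiling = "complex set \<times> complex set set set"

definition induced_tiling :: "complex set \<Rightarrow> complex set set \<Rightarrow> torus_tiling" where
  "induced_tiling \<Lambda> T = (\<Lambda>, (\<lambda>t. {(\<lambda>z. z + l) ` t | l. l \<in> \<Lambda>}) ` T)"

definition torus_tiles :: "torus_tiling \<Rightarrow> complex set set set" where
  "torus_tiles \<T> = snd \<T>"

definition plane_covers :: "complex set \<Rightarrow> complex set set \<Rightarrow> torus_tiling \<Rightarrow> bool" where
  "plane_covers P T \<T> \<longleftrightarrow>
     tiling_by P T \<and>
     (\<exists>\<Lambda>. plane_lattice \<Lambda> \<and> lattice_invariant \<Lambda> T \<and> \<T> = induced_tiling \<Lambda> T)"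

definition torus_covers :: "complex set \<Rightarrow> torus_tiling \<Rightarrow> torus_tiling \<Rightarrow> bool" where
  "torus_covers P \<T> \<T>' \<longleftrightarrow>
     (\<exists>T \<Lambda> \<Lambda>'. tiling_by P T \<and> plane_lattice \<Lambda> \<and> plane_lattice \<Lambda>' \<and> \<Lambda> \<subseteq> \<Lambda>' \<and>
        lattice_invariant \<Lambda>' T \<and> \<T> = induced_tiling \<Lambda> T \<and> \<T>' = induced_tiling \<Lambda>' T)"

definition minimal_torus_tiling :: "complex set \<Rightarrow> torus_tiling \<Rightarrow> bool" where
  "minimal_torus_tiling P \<T> \<longleftrightarrow>
     (\<exists>T. plane_covers P T \<T>) \<and> (\<forall>\<T>'. torus_covers P \<T> \<T>' \<longrightarrow> \<T> = \<T>')"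

end

theory Submission
  imports Defs
begin

text \<open>
  \<^emph>\<open>Uniqueness.\<close> In a trivalent side-to-side tiling the three tiles at a vertex share three edges
  pairwise, and adjacent sides of a tile have different lengths; so the three edges at a vertex
  have the three different side lengths. This fixes which end of an edge is which for the tile on
  its other side. That tile is therefore the translate taking a side to the opposite one, the only
  other candidate being its mirror image in the edge, which overlaps the given tile. Hence the
  tiling contains all translates of one tile under a lattice, and these already fill the plane.

  \<^emph>\<open>Existence.\<close> The hexagon need not be convex, but it has an ear, and then also the opposite ear.
  Cutting off both leaves a parallelogram. Its translates along the direction of the cuts form a
  strip, and between two neighbouring strips the cut-off triangles fill another strip.
\<close>

section \<open>Simple polygons\<close>

text \<open>Uniqueness leans on existence. That the mirror image overlaps the given tile is seen
  close to the shared side: the translate across this side must lie beyond it, and for a hexagon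
  that need not be convex this is read off from the disjoint interiors of the lattice tiling. The
  notions of tiling refer to point sets, so corners and sides have to be recovered from a region.
  Its frontier is the polygon by the Jordan curve theorem, and the corners are visible in the
  polygon because straight angles are excluded. An edge is merely a component of an intersection of
  tiles; that it is a whole side of two tiles holds because no three tiles can lie along one
  segment. The ear comes from signs: with centre 0 and consecutive corners A, B, C, the cross
  products of these three vectors either put a corner beyond the diagonal joining its neighbours or
  force two sides to cross. In coordinates that put the two cuts at heights 1 and -1, the widths of
  an upper ear and of a lower ear from the next row add up to 1 at each height between the rows,
  which is why the triangles fill the gaps.\<close>

lemma Suc_mod_inj: "i < n \<Longrightarrow> j < n \<Longrightarrow> Suc i mod n = Suc j mod n \<Longrightarrow> i = j"
  by (cases "Suc i = n"; cases "Suc j = n") auto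

lemma Suc_mod_neq: "2 \<le> n \<Longrightarrow> i < n \<Longrightarrow> Suc i mod n \<noteq> i"
  by (cases "Suc i = n") auto

lemma Suc_mod_less: "i < n \<Longrightarrow> Suc j mod n < (n::nat)"
  by simp

lemma cyclic_predecessor:
  assumes "k < n"
  obtains j where "j < n" "Suc j mod n = k"
proof (cases k)
  case 0
  with assms have "n - 1 < n" "Suc (n - 1) mod n = k" by auto
  then show ?thesis by (rule that)
next
  case (Suc m)
  with assms have "m < n" "Suc m mod n = k" by auto
  then show ?thesis by (rule that)
qed

lemma simple_polygon_side_Int:
  assumes "simple_polygon vs" "i < length vs" "j < length vs" "i \<noteq> j"
  shows "poly_side vs i \<inter> poly_side vs j
          \<subseteq> {vs ! i, vs ! (Suc i mod length vs)} \<inter> {vs ! j, vs ! (Suc j mod length vs)}"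
  using assms unfolding simple_polygon_def by blast

lemma simple_polygon_length: "simple_polygon vs \<Longrightarrow> 3 \<le> length vs"
  and simple_polygon_distinct: "simple_polygon vs \<Longrightarrow> distinct vs"
  by (simp_all add: simple_polygon_def)

lemma simple_polygon_side_endpoints_neq:
  assumes "simple_polygon vs" "i < length vs"
  shows "vs ! i \<noteq> vs ! (Suc i mod length vs)"
proof -
  have "Suc i mod length vs \<noteq> i" "Suc i mod length vs < length vs"
    using simple_polygon_length[OF assms(1)] Suc_mod_neq[OF _ assms(2)] Suc_mod_less[OF assms(2)] by simp_all
  with assms simple_polygon_distinct[OF assms(1)] show ?thesis
    by (metis nth_eq_iff_index_eq)
qed

lemma closed_poly_side: "closed (poly_side vs i)"
  by (simp add: poly_side_def)

lemma compact_poly_boundary: "compact (poly_boundary vs)"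
  unfolding poly_boundary_def by (intro compact_UN) (auto simp: poly_side_def)

lemma corner_in_side_iff:
  assumes "simple_polygon vs" "k < length vs" "j < length vs"
  shows "vs ! k \<in> poly_side vs j \<longleftrightarrow> j = k \<or> Suc j mod length vs = k"
proof
  assume *: "vs ! k \<in> poly_side vs j"
  show "j = k \<or> Suc j mod length vs = k"
  proof (rule ccontr)
    assume n: "\<not> ?thesis"
    have "vs ! k \<in> poly_side vs k" by (simp add: poly_side_def)
    with * n simple_polygon_side_Int[OF assms(1,3,2)]
    have "vs ! k = vs ! j \<or> vs ! k = vs ! (Suc j mod length vs)" by blast
    moreover have "Suc j mod length vs < length vs" using assms(2) by (rule Suc_mod_less)
    ultimately show False
      using n assms simple_polygon_distinct[OF assms(1)] by (metis nth_eq_iff_index_eq)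
  qed
qed (auto simp: poly_side_def)

text \<open>A corner in the interior of the segment would have a straight angle.\<close>

lemma no_corner_in_open_segment:
  assumes simp: "simple_polygon ws" and sub: "closed_segment p q \<subseteq> poly_boundary ws"
    and k: "k < length ws"
  shows "ws ! k \<notin> open_segment p q"
proof
  define n where "n = length ws"
  assume y: "ws ! k \<in> open_segment p q"
  define y where "y = ws ! k"
  obtain k' where k': "k' < n" "Suc k' mod n = k"
    using cyclic_predecessor k unfolding n_def by blast
  define F where "F = (\<Union>j\<in>{..<n} - {k, k'}. poly_side ws j)"
  have "closed F" unfolding F_def by (intro closed_UN) (auto simp: closed_poly_side)
  have "y \<notin> F"
  proof
    assume "y \<in> F"
    then obtain j where j: "j < n" "j \<noteq> k" "j \<noteq> k'" "y \<in> poly_side ws j" by (auto simp: F_def)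
    with corner_in_side_iff[OF simp k, of j] have "Suc j mod n = k" unfolding n_def y_def by auto
    with k' j Suc_mod_inj show False by metis
  qed
  with \<open>closed F\<close> obtain e where e: "e > 0" "ball y e \<subseteq> - F"
    by (metis ComplI closed_def open_contains_ball)
  obtain u where u: "0 < u" "u < 1" "y = (1 - u) *\<^sub>R p + u *\<^sub>R q" and pq: "p \<noteq> q"
    using y unfolding y_def in_segment by blast
  define d where "d = q - p"
  have d: "d \<noteq> 0" using pq by (simp add: d_def)
  define \<delta> where "\<delta> = Min {u, 1 - u, e / (2 * norm d)}"
  have \<delta>: "0 < \<delta>" "\<delta> \<le> u" "\<delta> \<le> 1 - u" "\<delta> * norm d < e"
  proof -
    show "0 < \<delta>" "\<delta> \<le> u" "\<delta> \<le> 1 - u" using u e d by (auto simp: \<delta>_def)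
    have "\<delta> \<le> e / (2 * norm d)" by (auto simp: \<delta>_def)
    then have "\<delta> * norm d \<le> e / 2" using d by (simp add: field_simps)
    then show "\<delta> * norm d < e" using e by simp
  qed
  have key: "\<exists>w s. w \<in> {ws ! k', ws ! (Suc k mod n)} \<and> 0 < s \<and> c *\<^sub>R d = s *\<^sub>R (w - y)"
    if c: "c = \<delta> \<or> c = - \<delta>" for c
  proof -
    have "y + c *\<^sub>R d = (1 - (u + c)) *\<^sub>R p + (u + c) *\<^sub>R q"
      by (simp add: u(3) d_def algebra_simps)
    moreover have "0 \<le> u + c" "u + c \<le> 1" using c \<delta> by auto
    ultimately have "y + c *\<^sub>R d \<in> closed_segment p q" unfolding in_segment by blast
    then have "y + c *\<^sub>R d \<in> poly_boundary ws" using sub by blast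
    moreover have "y + c *\<^sub>R d \<in> ball y e"
      using c \<delta> by (auto simp: dist_norm)
    ultimately have "y + c *\<^sub>R d \<in> poly_side ws k \<union> poly_side ws k'"
      using e(2) unfolding poly_boundary_def F_def n_def by auto
    then have "\<exists>w\<in>{ws ! k', ws ! (Suc k mod n)}. y + c *\<^sub>R d \<in> closed_segment y w"
      unfolding poly_side_def y_def using k' by (auto simp: n_def closed_segment_commute)
    then obtain w s where w: "w\<in>{ws ! k', ws ! (Suc k mod n)}" "0 \<le> s"
      "y + c *\<^sub>R d = (1 - s) *\<^sub>R y + s *\<^sub>R w"
      unfolding in_segment by blast
    from w(3) have *: "c *\<^sub>R d = s *\<^sub>R (w - y)" by (simp add: algebra_simps)
    have "s \<noteq> 0" using * c \<delta>(1) d by auto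
    with w * show ?thesis by (intro exI[of _ w] exI[of _ s]) auto
  qed
  obtain w s where w: "w \<in> {ws ! k', ws ! (Suc k mod n)}" "0 < s" "\<delta> *\<^sub>R d = s *\<^sub>R (w - y)"
    using key[of \<delta>] by blast
  obtain w' s' where w': "w' \<in> {ws ! k', ws ! (Suc k mod n)}" "0 < s'" "(-\<delta>) *\<^sub>R d = s' *\<^sub>R (w' - y)"
    using key[of "-\<delta>"] by blast
  have sum: "s *\<^sub>R (w - y) + s' *\<^sub>R (w' - y) = 0"
    unfolding w(3)[symmetric] w'(3)[symmetric] by simp
  show False
  proof (cases "w = w'")
    case True
    with sum have "(s + s') *\<^sub>R (w - y) = 0" by (simp add: scaleR_add_left)
    with w w' have "w - y = 0" by auto
    with w(3) \<delta>(1) d show False by simp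
  next
    case False
    have "s' *\<^sub>R (w' - y) = (- s) *\<^sub>R (w - y)" using sum
      by (simp add: eq_neg_iff_add_eq_0 add.commute)
    then have "(1 / s') *\<^sub>R (s' *\<^sub>R (w' - y)) = (1 / s') *\<^sub>R ((- s) *\<^sub>R (w - y))" by simp
    then have "w' - y = (- s / s') *\<^sub>R (w - y)" using w'(2) by simp
    then have "collinear {0, w - y, w' - y}" using collinear_lemma by blast
    then have "collinear {w, y, w'}" using collinear_3[of w y w'] unfolding NO_MATCH_def by blast
    moreover have "{w, y, w'} = {ws ! k', ws ! ((k' + 1) mod n), ws ! ((k' + 2) mod n)}"
    proof -
      have "(k' + 2) mod n = Suc k mod n" using k'(2) by (metis add_2_eq_Suc' mod_Suc_eq)
      then show ?thesis using False w w' k'(2) by (auto simp: y_def)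
    qed
    ultimately show False using simp k'(1) unfolding simple_polygon_def n_def by auto
  qed
qed

text \<open>The side through some point of the open segment and the union of the other sides are
  closed sets that cover the segment. They could meet only in corners, which the open segment
  avoids, so connectedness leaves it in a single side.\<close>

lemma segment_in_boundary_imp_in_side:
  assumes simp: "simple_polygon ws" and sub: "closed_segment p q \<subseteq> poly_boundary ws"
    and pq: "p \<noteq> q"
  shows "\<exists>i<length ws. closed_segment p q \<subseteq> poly_side ws i"
proof -
  let ?O = "open_segment p q"
  have OB: "?O \<subseteq> poly_boundary ws" using sub segment_open_subset_closed by blast
  have "?O \<noteq> {}" using pq by simp
  then obtain x where x: "x \<in> ?O" by blast
  then obtain i where i: "i < length ws" "x \<in> poly_side ws i" using OB by (auto simp: poly_boundary_def)
  define F where "F = (\<Union>j\<in>{..<length ws} - {i}. poly_side ws j)"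
  have "closed F" unfolding F_def by (intro closed_UN) (auto simp: closed_poly_side)
  have dis: "poly_side ws i \<inter> F \<inter> ?O = {}"
  proof (rule ccontr)
    assume "\<not> ?thesis"
    then obtain z j where z: "z \<in> poly_side ws i" "j < length ws" "j \<noteq> i" "z \<in> poly_side ws j" "z \<in> ?O"
      by (auto simp: F_def)
    with simple_polygon_side_Int[OF simp i(1), of j]
    have "z = ws ! i \<or> z = ws ! (Suc i mod length ws)" by blast
    moreover have "Suc i mod length ws < length ws" using i(1) by (rule Suc_mod_less)
    ultimately show False using no_corner_in_open_segment[OF simp sub] i(1) z(5) by metis
  qed
  have "?O \<subseteq> poly_side ws i \<union> F" using OB by (auto simp: F_def poly_boundary_def)
  then have "F \<inter> ?O = {}"
    using connected_closedD[OF convex_connected[OF convex_open_segment] dis _ closed_poly_side \<open>closed F\<close>] x i(2) by blast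
  then have "?O \<subseteq> poly_side ws i" using \<open>?O \<subseteq> poly_side ws i \<union> F\<close> by blast
  then have "closure ?O \<subseteq> poly_side ws i"
    using closed_poly_side by (rule closure_minimal)
  with pq i(1) show ?thesis by auto
qed

lemma side_subset_imp_eq:
  assumes "simple_polygon vs" "i < length vs" "j < length vs" "poly_side vs i \<subseteq> poly_side vs j"
  shows "i = j"
proof (rule ccontr)
  assume "i \<noteq> j"
  with assms have "poly_side vs i \<subseteq> {vs ! i, vs ! (Suc i mod length vs)}"
    using simple_polygon_side_Int[OF assms(1-3)] by blast
  then have "finite (poly_side vs i)" by (rule finite_subset) simp
  then show False using simple_polygon_side_endpoints_neq[OF assms(1,2)] by (simp add: poly_side_def)
qed

lemma poly_side_subset_boundary: "i < length vs \<Longrightarrow> poly_side vs i \<subseteq> poly_boundary vs"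
  by (auto simp: poly_boundary_def)

text \<open>A side of \<open>vs\<close> lies in a side of \<open>ws\<close>, which lies in a side of
  \<open>vs\<close> again. Nested sides of one polygon coincide, so all three are equal.\<close>

lemma same_boundary_imp_sides_subset:
  assumes vs: "simple_polygon vs" and ws: "simple_polygon ws"
    and eq: "poly_boundary vs = poly_boundary ws" and i: "i < length vs"
  shows "\<exists>j<length ws. poly_side vs i = poly_side ws j"
proof -
  obtain j where j: "j < length ws" "poly_side vs i \<subseteq> poly_side ws j"
    using segment_in_boundary_imp_in_side[OF ws, of "vs ! i" "vs ! (Suc i mod length vs)"]
      simple_polygon_side_endpoints_neq[OF vs i] poly_side_subset_boundary[OF i] eq
    unfolding poly_side_def by metis
  obtain k where k: "k < length vs" "poly_side ws j \<subseteq> poly_side vs k"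
    using segment_in_boundary_imp_in_side[OF vs, of "ws ! j" "ws ! (Suc j mod length ws)"]
      simple_polygon_side_endpoints_neq[OF ws j(1)] poly_side_subset_boundary[OF j(1)] eq
    unfolding poly_side_def by metis
  have "i = k" using side_subset_imp_eq[OF vs i k(1)] j k by blast
  with j k show ?thesis by blast
qed

lemma same_boundary_imp_corners_subset:
  assumes vs: "simple_polygon vs" and ws: "simple_polygon ws"
    and eq: "poly_boundary vs = poly_boundary ws"
  shows "set vs \<subseteq> set ws"
proof
  fix x assume "x \<in> set vs"
  then obtain i where i: "i < length vs" "x = vs ! i" by (metis in_set_conv_nth)
  obtain j where j: "j < length ws" "poly_side vs i = poly_side ws j"
    using same_boundary_imp_sides_subset[OF assms i(1)] by blast
  then have "{vs ! i, vs ! (Suc i mod length vs)} = {ws ! j, ws ! (Suc j mod length ws)}"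
    by (simp add: poly_side_def)
  moreover have "Suc j mod length ws < length ws" using j(1) by (rule Suc_mod_less)
  ultimately show "x \<in> set ws" using i j(1)
    by (metis insert_iff nth_mem singletonD)
qed

text \<open>Turns a vertex list into a path, the form in which the Jordan curve theorem applies. The
  clause for two points keeps a constant last piece out, which would spoil injectivity.\<close>

fun chain_path :: "complex list \<Rightarrow> real \<Rightarrow> complex" where
  "chain_path [] = linepath 0 0"
| "chain_path [x] = linepath x x"
| "chain_path [x, y] = linepath x y"
| "chain_path (x # y # z # zs) = linepath x y +++ chain_path (y # z # zs)"

lemma chain_path_ends:
  "xs \<noteq> [] \<Longrightarrow> pathstart (chain_path xs) = hd xs \<and> pathfinish (chain_path xs) = last xs"
  by (induction xs rule: chain_path.induct) auto

lemma UN_lessThan_Suc_shift: "(\<Union>i<Suc n. f i) = f 0 \<union> (\<Union>i<n. f (Suc i))"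
  by (auto simp: lessThan_Suc_eq_insert_0)

lemma chain_path_image:
  "2 \<le> length xs \<Longrightarrow>
     path_image (chain_path xs) = (\<Union>i<length xs - 1. closed_segment (xs ! i) (xs ! Suc i))"
proof (induction xs rule: chain_path.induct)
  case (4 x y z zs)
  have "path_image (chain_path (x # y # z # zs)) =
      closed_segment x y \<union> path_image (chain_path (y # z # zs))"
    by (simp add: path_image_join chain_path_ends)
  also have "\<dots> = closed_segment x y \<union>
      (\<Union>i<Suc (length zs). closed_segment ((y # z # zs) ! i) ((y # z # zs) ! Suc i))"
    using 4 by simp
  also have "\<dots> = (\<Union>i<Suc (Suc (length zs)). closed_segment ((x # y # z # zs) ! i) ((x # y # z # zs) ! Suc i))"
    by (subst (2) UN_lessThan_Suc_shift) simp
  finally show ?case by simp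
qed (auto simp: lessThan_Suc)

lemma arc_chain_path:
  assumes "2 \<le> length xs" "distinct xs"
    and "\<And>i j. i < j \<Longrightarrow> j < length xs - 1 \<Longrightarrow>
       closed_segment (xs ! i) (xs ! Suc i) \<inter> closed_segment (xs ! j) (xs ! Suc j)
         \<subseteq> {xs ! i, xs ! Suc i} \<inter> {xs ! j, xs ! Suc j}"
  shows "arc (chain_path xs)"
  using assms
proof (induction xs rule: chain_path.induct)
  case (4 x y z zs)
  let ?t = "y # z # zs"
  have "arc (chain_path ?t)"
  proof (rule 4(1))
    fix i j assume "i < j" "j < length ?t - 1"
    then show "closed_segment (?t ! i) (?t ! Suc i) \<inter> closed_segment (?t ! j) (?t ! Suc j)
         \<subseteq> {?t ! i, ?t ! Suc i} \<inter> {?t ! j, ?t ! Suc j}"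
      using 4(4)[of "Suc i" "Suc j"] by simp
  qed (use 4 in auto)
  moreover have "arc (linepath x y)" using 4 by simp
  moreover have "closed_segment x y \<inter> path_image (chain_path ?t) \<subseteq> {y}"
  proof
    fix w assume w: "w \<in> closed_segment x y \<inter> path_image (chain_path ?t)"
    then obtain j where j: "j < length ?t - 1" "w \<in> closed_segment (?t ! j) (?t ! Suc j)"
      by (subst (asm) chain_path_image) auto
    with 4(4)[of 0 "Suc j"] w have "w \<in> {x, y} \<inter> {?t ! j, ?t ! Suc j}" by auto
    moreover have "?t ! j \<in> set ?t" "?t ! Suc j \<in> set ?t"
      using j(1) by (intro nth_mem; simp)+
    then have "?t ! j \<noteq> x" "?t ! Suc j \<noteq> x" using 4(3) by (metis distinct.simps(2))+
    ultimately show "w \<in> {y}" by auto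
  qed
  ultimately show ?case
    by (simp add: arc_join chain_path_ends)
qed auto

text \<open>All sides but the last form an arc through the corners; the last side meets this arc
  only in its two ends and closes it to a simple loop.\<close>

lemma simple_polygon_Jordan_path:
  assumes simp: "simple_polygon vs"
  obtains c where "simple_path c" "pathfinish c = pathstart c" "path_image c = poly_boundary vs"
proof -
  define n where "n = length vs"
  have n: "3 \<le> n" using simple_polygon_length[OF simp] by (simp add: n_def)
  then have ne: "vs \<noteq> []" by (auto simp: n_def)
  have side: "poly_side vs i = closed_segment (vs ! i) (vs ! Suc i)" if "i < n - 1" for i
    using that n by (simp add: poly_side_def n_def)
  have last_side: "poly_side vs (n - 1) = closed_segment (last vs) (hd vs)"
    using n ne by (simp add: poly_side_def n_def last_conv_nth hd_conv_nth)
  have img: "path_image (chain_path vs) = (\<Union>i<n - 1. poly_side vs i)"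
    using chain_path_image[of vs] n side by (simp add: n_def)
  let ?g = "chain_path vs +++ linepath (last vs) (hd vs)"
  have "arc (chain_path vs)"
  proof (rule arc_chain_path)
    fix i j assume ij: "i < j" "j < length vs - 1"
    then show "closed_segment (vs ! i) (vs ! Suc i) \<inter> closed_segment (vs ! j) (vs ! Suc j)
         \<subseteq> {vs ! i, vs ! Suc i} \<inter> {vs ! j, vs ! Suc j}"
      using simple_polygon_side_Int[OF simp, of i j] side[of i] side[of j] by (simp add: n_def)
  qed (use n simple_polygon_distinct[OF simp] in \<open>auto simp: n_def\<close>)
  moreover have "arc (linepath (last vs) (hd vs))"
    using simple_polygon_side_endpoints_neq[OF simp, of "n - 1"] n ne
    by (simp add: n_def last_conv_nth hd_conv_nth)
  moreover have "(\<Union>i<n - 1. poly_side vs i) \<inter> closed_segment (last vs) (hd vs) \<subseteq> {hd vs, last vs}"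
  proof -
    have "poly_side vs i \<inter> poly_side vs (n - 1) \<subseteq> {vs ! (n - 1), vs ! 0}" if "i < n - 1" for i
    proof -
      have "Suc (n - 1) mod length vs = 0" "n - 1 < length vs" using n by (simp_all flip: n_def)
      with simple_polygon_side_Int[OF simp, of i "n - 1"] that show ?thesis by (auto simp: n_def)
    qed
    then show ?thesis using last_side ne by (auto simp: n_def last_conv_nth hd_conv_nth)
  qed
  ultimately have "simple_path ?g"
    using ne by (intro simple_path_join_loop) (auto simp: chain_path_ends img)
  moreover have "pathfinish ?g = pathstart ?g" using ne by (simp add: chain_path_ends)
  moreover have "path_image ?g = poly_boundary vs"
  proof -
    have "{..<n} = insert (n - 1) {..<n - 1}" using n by auto
    then show ?thesis using ne last_side
      by (simp add: path_image_join chain_path_ends img poly_boundary_def flip: n_def)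
        (simp add: Un_commute)
  qed
  ultimately show ?thesis by (rule that)
qed

text \<open>The region is the complement of the outside, and by the Jordan curve theorem the polygon
  is the frontier of both the inside and the outside. The first fact recovers the boundary from the
  region; the second lets any point of a tile be approximated by interior points, which is how
  overlaps are detected.\<close>

lemma poly_region_topology:
  assumes "simple_polygon vs"
  shows poly_region_frontier: "frontier (poly_region vs) = poly_boundary vs"
    and poly_region_regular: "poly_region vs \<subseteq> closure (interior (poly_region vs))"
    and poly_region_compact: "compact (poly_region vs)"
proof -
  obtain c where c: "simple_path c" "pathfinish c = pathstart c" "path_image c = poly_boundary vs"
    using simple_polygon_Jordan_path[OF assms] by blast
  let ?B = "poly_boundary vs"
  have J: "open (inside ?B)" "frontier (inside ?B) = ?B" "frontier (outside ?B) = ?B"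
    "open (outside ?B)"
    using Jordan_inside_outside[OF c(1,2)] c(3) by auto
  have R: "poly_region vs = - outside ?B" by (simp add: poly_region_def union_with_inside)
  show "frontier (poly_region vs) = ?B" by (simp add: R frontier_complement J)
  have "closed (poly_region vs)" using J(4) unfolding R by (rule closed_Compl)
  moreover have "bounded (poly_region vs)"
    unfolding poly_region_def using compact_poly_boundary[of vs]
    by (simp add: compact_imp_bounded bounded_inside)
  ultimately show "compact (poly_region vs)" by (simp add: compact_eq_bounded_closed)
  have "inside ?B \<subseteq> interior (poly_region vs)"
    by (rule interior_maximal) (auto simp: poly_region_def J)
  then have "closure (inside ?B) \<subseteq> closure (interior (poly_region vs))" by (rule closure_mono)
  moreover have "?B \<subseteq> closure (inside ?B)" using J(2) by (auto simp: frontier_def)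
  ultimately show "poly_region vs \<subseteq> closure (interior (poly_region vs))"
    using closure_subset[of "inside ?B"] by (auto simp: poly_region_def)
qed

text \<open>Any other vertex list of the same region has the same boundary, namely the frontier, and
  the boundary determines the corners.\<close>

lemma corners_poly_region:
  assumes "simple_polygon vs"
  shows "corners (poly_region vs) = set vs"
proof -
  have "set ws = set vs" if "simple_polygon ws" "poly_region ws = poly_region vs" for ws
  proof -
    have "poly_boundary ws = poly_boundary vs"
      using poly_region_frontier that assms by metis
    then show ?thesis using same_boundary_imp_corners_subset that assms by (metis subset_antisym)
  qed
  then show ?thesis using assms unfolding corners_def by blast
qed

lemma sides_poly_region:
  assumes "simple_polygon vs"
  shows "sides (poly_region vs) = poly_side vs ` {..<length vs}"
proof -
  have "poly_side ws i \<in> poly_side vs ` {..<length vs}"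
    if "simple_polygon ws" "poly_region ws = poly_region vs" "i < length ws" for ws i
  proof -
    have "poly_boundary ws = poly_boundary vs"
      using poly_region_frontier that assms by metis
    then show ?thesis using same_boundary_imp_sides_subset[OF that(1) assms _ that(3)] by auto
  qed
  then show ?thesis using assms unfolding sides_def by blast
qed

section \<open>Isometries of the plane\<close>

lemma plane_isometry_dist: "plane_isometry f \<Longrightarrow> dist (f x) (f y) = dist x y"
  by (simp add: plane_isometry_def)

lemma plane_isometry_bij: "plane_isometry f \<Longrightarrow> bij f"
  unfolding plane_isometry_def bij_def by (metis dist_eq_0_iff injI)

lemma plane_isometry_inv:
  assumes "plane_isometry f"
  shows "plane_isometry (inv f)"
proof -
  have b: "bij f" using assms by (rule plane_isometry_bij)
  have "dist (inv f x) (inv f y) = dist x y" for x y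
    using plane_isometry_dist[OF assms, of "inv f x" "inv f y"] b by (simp add: bij_is_surj surj_f_inv_f)
  then show ?thesis using b by (simp add: plane_isometry_def bij_imp_bij_inv bij_is_surj)
qed

lemma plane_isometry_comp:
  "plane_isometry f \<Longrightarrow> plane_isometry g \<Longrightarrow> plane_isometry (f \<circ> g)"
  unfolding plane_isometry_def using comp_surj[of g f] by simp

lemma plane_isometry_translation: "plane_isometry (\<lambda>z. z + l)"
  unfolding plane_isometry_def by (auto intro: surj_plus_right)

lemma plane_isometry_point_reflection: "plane_isometry (\<lambda>z. 2 * c - z)"
  unfolding plane_isometry_def
proof (intro conjI allI)
  show "surj (\<lambda>z. 2 * c - z)" by (rule surjI[of _ "\<lambda>z. 2 * c - z"]) simp
qed (auto simp: dist_norm norm_minus_commute)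

text \<open>Normalise the map to \<open>h\<close>, which fixes 0 and 1. The distances to these two
  points determine \<open>Re (h z)\<close> and the square of \<open>Im (h z)\<close>; the distance
  to the image of \<open>\<i>\<close> makes the sign of the imaginary part the same for all
  \<open>z\<close>.\<close>

lemma plane_isometry_cases:
  assumes "plane_isometry f"
  obtains (direct) a b where "norm a = 1" "\<And>z. f z = a * z + b"
    | (opposite) a b where "norm a = 1" "\<And>z. f z = a * cnj z + b"
proof -
  define b where "b = f 0"
  define a where "a = f 1 - b"
  define h where "h z = (f z - b) / a" for z
  have a: "norm a = 1"
    using plane_isometry_dist[OF assms, of 1 0] by (simp add: a_def b_def dist_norm)
  then have a0: "a \<noteq> 0" by auto
  have hd: "norm (h z - h w) = norm (z - w)" for z w
  proof -
    have "h z - h w = (f z - f w) / a" by (simp add: h_def diff_divide_distrib)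
    then show ?thesis
      using plane_isometry_dist[OF assms, of z w] a by (simp add: norm_divide dist_norm)
  qed
  have h0: "h 0 = 0" and h1: "h 1 = 1" using a0 by (simp_all add: h_def b_def a_def)
  have sq: "(Re (h z) - Re (h w))\<^sup>2 + (Im (h z) - Im (h w))\<^sup>2 = (Re z - Re w)\<^sup>2 + (Im z - Im w)\<^sup>2" for z w
    using hd[of z w] by (metis cmod_power2 minus_complex.sel)
  have Re: "Re (h z) = Re z" for z
    using sq[of z 0] sq[of z 1] by (simp add: h0 h1 power2_eq_square algebra_simps)
  have Im2: "(Im (h z))\<^sup>2 = (Im z)\<^sup>2" for z
    using sq[of z 0] by (simp add: h0 Re)
  have ImI: "Im (h z) * Im (h \<i>) = Im z" for z
    using sq[of z \<i>] Im2[of z] Im2[of \<i>] by (simp add: Re power2_eq_square algebra_simps)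
  have "Im (h \<i>) = 1 \<or> Im (h \<i>) = -1" using Im2[of \<i>] by (simp add: power2_eq_1_iff)
  then show ?thesis
  proof
    assume "Im (h \<i>) = 1"
    with ImI Re have hz: "h z = z" for z by (simp add: complex_eq_iff)
    have "f z = a * z + b" for z using hz[of z] a0 by (simp add: h_def field_simps)
    with a show ?thesis by (rule direct)
  next
    assume i: "Im (h \<i>) = -1"
    have "Im (h z) = - Im z" for z using ImI[of z] i by simp
    with Re have hz: "h z = cnj z" for z by (simp add: complex_eq_iff)
    have "f z = a * cnj z + b" for z using hz[of z] a0 by (simp add: h_def field_simps)
    with a show ?thesis by (rule opposite)
  qed
qed

lemma plane_isometry_affine:
  assumes "plane_isometry f"
  shows "f ((1 - u) *\<^sub>R p + u *\<^sub>R q) = (1 - u) *\<^sub>R f p + u *\<^sub>R f q"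
  using assms by (cases rule: plane_isometry_cases) (simp_all add: scaleR_conv_of_real algebra_simps)

lemma plane_isometry_closed_segment:
  assumes "plane_isometry f"
  shows "f ` closed_segment p q = closed_segment (f p) (f q)"
  unfolding closed_segment_def image_Collect
  by (auto simp: plane_isometry_affine[OF assms]) (metis plane_isometry_affine[OF assms])

lemma plane_isometry_collinear_3:
  assumes "plane_isometry f" "collinear {f a, f b, f c}"
  shows "collinear {a, b, c}"
proof -
  have inj: "inj f" using plane_isometry_bij[OF assms(1)] by (rule bij_is_inj)
  from assms(2) consider "f a = f c" | u where "f b = u *\<^sub>R f a + (1 - u) *\<^sub>R f c"
    unfolding collinear_3_expand by blast
  then show ?thesis
  proof cases
    case 1
    with inj have "a = c" by (simp add: inj_eq)
    then show ?thesis unfolding collinear_3_expand by blast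
  next
    case 2
    then have "f b = f (u *\<^sub>R a + (1 - u) *\<^sub>R c)"
      using plane_isometry_affine[OF assms(1), of "1 - u" a c] by simp
    with inj have "b = u *\<^sub>R a + (1 - u) *\<^sub>R c" by (simp add: inj_eq)
    then show ?thesis unfolding collinear_3_expand by blast
  qed
qed

lemma plane_isometry_continuous: "plane_isometry f \<Longrightarrow> continuous_on S f"
  unfolding continuous_on_iff by (auto simp: plane_isometry_dist)

lemma plane_isometry_open_image:
  assumes "plane_isometry f" "open S"
  shows "open (f ` S)"
proof -
  have "f ` S = inv f -` S"
    using plane_isometry_bij[OF assms(1)] by (simp add: bij_vimage_eq_inv_image bij_imp_bij_inv inv_inv_eq)
  then show ?thesis
    using continuous_open_vimage[OF assms(2), of "inv f"]
      plane_isometry_continuous[OF plane_isometry_inv[OF assms(1)], of UNIV]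
    by (simp add: continuous_on_eq_continuous_at)
qed

lemma plane_isometry_interior:
  assumes "plane_isometry f"
  shows "interior (f ` S) = f ` interior S"
proof
  have b: "bij f" using assms by (rule plane_isometry_bij)
  show "f ` interior S \<subseteq> interior (f ` S)"
    by (intro interior_maximal plane_isometry_open_image[OF assms] image_mono interior_subset) simp
  have "inv f ` interior (f ` S) \<subseteq> interior S"
  proof (rule interior_maximal)
    have "inv f ` interior (f ` S) \<subseteq> inv f ` f ` S" by (intro image_mono interior_subset)
    then show "inv f ` interior (f ` S) \<subseteq> S" using b by (simp add: image_inv_f_f bij_is_inj)
    show "open (inv f ` interior (f ` S))"
      by (intro plane_isometry_open_image plane_isometry_inv assms) simp
  qed
  then have "f ` inv f ` interior (f ` S) \<subseteq> f ` interior S" by (rule image_mono)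
  then show "interior (f ` S) \<subseteq> f ` interior S" using b by (simp add: image_f_inv_f bij_is_surj)
qed

lemma plane_isometry_bounded:
  assumes "plane_isometry f" "bounded S"
  shows "bounded (f ` S)"
proof -
  obtain x e where "\<forall>y\<in>S. dist x y \<le> e" using assms(2) unfolding bounded_def by blast
  then have "\<forall>y\<in>f ` S. dist (f x) y \<le> e" using plane_isometry_dist[OF assms(1)] by auto
  then show ?thesis unfolding bounded_def by blast
qed

lemma plane_isometry_inside_subset:
  assumes "plane_isometry f"
  shows "f ` inside S \<subseteq> inside (f ` S)"
proof
  have b: "bij f" using assms by (rule plane_isometry_bij)
  note iv = plane_isometry_inv[OF assms]
  fix y assume "y \<in> f ` inside S"
  then obtain x where x: "y = f x" "x \<notin> S" "bounded (connected_component_set (- S) x)"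
    by (auto simp: inside_def)
  have "connected_component_set (- (f ` S)) y \<subseteq> f ` connected_component_set (- S) x"
  proof
    fix z assume "z \<in> connected_component_set (- (f ` S)) y"
    then obtain U where U: "connected U" "U \<subseteq> - (f ` S)" "y \<in> U" "z \<in> U"
      by (auto simp: connected_component_def)
    have "connected (inv f ` U)"
      by (intro connected_continuous_image plane_isometry_continuous iv U)
    moreover have "inv f ` U \<subseteq> - S"
      using U(2) b by (auto simp: bij_is_surj surj_f_inv_f) (metis ComplD bij_inv_eq_iff imageI subsetD)
    moreover have "x \<in> inv f ` U" using U(3) x(1) b by (metis bij_inv_eq_iff imageI)
    ultimately have "inv f z \<in> connected_component_set (- S) x"
      using U(4) by (auto simp: connected_component_def)
    then show "z \<in> f ` connected_component_set (- S) x"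
      using b by (metis bij_inv_eq_iff imageI)
  qed
  then have "bounded (connected_component_set (- (f ` S)) y)"
    using plane_isometry_bounded[OF assms x(3)] bounded_subset by blast
  moreover have "y \<notin> f ` S" using x b by (simp add: inj_image_mem_iff bij_is_inj)
  ultimately show "y \<in> inside (f ` S)" by (simp add: inside_def)
qed

lemma plane_isometry_inside:
  assumes "plane_isometry f"
  shows "inside (f ` S) = f ` inside S"
proof
  have b: "bij f" using assms by (rule plane_isometry_bij)
  have "inv f ` inside (f ` S) \<subseteq> inside S"
    using plane_isometry_inside_subset[OF plane_isometry_inv[OF assms], of "f ` S"] b
    by (simp add: image_inv_f_f bij_is_inj)
  then have "f ` inv f ` inside (f ` S) \<subseteq> f ` inside S" by (rule image_mono)
  then show "inside (f ` S) \<subseteq> f ` inside S" using b by (simp add: image_f_inv_f bij_is_surj)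
qed (rule plane_isometry_inside_subset[OF assms])

section \<open>Polygons under isometries\<close>

lemma poly_side_map:
  assumes "plane_isometry f" "i < length vs"
  shows "poly_side (map f vs) i = f ` poly_side vs i"
proof -
  have "Suc i mod length vs < length vs" using assms(2) by (rule Suc_mod_less)
  then show ?thesis
    using assms by (simp add: poly_side_def plane_isometry_closed_segment)
qed

lemma side_length_map:
  assumes "plane_isometry f" "i < length vs"
  shows "side_length (map f vs) i = side_length vs i"
proof -
  have "Suc i mod length vs < length vs" using assms(2) by (rule Suc_mod_less)
  then show ?thesis
    using assms by (simp add: side_length_def plane_isometry_dist)
qed

lemma poly_boundary_map:
  assumes "plane_isometry f"
  shows "poly_boundary (map f vs) = f ` poly_boundary vs"
  unfolding poly_boundary_def image_UN by (auto simp: poly_side_map[OF assms])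

lemma poly_region_map:
  assumes "plane_isometry f"
  shows "poly_region (map f vs) = f ` poly_region vs"
  by (simp add: poly_region_def poly_boundary_map plane_isometry_inside image_Un assms)

lemma simple_polygon_map:
  assumes f: "plane_isometry f" and vs: "simple_polygon vs"
  shows "simple_polygon (map f vs)"
proof -
  have inj: "inj f" using plane_isometry_bij[OF f] by (rule bij_is_inj)
  have len: "3 \<le> length vs" using vs by (rule simple_polygon_length)
  have m: "j mod length vs < length vs" for j using len by (intro mod_less_divisor) linarith
  have 1: "poly_side (map f vs) i \<inter> poly_side (map f vs) j
          \<subseteq> {map f vs ! i, map f vs ! (Suc i mod length vs)} \<inter> {map f vs ! j, map f vs ! (Suc j mod length vs)}"
    if "i < length vs" "j < length vs" "i \<noteq> j" for i j
  proof -
    have "f ` (poly_side vs i \<inter> poly_side vs j)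
       \<subseteq> f ` ({vs ! i, vs ! (Suc i mod length vs)} \<inter> {vs ! j, vs ! (Suc j mod length vs)})"
      by (intro image_mono simple_polygon_side_Int vs that)
    then show ?thesis
      using that m by (simp only: poly_side_map[OF f] image_Int[OF inj] image_insert image_empty nth_map)
  qed
  have 2: "\<not> collinear {map f vs ! i, map f vs ! ((i + 1) mod length vs), map f vs ! ((i + 2) mod length vs)}"
    if "i < length vs" for i
  proof -
    have "\<not> collinear {vs ! i, vs ! ((i + 1) mod length vs), vs ! ((i + 2) mod length vs)}"
      using vs that unfolding simple_polygon_def by blast
    then show ?thesis using plane_isometry_collinear_3[OF f] that m by (metis nth_map)
  qed
  have 3: "distinct (map f vs)" using simple_polygon_distinct[OF vs] inj
    by (auto simp: distinct_map intro: inj_on_subset)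
  show ?thesis unfolding simple_polygon_def using 1 2 3 len by simp
qed

section \<open>Centrally symmetric hexagons\<close>

lemma less_6_cases: "i < (6::nat) \<Longrightarrow> i = 0 \<or> i = 1 \<or> i = 2 \<or> i = 3 \<or> i = 4 \<or> i = 5"
  by arith

text \<open>The involutory automorphisms of the 6-cycle are the identity, the half turn and six
  reflections. A reflection fixes two opposite corners or flips two opposite edges, and the identity
  fixes all corners, so only the half turn is left.\<close>

lemma hexagon_cycle_involution:
  fixes p :: "nat \<Rightarrow> nat"
  assumes range: "\<And>i. i < 6 \<Longrightarrow> p i < 6"
    and adj: "\<And>i. i < 6 \<Longrightarrow> p (Suc i mod 6) = Suc (p i) mod 6 \<or> p i = Suc (p (Suc i mod 6)) mod 6"
    and inv: "\<And>i. i < 6 \<Longrightarrow> p (p i) = i"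
    and one_fixed: "\<And>i j. i < 6 \<Longrightarrow> j < 6 \<Longrightarrow> p i = i \<Longrightarrow> p j = j \<Longrightarrow> i = j"
    and one_flipped: "\<And>i j. i < 6 \<Longrightarrow> j < 6 \<Longrightarrow> p i = Suc i mod 6 \<Longrightarrow> p j = Suc j mod 6 \<Longrightarrow> i = j"
  shows "\<forall>i<6. p i = (i + 3) mod 6"
proof -
  have m: "Suc 0 mod 6 = (1::nat)" "Suc 1 mod 6 = (2::nat)" "Suc 2 mod 6 = (3::nat)" "Suc 3 mod 6 = (4::nat)"
    "Suc 4 mod 6 = (5::nat)" by simp_all
  have a: "p 1 = Suc (p 0) mod 6 \<or> p 0 = Suc (p 1) mod 6"
    "p 2 = Suc (p 1) mod 6 \<or> p 1 = Suc (p 2) mod 6"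
    "p 3 = Suc (p 2) mod 6 \<or> p 2 = Suc (p 3) mod 6"
    "p 4 = Suc (p 3) mod 6 \<or> p 3 = Suc (p 4) mod 6"
    "p 5 = Suc (p 4) mod 6 \<or> p 4 = Suc (p 5) mod 6"
    using adj[of 0, unfolded m] adj[of 1, unfolded m] adj[of 2, unfolded m] adj[of 3, unfolded m]
      adj[of 4, unfolded m] by simp_all
  have r: "p 0 < 6" "p 1 < 6" "p 2 < 6" "p 3 < 6" "p 4 < 6" "p 5 < 6"
    using range by auto
  have ne: "p i \<noteq> p j" if "i < 6" "j < 6" "i \<noteq> j" for i j
    using inv that by metis
  have d: "p 0 \<noteq> p 2" "p 1 \<noteq> p 3" "p 2 \<noteq> p 4" "p 3 \<noteq> p 5"
    using ne by simp_all
  have i: "p (p 0) = 0" "p (p 1) = 1" using inv by simp_all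
  have f: "\<not> (p 0 = 0 \<and> p 1 = 1)" "\<not> (p 0 = 0 \<and> p 3 = 3)" "\<not> (p 1 = 1 \<and> p 4 = 4)" "\<not> (p 2 = 2 \<and> p 5 = 5)"
    using one_fixed[of 0 1] one_fixed[of 0 3] one_fixed[of 1 4] one_fixed[of 2 5] by auto
  have g: "\<not> (p 0 = 1 \<and> p 3 = 4)" "\<not> (p 1 = 2 \<and> p 4 = 5)" "\<not> (p 2 = 3 \<and> p 5 = 0)"
    using one_flipped[of 0 3] one_flipped[of 1 4] one_flipped[of 2 5] by auto
  have inj: "u = w" if "Suc u mod 6 = Suc w mod 6" "u < 6" "w < 6" for u w
    using Suc_mod_inj that by metis
  have "p 0 = 3 \<and> p 1 = 4 \<and> p 2 = 5 \<and> p 3 = 0 \<and> p 4 = 1 \<and> p 5 = 2"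
    using a(1)
  proof
    assume 1: "p 1 = Suc (p 0) mod 6"
    \<comment> \<open>Turning back would give \<open>p 2 = p 0\<close>; so the direction of the
      first step is kept all around.\<close>
    have 2: "p 2 = Suc (p 1) mod 6" using a(2) 1 d(1) r inj by metis
    have 3: "p 3 = Suc (p 2) mod 6" using a(3) 2 d(2) r inj by metis
    have 4: "p 4 = Suc (p 3) mod 6" using a(4) 3 d(3) r inj by metis
    have 5: "p 5 = Suc (p 4) mod 6" using a(5) 4 d(4) r inj by metis
    from less_6_cases[OF r(1)] show ?thesis
      using 1 2 3 4 5 i f by (elim disjE) simp_all
  next
    assume 1: "p 0 = Suc (p 1) mod 6"
    have 2: "p 1 = Suc (p 2) mod 6" using a(2) 1 d(1) r by metis
    have 3: "p 2 = Suc (p 3) mod 6" using a(3) 2 d(2) r by metis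
    have 4: "p 3 = Suc (p 4) mod 6" using a(4) 3 d(3) r by metis
    have 5: "p 4 = Suc (p 5) mod 6" using a(5) 4 d(4) r by metis
    from less_6_cases[OF r(6)] show ?thesis
      using 1 2 3 4 5 f g by (elim disjE) simp_all
  qed
  then show ?thesis by (auto dest!: less_6_cases)
qed

text \<open>Symmetry is assumed of the point set only. The half turn permutes its corners and sides,
  hence acts on the indices as an automorphism of the 6-cycle. A fixed corner equals
  \<open>c\<close>, and a side with swapped ends has midpoint \<open>c\<close>, so there is at most
  one of each.\<close>

lemma centrally_symmetric_hexagon_opposite:
  assumes simp: "simple_polygon vs" and len: "length vs = 6"
    and sym: "(\<lambda>z. 2 * c - z) ` poly_region vs = poly_region vs" and i: "i < 6"
  shows "vs ! ((i + 3) mod 6) = 2 * c - vs ! i"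
proof -
  let ?r = "\<lambda>z. 2 * c - z"
  have iso: "plane_isometry ?r" by (rule plane_isometry_point_reflection)
  let ?ws = "map ?r vs"
  have ws: "simple_polygon ?ws" by (rule simple_polygon_map[OF iso simp])
  have eq: "poly_region ?ws = poly_region vs" using poly_region_map[OF iso, of vs] sym by simp
  have corn: "set ?ws = set vs" using corners_poly_region[OF ws] corners_poly_region[OF simp] eq by simp
  have sid: "poly_side ?ws ` {..<6} = poly_side vs ` {..<6}"
    using sides_poly_region[OF ws] sides_poly_region[OF simp] eq len by simp
  have idx: "i = j" if "vs ! i = vs ! j" "i < 6" "j < 6" for i j
    using that simple_polygon_distinct[OF simp] len by (simp add: nth_eq_iff_index_eq)
  have "\<exists>j<6. ?r (vs ! i) = vs ! j" if "i < 6" for i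
  proof -
    have "?ws ! i \<in> set vs" using corn len that by (metis length_map nth_mem)
    then show ?thesis using that len by (auto simp: in_set_conv_nth)
  qed
  then obtain p where p: "\<And>i. i < 6 \<Longrightarrow> p i < 6" "\<And>i. i < 6 \<Longrightarrow> ?r (vs ! i) = vs ! p i" by metis
  have "\<forall>i<6. p i = (i + 3) mod 6"
  proof (rule hexagon_cycle_involution)
    fix i :: nat assume i: "i < 6"
    show "p i < 6" using p i by blast
    have S: "Suc i mod 6 < 6" by simp
    obtain j where j: "j < 6" "poly_side ?ws i = poly_side vs j" using sid i by blast
    have S': "Suc j mod 6 < 6" by simp
    have "{vs ! p i, vs ! p (Suc i mod 6)} = {vs ! j, vs ! (Suc j mod 6)}"
      using j(2) i S len p by (simp add: poly_side_def)
    then have "p i = j \<and> p (Suc i mod 6) = Suc j mod 6 \<or> p i = Suc j mod 6 \<and> p (Suc i mod 6) = j"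
      using idx p(1) i S j S' by (metis doubleton_eq_iff)
    then show "p (Suc i mod 6) = Suc (p i) mod 6 \<or> p i = Suc (p (Suc i mod 6)) mod 6" by auto
    have "vs ! p (p i) = vs ! i" using p(2)[of i] p(2)[of "p i"] p(1)[OF i] i by (metis diff_diff_eq2 add_diff_cancel_left')
    then show "p (p i) = i" using idx p(1) i by blast
  next
    fix i j :: nat assume ij: "i < 6" "j < 6" "p i = i" "p j = j"
    have "vs ! i = c" "vs ! j = c" using p(2)[of i] p(2)[of j] ij by auto
    then show "i = j" using idx ij by metis
  next
    fix i j :: nat assume ij: "i < 6" "j < 6" "p i = Suc i mod 6" "p j = Suc j mod 6"
    have mid: "c \<in> open_segment (vs ! k) (vs ! (Suc k mod 6))" if "k < 6" "p k = Suc k mod 6" for k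
    proof -
      have "vs ! (Suc k mod 6) = 2 * c - vs ! k" using p(2)[OF that(1)] that(2) by simp
      then have "c = midpoint (vs ! k) (vs ! (Suc k mod 6))"
        by (simp add: midpoint_def scaleR_conv_of_real)
      moreover have "vs ! k \<noteq> vs ! (Suc k mod 6)"
        using simple_polygon_side_endpoints_neq[OF simp, of k] that len by simp
      ultimately show ?thesis by simp
    qed
    show "i = j"
    proof (rule ccontr)
      assume "i \<noteq> j"
      then have "poly_side vs i \<inter> poly_side vs j \<subseteq> {vs ! i, vs ! (Suc i mod 6)}"
        using simple_polygon_side_Int[OF simp, of i j] ij len by auto
      moreover have "c \<in> poly_side vs i \<inter> poly_side vs j"
        using mid[of i] mid[of j] ij len by (auto simp: poly_side_def open_segment_def)
      ultimately show False using mid[of i] ij by (auto simp: open_segment_def)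
    qed
  qed
  then show ?thesis using p(2)[OF i] i by simp
qed

section \<open>Existence of an ear\<close>

definition cross2 :: "complex \<Rightarrow> complex \<Rightarrow> real" where
  "cross2 a b = Re a * Im b - Im a * Re b"

lemma cross2_three_vectors:
  "cross2 B C *\<^sub>R A - cross2 A C *\<^sub>R B + cross2 A B *\<^sub>R C = 0"
  by (simp add: complex_eq_iff cross2_def algebra_simps)

lemma hexagon_sides_cross:
  fixes A B C :: complex
  defines "x \<equiv> cross2 A B" and "y \<equiv> cross2 B C" and "z \<equiv> cross2 A C"
  assumes "0 \<le> x \<and> 0 \<le> y \<and> \<bar>x - y\<bar> < - z \<or> x \<le> 0 \<and> y \<le> 0 \<and> \<bar>x - y\<bar> < z"
  shows "closed_segment A B \<inter> closed_segment (- B) (- C) \<noteq> {}"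
proof -
  \<comment> \<open>The point at parameter \<open>s\<close> of the first segment is the point at
    parameter \<open>t\<close> of the second if \<open>(1 - s) A + (1 + s - t) B + t C = 0\<close>.
    Comparing with \<open>cross2_three_vectors\<close>, the coefficients are taken proportional to
    \<open>y\<close>, \<open>- z\<close>, \<open>x\<close>; as they sum to 2, the factor is
    \<open>2 / d\<close>. The hypothesis on \<open>x\<close>, \<open>y\<close>, \<open>z\<close>
    puts \<open>s\<close> and \<open>t\<close> into the unit interval.\<close>
  define d where "d = x + y - z"
  define s where "s = (x - y - z) / d"
  define t where "t = 2 * x / d"
  have d: "d \<noteq> 0" using assms(4) by (auto simp: d_def)
  have st: "0 \<le> s" "s \<le> 1" "0 \<le> t" "t \<le> 1"
    using assms(4) unfolding s_def t_def d_def
    by (auto simp: divide_simps abs_if split: if_splits)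
  have "d *\<^sub>R ((1 - s) *\<^sub>R A + s *\<^sub>R B) = (d - d * s) *\<^sub>R A + (d * s) *\<^sub>R B"
    by (simp add: algebra_simps)
  also have "\<dots> = (2 * y) *\<^sub>R A + (x - y - z) *\<^sub>R B"
    using d by (simp add: s_def) (simp add: d_def)
  also have "\<dots> = (2 * y) *\<^sub>R A + (x - y - z) *\<^sub>R B - 2 *\<^sub>R (y *\<^sub>R A - z *\<^sub>R B + x *\<^sub>R C)"
    using cross2_three_vectors[of B C A] by (simp add: x_def y_def z_def)
  also have "\<dots> = (d - 2 * x) *\<^sub>R (- B) + (2 * x) *\<^sub>R (- C)"
    by (simp add: d_def complex_eq_iff algebra_simps)
  also have "\<dots> = d *\<^sub>R ((1 - t) *\<^sub>R (- B) + t *\<^sub>R (- C))"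
    using d by (simp add: t_def scaleR_add_right algebra_simps)
  finally have "(1 - s) *\<^sub>R A + s *\<^sub>R B = (1 - t) *\<^sub>R (- B) + t *\<^sub>R (- C)"
    using d by (metis scaleR_cancel_left)
  then have "(1 - s) *\<^sub>R A + s *\<^sub>R B \<in> closed_segment A B \<inter> closed_segment (- B) (- C)"
    using st unfolding in_segment Int_iff by blast
  then show ?thesis by blast
qed

text \<open>With the centre at 0, the quotient is the height of \<open>B\<close> when 0 has height 0
  and the line through \<open>A\<close> and \<open>C\<close> has height 1. Thus \<open>B\<close>
  lies beyond that line as seen from the centre.\<close>

definition ear :: "complex \<Rightarrow> complex \<Rightarrow> complex \<Rightarrow> bool" where
  "ear A B C \<longleftrightarrow> cross2 A C \<noteq> 0 \<and> 1 < (cross2 A B + cross2 B C) / cross2 A C"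

text \<open>Moving on by one corner permutes the cross products \<open>x\<close>, \<open>y\<close>,
  \<open>z\<close> cyclically. If all are positive, failure of two ear conditions gives, say,
  \<open>x + y < z\<close> and \<open>y + z < x\<close>, whose sum is absurd. If the signs are
  mixed, say \<open>x\<close> and \<open>y\<close> are positive and \<open>z\<close> is negative,
  failure of the conditions at the other two corners gives \<open>\<bar>x - y\<bar> < - z\<close>,
  and two sides cross. The last three assumptions exclude equality, and nonzero vectors exclude that
  just two of the products vanish.\<close>

lemma symmetric_hexagon_has_ear:
  fixes A B C :: complex
  assumes "closed_segment A B \<inter> closed_segment (- B) (- C) = {}"
    and "closed_segment B C \<inter> closed_segment (- C) A = {}"
    and "closed_segment C (- A) \<inter> closed_segment A B = {}"
    and "A \<noteq> 0" "B \<noteq> 0" "C \<noteq> 0"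
    and "cross2 A B + cross2 B C \<noteq> cross2 A C" "cross2 B C + cross2 A C \<noteq> cross2 A B"
      "cross2 A C + cross2 A B \<noteq> cross2 B C"
  shows "ear A B C \<or> ear B C (- A) \<or> ear C (- A) (- B)"
proof -
  define x where "x = cross2 A B"
  define y where "y = cross2 B C"
  define z where "z = cross2 A C"
  have r: "cross2 B C = y" "cross2 C (- A) = z" "cross2 B (- A) = x"
    "cross2 (- A) (- B) = x" "cross2 C (- B) = y"
    by (simp_all add: x_def y_def z_def cross2_def)
  note 1 = hexagon_sides_cross[of A B C, folded x_def y_def z_def]
  note 2 = hexagon_sides_cross[of B C "- A", unfolded r]
  note 3 = hexagon_sides_cross[of C "- A" "- B", unfolded r]
  have n: "\<not> (0 \<le> x \<and> 0 \<le> y \<and> \<bar>x - y\<bar> < - z \<or> x \<le> 0 \<and> y \<le> 0 \<and> \<bar>x - y\<bar> < z)"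
    "\<not> (0 \<le> y \<and> 0 \<le> z \<and> \<bar>y - z\<bar> < - x \<or> y \<le> 0 \<and> z \<le> 0 \<and> \<bar>y - z\<bar> < x)"
    "\<not> (0 \<le> z \<and> 0 \<le> x \<and> \<bar>z - x\<bar> < - y \<or> z \<le> 0 \<and> x \<le> 0 \<and> \<bar>z - x\<bar> < y)"
    using 1 2 3 assms(1-3) by auto
  have v: "y *\<^sub>R A - z *\<^sub>R B + x *\<^sub>R C = 0"
    unfolding x_def y_def z_def by (rule cross2_three_vectors)
  have d: "y = 0 \<Longrightarrow> z = 0 \<Longrightarrow> x = 0" "y = 0 \<Longrightarrow> x = 0 \<Longrightarrow> z = 0" "x = 0 \<Longrightarrow> z = 0 \<Longrightarrow> y = 0"
    using v assms(4-6) by auto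
  have e: "(u / w > 1) = (w > 0 \<and> u > w \<or> w < 0 \<and> u < w)" for u w :: real
    by (auto simp: less_divide_eq)
  have g: "x + y \<noteq> z" "y + z \<noteq> x" "z + x \<noteq> y"
    using assms(7-9) by (auto simp: x_def y_def z_def)
  have "z \<noteq> 0 \<and> (x + y) / z > 1 \<or> x \<noteq> 0 \<and> (y + z) / x > 1 \<or> y \<noteq> 0 \<and> (z + x) / y > 1"
    unfolding e using n d g by (smt (verit))
  then show ?thesis unfolding ear_def r by (simp add: x_def y_def z_def)
qed

section \<open>Lattice translates of a hexagon with an ear\<close>

lemma abs_le_add_if_abs_diff_le:
  fixes u v :: real
  assumes "\<bar>u\<bar> \<le> a" "\<bar>u - v\<bar> \<le> b"
  shows "\<bar>v\<bar> \<le> a + b"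
  using assms by linarith

text \<open>Affine coordinates with origin at the centre \<open>c\<close> in which cutting off the
  ears leaves the rectangle of width 1 between the heights -1 and 1. The apex of the upper ear is at
  \<open>(\<beta>, h)\<close>; \<open>\<beta>\<close> is arbitrary, so the apex need not lie above
  the cut.\<close>

locale ear_hexagon =
  fixes c e1 e2 :: complex and \<beta> h :: real
  assumes cross_nz: "cross2 e1 e2 \<noteq> 0" and h_gt_1: "1 < h"
begin

definition pt :: "real \<Rightarrow> real \<Rightarrow> complex" where
  "pt x y = c + x *\<^sub>R e1 + y *\<^sub>R e2"

definition X :: "complex \<Rightarrow> real" where
  "X z = cross2 (z - c) e2 / cross2 e1 e2"

definition Y :: "complex \<Rightarrow> real" where
  "Y z = cross2 e1 (z - c) / cross2 e1 e2"

lemma X_pt [simp]: "X (pt x y) = x"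
  using cross_nz unfolding X_def pt_def by (simp add: divide_eq_eq) (simp add: cross2_def algebra_simps)

lemma Y_pt [simp]: "Y (pt x y) = y"
  using cross_nz unfolding Y_def pt_def by (simp add: divide_eq_eq) (simp add: cross2_def algebra_simps)

lemma pt_X_Y [simp]: "pt (X z) (Y z) = z"
proof -
  have "cross2 e1 e2 *\<^sub>R (pt (X z) (Y z) - z) =
      cross2 (z - c) e2 *\<^sub>R e1 + cross2 e1 (z - c) *\<^sub>R e2 - cross2 e1 e2 *\<^sub>R (z - c)"
    using cross_nz by (simp add: pt_def X_def Y_def scaleR_add_right scaleR_diff_right)
  also have "\<dots> = 0" by (simp add: complex_eq_iff cross2_def algebra_simps)
  finally show ?thesis using cross_nz by simp
qed

lemma pt_eq_iff [simp]: "pt x y = pt x' y' \<longleftrightarrow> x = x' \<and> y = y'"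
  by (metis X_pt Y_pt)

lemma pt_add: "pt x y + (u *\<^sub>R e1 + v *\<^sub>R e2) = pt (x + u) (y + v)"
  by (simp add: pt_def algebra_simps)

lemma pt_diff: "pt x y - (u *\<^sub>R e1 + v *\<^sub>R e2) = pt (x - u) (y - v)"
  by (simp add: pt_def algebra_simps)

lemma continuous_X [continuous_intros]: "continuous_on S X"
  using cross_nz unfolding X_def cross2_def by (intro continuous_intros) auto

lemma continuous_Y [continuous_intros]: "continuous_on S Y"
  using cross_nz unfolding Y_def cross2_def by (intro continuous_intros) auto

lemma pt_segment:
  "closed_segment (pt x y) (pt x' y') = {pt ((1 - u) * x + u * x') ((1 - u) * y + u * y') |u. 0 \<le> u \<and> u \<le> 1}"
proof -
  have "(1 - u) *\<^sub>R pt x y + u *\<^sub>R pt x' y' = pt ((1 - u) * x + u * x') ((1 - u) * y + u * y')" for u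
    by (simp add: pt_def algebra_simps)
  then show ?thesis unfolding closed_segment_def by simp
qed

text \<open>Signed progress from a cut to its apex: 0 on the parallelogram, 1 at height
  \<open>h\<close>, -1 at height \<open>- h\<close>. Clamping \<open>y\<close> gives one continuous
  formula for all three parts of the hexagon.\<close>

definition tau :: "real \<Rightarrow> real" where
  "tau y = (y - max (-1) (min 1 y)) / (h - 1)"

lemma continuous_tau [continuous_intros]: "continuous_on S f \<Longrightarrow> continuous_on S (\<lambda>z. tau (f z))"
  using h_gt_1 unfolding tau_def by (intro continuous_intros) auto

lemma tau_upper: "1 \<le> y \<Longrightarrow> tau y = (y - 1) / (h - 1)"
  and tau_middle: "-1 \<le> y \<Longrightarrow> y \<le> 1 \<Longrightarrow> tau y = 0"
  and tau_lower: "y \<le> -1 \<Longrightarrow> tau y = (y + 1) / (h - 1)"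
  by (simp_all add: tau_def max_def min_def)

lemma tau_uminus: "tau (- y) = - tau y"
  using h_gt_1 by (auto simp: tau_def max_def min_def field_simps)

lemma abs_tau_le_1_iff: "\<bar>tau y\<bar> \<le> 1 \<longleftrightarrow> \<bar>y\<bar> \<le> h"
  using h_gt_1 by (auto simp: tau_def max_def min_def abs_if divide_simps split: if_splits)

lemma tau_upper_bounds: "1 \<le> y \<Longrightarrow> 0 \<le> tau y"
  and tau_upper_1: "1 \<le> y \<Longrightarrow> y \<le> h \<Longrightarrow> tau y \<le> 1"
  using h_gt_1 by (simp_all add: tau_upper)

text \<open>The cross section at height \<open>y\<close> is an interval with midpoint
  \<open>\<beta> * tau y\<close> and length \<open>1 - \<bar>tau y\<bar>\<close>: full width on the
  parallelogram, a point at the apexes.\<close>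

definition hex :: "real \<Rightarrow> real \<Rightarrow> bool" where
  "hex x y \<longleftrightarrow> \<bar>x - \<beta> * tau y\<bar> \<le> (1 - \<bar>tau y\<bar>) / 2"

lemma hex_uminus: "hex (- x) (- y) \<longleftrightarrow> hex x y"
proof -
  have "- x - \<beta> * tau (- y) = - (x - \<beta> * tau y)" by (simp add: tau_uminus)
  then show ?thesis by (simp only: hex_def tau_uminus abs_minus_cancel)
qed

lemma hex_imp_abs_tau_le: "hex x y \<Longrightarrow> \<bar>tau y\<bar> \<le> 1"
  unfolding hex_def using order_trans[OF abs_ge_zero, of "x - \<beta> * tau y" "(1 - \<bar>tau y\<bar>) / 2"] by simp

lemma hex_imp_abs_le: "hex x y \<Longrightarrow> \<bar>y\<bar> \<le> h"
  using hex_imp_abs_tau_le abs_tau_le_1_iff by blast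

definition vertices :: "complex list" where
  "vertices = [pt (1/2) 1, pt \<beta> h, pt (-1/2) 1, pt (-1/2) (-1), pt (-\<beta>) (-h), pt (1/2) (-1)]"

lemma length_vertices [simp]: "length vertices = 6"
  by (simp add: vertices_def)

lemma poly_side_vertices:
  "poly_side vertices 0 = closed_segment (pt (1/2) 1) (pt \<beta> h)"
  "poly_side vertices 1 = closed_segment (pt \<beta> h) (pt (-1/2) 1)"
  "poly_side vertices 2 = closed_segment (pt (-1/2) 1) (pt (-1/2) (-1))"
  "poly_side vertices 3 = closed_segment (pt (-1/2) (-1)) (pt (-\<beta>) (-h))"
  "poly_side vertices 4 = closed_segment (pt (-\<beta>) (-h)) (pt (1/2) (-1))"
  "poly_side vertices 5 = closed_segment (pt (1/2) (-1)) (pt (1/2) 1)"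
  by (simp_all add: poly_side_def vertices_def)

text \<open>The value 1 of \<open>k\<close> gives the right side of the upper ear, -1 the left
  one.\<close>

lemma pt_in_slanted_segment:
  "pt x y \<in> closed_segment (pt (k / 2) 1) (pt \<beta> h) \<longleftrightarrow>
    1 \<le> y \<and> y \<le> h \<and> x - \<beta> * tau y = k * (1 - tau y) / 2"
proof
  assume "pt x y \<in> closed_segment (pt (k / 2) 1) (pt \<beta> h)"
  then obtain u where u: "0 \<le> u" "u \<le> 1" "x = (1 - u) * (k / 2) + u * \<beta>" "y = (1 - u) * 1 + u * h"
    unfolding pt_segment by auto
  have y: "y = 1 + u * (h - 1)" using u(4) by (simp add: algebra_simps)
  have "0 \<le> u * (h - 1)" "u * (h - 1) \<le> 1 * (h - 1)"
    using u(1,2) h_gt_1 by (simp, intro mult_right_mono) auto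
  then have yb: "1 \<le> y" "y \<le> h" using y by auto
  then have "tau y = u" using h_gt_1 y by (simp add: tau_upper)
  with yb u(3) show "1 \<le> y \<and> y \<le> h \<and> x - \<beta> * tau y = k * (1 - tau y) / 2"
    by (simp add: algebra_simps)
next
  assume a: "1 \<le> y \<and> y \<le> h \<and> x - \<beta> * tau y = k * (1 - tau y) / 2"
  then have "x = (1 - tau y) * (k / 2) + tau y * \<beta>" by (simp add: field_simps)
  moreover have "y = (1 - tau y) * 1 + tau y * h"
  proof -
    have "tau y * (h - 1) = y - 1" using a h_gt_1 by (simp add: tau_upper)
    then show ?thesis by (simp add: algebra_simps)
  qed
  ultimately show "pt x y \<in> closed_segment (pt (k / 2) 1) (pt \<beta> h)"
    unfolding pt_segment using tau_upper_bounds tau_upper_1 a by auto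
qed

lemma pt_in_segment_uminus:
  "pt x y \<in> closed_segment (pt (- a) (- b)) (pt (- a') (- b')) \<longleftrightarrow> pt (- x) (- y) \<in> closed_segment (pt a b) (pt a' b')"
proof -
  have "(x = (1 - u) * - a + u * - a') = (- x = (1 - u) * a + u * a')"
    "(y = (1 - u) * - b + u * - b') = (- y = (1 - u) * b + u * b')" for u
    by (auto simp: algebra_simps)
  then show ?thesis unfolding pt_segment by simp
qed

lemma pt_in_vertical_segment:
  "pt x y \<in> closed_segment (pt a 1) (pt a (-1)) \<longleftrightarrow> -1 \<le> y \<and> y \<le> 1 \<and> x = a"
proof
  assume "pt x y \<in> closed_segment (pt a 1) (pt a (-1))"
  then obtain u where u: "0 \<le> u" "u \<le> 1" "x = (1 - u) * a + u * a" "y = (1 - u) * 1 + u * (-1)"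
    unfolding pt_segment by auto
  then show "-1 \<le> y \<and> y \<le> 1 \<and> x = a" by (simp add: algebra_simps)
next
  assume a: "-1 \<le> y \<and> y \<le> 1 \<and> x = a"
  then have "x = (1 - (1 - y) / 2) * a + (1 - y) / 2 * a" "y = (1 - (1 - y) / 2) * 1 + (1 - y) / 2 * (-1)"
    "0 \<le> (1 - y) / 2" "(1 - y) / 2 \<le> 1" by (simp_all add: field_simps)
  then show "pt x y \<in> closed_segment (pt a 1) (pt a (-1))"
    unfolding pt_segment mem_Collect_eq pt_eq_iff by blast
qed

lemma pt_in_side:
  "pt x y \<in> poly_side vertices 0 \<longleftrightarrow> 1 \<le> y \<and> y \<le> h \<and> x - \<beta> * tau y = (1 - tau y) / 2"
  "pt x y \<in> poly_side vertices 1 \<longleftrightarrow> 1 \<le> y \<and> y \<le> h \<and> x - \<beta> * tau y = - (1 - tau y) / 2"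
  "pt x y \<in> poly_side vertices 2 \<longleftrightarrow> -1 \<le> y \<and> y \<le> 1 \<and> x = - 1 / 2"
  "pt x y \<in> poly_side vertices 3 \<longleftrightarrow> y \<le> -1 \<and> -h \<le> y \<and> x - \<beta> * tau y = - (1 + tau y) / 2"
  "pt x y \<in> poly_side vertices 4 \<longleftrightarrow> y \<le> -1 \<and> -h \<le> y \<and> x - \<beta> * tau y = (1 + tau y) / 2"
  "pt x y \<in> poly_side vertices 5 \<longleftrightarrow> -1 \<le> y \<and> y \<le> 1 \<and> x = 1 / 2"
proof -
  show "pt x y \<in> poly_side vertices 0 \<longleftrightarrow> 1 \<le> y \<and> y \<le> h \<and> x - \<beta> * tau y = (1 - tau y) / 2"
    unfolding poly_side_vertices using pt_in_slanted_segment[of x y 1] by simp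
  show "pt x y \<in> poly_side vertices 1 \<longleftrightarrow> 1 \<le> y \<and> y \<le> h \<and> x - \<beta> * tau y = - (1 - tau y) / 2"
    unfolding poly_side_vertices closed_segment_commute[of "pt \<beta> h"]
    using pt_in_slanted_segment[of x y "-1"] by simp
  show "pt x y \<in> poly_side vertices 2 \<longleftrightarrow> -1 \<le> y \<and> y \<le> 1 \<and> x = - 1 / 2"
    unfolding poly_side_vertices by (rule pt_in_vertical_segment)
  show "pt x y \<in> poly_side vertices 5 \<longleftrightarrow> -1 \<le> y \<and> y \<le> 1 \<and> x = 1 / 2"
    unfolding poly_side_vertices closed_segment_commute[of "pt (1/2) (-1)"] by (rule pt_in_vertical_segment)
  have eq: "(- x - \<beta> * tau (- y) = r) = (x - \<beta> * tau y = - r)" for r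
    by (auto simp: tau_uminus)
  have "pt x y \<in> poly_side vertices 3 \<longleftrightarrow> 1 \<le> - y \<and> - y \<le> h \<and> - x - \<beta> * tau (- y) = (1 - tau (- y)) / 2"
    unfolding poly_side_vertices
    using pt_in_slanted_segment[of "-x" "-y" 1] pt_in_segment_uminus[of x y "1/2" 1 \<beta> h] by simp
  then show "pt x y \<in> poly_side vertices 3 \<longleftrightarrow> y \<le> -1 \<and> -h \<le> y \<and> x - \<beta> * tau y = - (1 + tau y) / 2"
    unfolding eq by (simp add: tau_uminus minus_divide_left) auto
  have "pt x y \<in> poly_side vertices 4 \<longleftrightarrow> 1 \<le> - y \<and> - y \<le> h \<and> - x - \<beta> * tau (- y) = - (1 - tau (- y)) / 2"
    unfolding poly_side_vertices closed_segment_commute[of "pt (-\<beta>) (-h)"]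
    using pt_in_slanted_segment[of "-x" "-y" "-1"] pt_in_segment_uminus[of x y "-1/2" 1 \<beta> h] by simp
  then show "pt x y \<in> poly_side vertices 4 \<longleftrightarrow> y \<le> -1 \<and> -h \<le> y \<and> x - \<beta> * tau y = (1 + tau y) / 2"
    unfolding eq by (simp add: tau_uminus minus_divide_left) auto
qed

lemma side_imp_hex_boundary:
  "pt x y \<in> poly_side vertices i \<Longrightarrow> i < 6 \<Longrightarrow> \<bar>x - \<beta> * tau y\<bar> = (1 - \<bar>tau y\<bar>) / 2"
proof -
  have l: "y \<le> -1 \<Longrightarrow> -h \<le> y \<Longrightarrow> tau y \<le> 0 \<and> -1 \<le> tau y"
    using tau_upper_bounds[of "-y"] tau_upper_1[of "-y"] by (simp add: tau_uminus)
  show "pt x y \<in> poly_side vertices i \<Longrightarrow> i < 6 \<Longrightarrow> \<bar>x - \<beta> * tau y\<bar> = (1 - \<bar>tau y\<bar>) / 2"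
    by (elim less_6_cases[THEN disjE] disjE; hypsubst; unfold pt_in_side)
      (use tau_upper_bounds[of y] tau_upper_1[of y] tau_middle[of y] l in auto)
qed

lemma boundary_iff:
  "pt x y \<in> poly_boundary vertices \<longleftrightarrow> \<bar>x - \<beta> * tau y\<bar> = (1 - \<bar>tau y\<bar>) / 2"
proof
  assume "pt x y \<in> poly_boundary vertices"
  then show "\<bar>x - \<beta> * tau y\<bar> = (1 - \<bar>tau y\<bar>) / 2"
    using side_imp_hex_boundary by (auto simp: poly_boundary_def)
next
  assume a: "\<bar>x - \<beta> * tau y\<bar> = (1 - \<bar>tau y\<bar>) / 2"
  then have "hex x y" by (simp add: hex_def)
  then have yh: "\<bar>y\<bar> \<le> h" by (rule hex_imp_abs_le)
  consider "1 \<le> y" | "-1 \<le> y" "y \<le> 1" | "y \<le> -1" by linarith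
  then have "\<exists>i<6. pt x y \<in> poly_side vertices i"
  proof cases
    case 1
    then have "pt x y \<in> poly_side vertices 0 \<or> pt x y \<in> poly_side vertices 1"
      using a yh tau_upper_bounds[OF 1] unfolding pt_in_side by (auto simp: abs_if split: if_splits)
    then show ?thesis by (auto intro: exI[of _ 0] exI[of _ 1])
  next
    case 2
    then have "pt x y \<in> poly_side vertices 2 \<or> pt x y \<in> poly_side vertices 5"
      using a tau_middle[OF 2] unfolding pt_in_side by (auto simp: abs_if split: if_splits)
    then show ?thesis by (auto intro: exI[of _ 2] exI[of _ 5])
  next
    case 3
    then have "0 \<le> tau (- y)" by (intro tau_upper_bounds) simp
    then have "tau y \<le> 0" by (simp add: tau_uminus)
    with 3 have "pt x y \<in> poly_side vertices 3 \<or> pt x y \<in> poly_side vertices 4"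
      using a yh unfolding pt_in_side by (auto simp: abs_if split: if_splits)
    then show ?thesis by (auto intro: exI[of _ 3] exI[of _ 4])
  qed
  then show "pt x y \<in> poly_boundary vertices" by (auto simp: poly_boundary_def)
qed

text \<open>The boundary is the zero set of the continuous function \<open>G\<close>. The set where
  \<open>G\<close> is negative is bounded, so components in it are inside. From a point where
  \<open>G\<close> is positive, the horizontal ray away from the midpoint of the cross section never
  meets the boundary, so the point is not inside.\<close>

lemma poly_region_iff: "pt x y \<in> poly_region vertices \<longleftrightarrow> hex x y"
proof -
  let ?B = "poly_boundary vertices"
  define G where "G z = \<bar>X z - \<beta> * tau (Y z)\<bar> - (1 - \<bar>tau (Y z)\<bar>) / 2" for z
  have contG: "continuous_on UNIV G" unfolding G_def by (intro continuous_intros) auto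
  have B: "?B = {z. G z = 0}"
    using boundary_iff[of "X z" "Y z" for z] by (auto simp: G_def)
  let ?U = "{z. G z < 0}" and ?V = "{z. G z > 0}"
  have opn: "open ?U" "open ?V" using contG by (auto intro!: open_Collect_less continuous_intros)
  have "bounded ?U"
  proof -
    have "?U \<subseteq> (\<lambda>(x, y). pt x y) ` ({- (1/2) - \<bar>\<beta>\<bar>..1/2 + \<bar>\<beta>\<bar>} \<times> {-h..h})"
    proof
      fix z assume "z \<in> ?U"
      then have z: "\<bar>X z - \<beta> * tau (Y z)\<bar> \<le> (1 - \<bar>tau (Y z)\<bar>) / 2" by (simp add: G_def)
      then have "\<bar>tau (Y z)\<bar> \<le> 1" using hex_imp_abs_tau_le[of "X z" "Y z"] by (simp add: hex_def)
      then have yb: "\<bar>Y z\<bar> \<le> h" by (simp add: abs_tau_le_1_iff)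
      have "\<bar>\<beta> * tau (Y z)\<bar> \<le> \<bar>\<beta>\<bar> * 1"
        using \<open>\<bar>tau (Y z)\<bar> \<le> 1\<close> unfolding abs_mult by (intro mult_left_mono) auto
      moreover have "\<bar>\<beta> * tau (Y z) - X z\<bar> \<le> 1/2"
        using z abs_ge_zero[of "tau (Y z)"] by (subst abs_minus_commute) argo
      ultimately have "\<bar>X z\<bar> \<le> 1/2 + \<bar>\<beta>\<bar>"
        using abs_le_add_if_abs_diff_le by fastforce
      with yb have "(X z, Y z) \<in> {- (1/2) - \<bar>\<beta>\<bar>..1/2 + \<bar>\<beta>\<bar>} \<times> {-h..h}" by (auto simp: abs_le_iff)
      then show "z \<in> (\<lambda>(x, y). pt x y) ` ({- (1/2) - \<bar>\<beta>\<bar>..1/2 + \<bar>\<beta>\<bar>} \<times> {-h..h})"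
        by (intro image_eqI[where x = "(X z, Y z)"]) auto
    qed
    moreover have "compact ((\<lambda>(x, y). pt x y) ` ({- (1/2) - \<bar>\<beta>\<bar>..1/2 + \<bar>\<beta>\<bar>} \<times> {-h..h}))"
      unfolding pt_def case_prod_unfold
      by (intro compact_continuous_image compact_Times continuous_intros) auto
    ultimately show ?thesis using compact_imp_bounded bounded_subset by blast
  qed
  have inU: "z \<in> inside ?B" if "G z < 0" for z
  proof -
    have "connected_component_set (- ?B) z \<subseteq> ?U"
    proof (rule ccontr)
      assume n: "\<not> ?thesis"
      let ?C = "connected_component_set (- ?B) z"
      have "?C \<subseteq> - ?B" by (rule connected_component_subset)
      then have "?C \<subseteq> ?U \<union> ?V" by (auto simp: B)
      moreover have "z \<in> ?C" using that by (simp add: B connected_component_refl_eq)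
      ultimately show False
        using connectedD[OF connected_connected_component[of "- ?B" z] opn] n that by fastforce
    qed
    with \<open>bounded ?U\<close> have "bounded (connected_component_set (- ?B) z)" using bounded_subset by blast
    then show ?thesis using that by (simp add: inside_def B)
  qed
  have outV: "z \<notin> inside ?B" if "G z > 0" for z
  proof
    assume "z \<in> inside ?B"
    then have bd: "bounded (connected_component_set (- ?B) z)" by (simp add: inside_def)
    define s :: real where "s = (if X z \<ge> \<beta> * tau (Y z) then 1 else -1)"
    define R where "R = (\<lambda>t. pt (X z + s * t) (Y z)) ` {0..}"
    have "connected R" unfolding R_def pt_def
      by (intro connected_continuous_image continuous_intros) (simp add: convex_connected)
    moreover have "R \<subseteq> - ?B"
      using that by (auto simp: R_def B G_def s_def abs_if split: if_splits)
    moreover have "z \<in> R" unfolding R_def by (rule image_eqI[of _ _ 0]) auto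
    ultimately have "R \<subseteq> connected_component_set (- ?B) z"
      by (simp add: connected_component_maximal)
    with bd have "bounded R" using bounded_subset by blast
    then obtain M where M: "\<And>w. w \<in> R \<Longrightarrow> norm w \<le> M" unfolding bounded_iff by blast
    have e1: "e1 \<noteq> 0" using cross_nz by (auto simp: cross2_def)
    \<comment> \<open>A displacement of length \<open>2 * \<bar>M\<bar> + 1\<close> cannot join two
      points of norm at most \<open>M\<close>.\<close>
    define t where "t = (2 * \<bar>M\<bar> + 1) / norm e1"
    have t: "0 \<le> t" "t * norm e1 = 2 * \<bar>M\<bar> + 1" using e1 by (auto simp: t_def)
    have "pt (X z + s * t) (Y z) \<in> R" using t by (auto simp: R_def)
    then have "norm (pt (X z + s * t) (Y z) - z) \<le> 2 * \<bar>M\<bar>"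
      using M[of "pt (X z + s * t) (Y z)"] M[OF \<open>z \<in> R\<close>] norm_triangle_ineq4[of "pt (X z + s * t) (Y z)" z] by linarith
    moreover have "pt (X z + s * t) (Y z) - z = (s * t) *\<^sub>R e1"
      using pt_add[of "X z" "Y z" "s * t" 0] by (simp add: algebra_simps)
    moreover have "norm ((s * t) *\<^sub>R e1) = t * norm e1" using t by (simp add: s_def abs_mult)
    ultimately show False using t(2) by simp
  qed
  have "pt x y \<in> poly_region vertices \<longleftrightarrow> G (pt x y) \<le> 0"
    unfolding poly_region_def using inU[of "pt x y"] outV[of "pt x y"] B by force
  then show ?thesis by (simp add: G_def hex_def)
qed

text \<open>\<open>lat 1 0\<close> moves the left side of the parallelogram onto the right one.
  \<open>lat 0 1\<close> moves side 3, on the lower ear, onto side 0, on the upper ear: it takes the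
  corner at \<open>(-1/2, -1)\<close> to the apex \<open>(\<beta>, h)\<close>.\<close>

definition lat :: "int \<Rightarrow> int \<Rightarrow> complex" where
  "lat k n = (k + n * (1/2 + \<beta>)) *\<^sub>R e1 + (n * (1 + h)) *\<^sub>R e2"

lemma tau_shift:
  assumes "1 \<le> y" "y \<le> h" shows "tau (y - (1 + h)) = tau y - 1"
  using assms h_gt_1 by (simp add: tau_upper tau_lower field_simps)

lemma hex_upper: "1 \<le> y \<Longrightarrow> y \<le> h \<Longrightarrow> hex x y \<longleftrightarrow> \<bar>x - \<beta> * tau y\<bar> \<le> (1 - tau y) / 2"
  using tau_upper_bounds by (simp add: hex_def)

text \<open>In the coordinate \<open>x - \<beta> * tau y\<close> the upper ears of one row have
  centres at the integers and width \<open>1 - tau y\<close>. By this lemma the lower ears of the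
  next row have centres halfway between and width \<open>tau y\<close>. So the two kinds of
  intervals alternate and fill the line.\<close>

lemma hex_upper_shifted:
  assumes "1 \<le> y" "y \<le> h"
  shows "hex (x - (k + (1/2 + \<beta>))) (y - (1 + h)) \<longleftrightarrow> \<bar>x - \<beta> * tau y - (k + 1/2)\<bar> \<le> tau y / 2"
proof -
  have "x - (k + (1/2 + \<beta>)) - \<beta> * (tau y - 1) = x - \<beta> * tau y - (k + 1/2)"
    by (simp add: algebra_simps)
  moreover have "1 - \<bar>tau y - 1\<bar> = tau y"
    using tau_upper_bounds[OF assms(1)] tau_upper_1[OF assms] by simp
  ultimately show ?thesis unfolding hex_def tau_shift[OF assms] by (simp only:)
qed

text \<open>The half widths add up to 1/2, while the centres are at distance at least 1/2. So the
  two sections can only touch in an endpoint, and only for the two nearest centres.\<close>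

lemma hex_overlap_upper:
  fixes k :: int
  assumes "hex x y" "hex (x - (k + (1/2 + \<beta>))) (y - (1 + h))"
  shows "k = 0 \<and> pt x y \<in> poly_side vertices 0 \<or> k = -1 \<and> pt x y \<in> poly_side vertices 1"
proof -
  have y: "1 \<le> y" "y \<le> h" using hex_imp_abs_le[OF assms(1)] hex_imp_abs_le[OF assms(2)] by auto
  define r where "r = x - \<beta> * tau y"
  have 1: "\<bar>r\<bar> \<le> (1 - tau y) / 2" using assms(1) hex_upper[OF y] by (simp add: r_def)
  have 2: "\<bar>r - (k + 1/2)\<bar> \<le> tau y / 2" using assms(2) hex_upper_shifted[OF y] by (simp add: r_def)
  have "\<bar>real_of_int k + 1/2\<bar> \<le> (1 - tau y) / 2 + tau y / 2"
    using 1 2 by (rule abs_le_add_if_abs_diff_le)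
  also have "\<dots> = 1/2" by (simp add: field_simps)
  finally have "real_of_int k \<le> 0" "-1 \<le> real_of_int k" unfolding abs_le_iff by auto
  then have "k = 0 \<or> k = -1" by linarith
  then show ?thesis
  proof
    assume "k = 0"
    with 1 2 have "r = (1 - tau y) / 2" unfolding abs_le_iff by auto
    then show ?thesis using y \<open>k = 0\<close> unfolding pt_in_side r_def by simp
  next
    assume k: "k = -1"
    with 1 2 have "r = - (1 - tau y) / 2" unfolding abs_le_iff by auto
    then show ?thesis using y k unfolding pt_in_side r_def by simp
  qed
qed

lemma in_hex_diff_lat:
  "pt x y - lat k n \<in> poly_region vertices \<longleftrightarrow> hex (x - (k + n * (1/2 + \<beta>))) (y - n * (1 + h))"
  unfolding lat_def pt_diff poly_region_iff ..

text \<open>Lattice coordinates of the translate across side \<open>i\<close>, in the order of the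
  sides in \<open>vertices\<close>.\<close>

definition nbr :: "nat \<Rightarrow> int \<times> int" where
  "nbr i = [(0, 1), (-1, 1), (-1, 0), (0, -1), (1, -1), (1, 0)] ! i"

lemma nbr_simps [simp]:
  "nbr 0 = (0, 1)" "nbr 1 = (-1, 1)" "nbr (Suc 0) = (-1, 1)" "nbr 2 = (-1, 0)" "nbr 3 = (0, -1)" "nbr 4 = (1, -1)" "nbr 5 = (1, 0)"
  by (simp_all add: nbr_def)

lemma side_uminus:
  assumes "i < 3" shows "pt x y \<in> poly_side vertices (i + 3) \<longleftrightarrow> pt (- x) (- y) \<in> poly_side vertices i"
proof -
  consider "i = 0" | "i = 1" | "i = 2" using assms by linarith
  then show ?thesis by cases (auto simp: pt_in_side pt_in_side(2)[simplified] tau_uminus)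
qed

text \<open>A tile has height \<open>2 * h\<close>, less than two row distances
  \<open>1 + h\<close>, so only equal or consecutive rows can meet. Within a row the widths are at
  most 1 and the centres at least 1 apart; the next row is \<open>hex_overlap_upper\<close>, and the
  previous row follows by the half turn.\<close>

lemma translates_meet_in_sides:
  assumes "(k, n) \<noteq> (0, 0)" "z \<in> poly_region vertices" "z - lat k n \<in> poly_region vertices"
  shows "\<exists>i<6. (k, n) = nbr i \<and> z \<in> poly_side vertices i"
proof -
  define x where "x = X z"
  define y where "y = Y z"
  have z: "z = pt x y" by (simp add: x_def y_def)
  have 1: "hex x y" using assms(2) z poly_region_iff by simp
  have 2: "hex (x - (k + n * (1/2 + \<beta>))) (y - n * (1 + h))" using assms(3) z in_hex_diff_lat by simp
  have n: "n = 0 \<or> n = 1 \<or> n = -1"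
  proof -
    have "\<bar>n * (1 + h)\<bar> \<le> 2 * h" using hex_imp_abs_le[OF 1] hex_imp_abs_le[OF 2] by linarith
    then have "\<bar>real_of_int n\<bar> * (1 + h) < 2 * (1 + h)" using h_gt_1 by (simp add: abs_mult)
    then have "\<bar>real_of_int n\<bar> < 2" using h_gt_1 by (subst (asm) mult_less_cancel_right_pos) auto
    then show ?thesis by linarith
  qed
  then consider "n = 0" | "n = 1" | "n = -1" by blast
  then show ?thesis
  proof cases
    case 1
    then have k: "k \<noteq> 0" using assms(1) by auto
    define r where "r = x - \<beta> * tau y"
    have a: "\<bar>r\<bar> \<le> (1 - \<bar>tau y\<bar>) / 2" using \<open>hex x y\<close> by (simp add: hex_def r_def)
    have b: "\<bar>r - k\<bar> \<le> (1 - \<bar>tau y\<bar>) / 2" using 2 1 by (simp add: hex_def r_def algebra_simps)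
    have "\<bar>real_of_int k\<bar> \<le> (1 - \<bar>tau y\<bar>) / 2 + (1 - \<bar>tau y\<bar>) / 2"
      using a b by (rule abs_le_add_if_abs_diff_le)
    also have "\<dots> \<le> 1" by simp
    finally have "real_of_int k \<le> 1" "-1 \<le> real_of_int k" unfolding abs_le_iff by auto
    with k have k1: "k = 1 \<or> k = -1" by linarith
    \<comment> \<open>Centres at distance 1 are reached only by sections of full width, so the point
      has the height of the parallelogram.\<close>
    then have t: "tau y = 0" using a b by auto
    then have y: "-1 \<le> y" "y \<le> 1"
      using h_gt_1 by (auto simp: tau_def max_def min_def split: if_splits)
    from k1 show ?thesis
    proof
      assume k: "k = 1"
      then have "r = 1/2" using a b t by auto
      then have "pt x y \<in> poly_side vertices 5" using y t unfolding pt_in_side r_def by simp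
      then show ?thesis using z k 1 by (intro exI[of _ 5]) simp
    next
      assume k: "k = -1"
      then have "r = - 1/2" using a b t by auto
      then have "pt x y \<in> poly_side vertices 2" using y t unfolding pt_in_side r_def by simp
      then show ?thesis using z k 1 by (intro exI[of _ 2]) simp
    qed
  next
    case n: 2
    then have "hex (x - (k + (1/2 + \<beta>))) (y - (1 + h))" using 2 by simp
    from hex_overlap_upper[OF 1 this] show ?thesis
    proof
      assume "k = 0 \<and> pt x y \<in> poly_side vertices 0"
      then show ?thesis using z n by (intro exI[of _ 0]) simp
    next
      assume "k = -1 \<and> pt x y \<in> poly_side vertices 1"
      then show ?thesis using z n by (intro exI[of _ 1]) simp
    qed
  next
    case n: 3
    have "x - (k + n * (1/2 + \<beta>)) = - (- x - (of_int (- k) + (1/2 + \<beta>)))" "y - n * (1 + h) = - (- y - (1 + h))"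
      using n by simp_all
    then have "hex (- x - (of_int (- k) + (1/2 + \<beta>))) (- y - (1 + h))" using 2 hex_uminus by metis
    moreover have "hex (- x) (- y)" using 1 by (simp add: hex_uminus)
    ultimately have "- k = 0 \<and> pt (- x) (- y) \<in> poly_side vertices 0 \<or> - k = -1 \<and> pt (- x) (- y) \<in> poly_side vertices 1"
      using hex_overlap_upper by blast
    then show ?thesis
    proof
      assume a: "- k = 0 \<and> pt (- x) (- y) \<in> poly_side vertices 0"
      then have "pt x y \<in> poly_side vertices 3" using side_uminus[of 0 x y] by simp
      then show ?thesis using z n a by (intro exI[of _ 3]) simp
    next
      assume a: "- k = -1 \<and> pt (- x) (- y) \<in> poly_side vertices 1"
      then have "pt x y \<in> poly_side vertices 4" using side_uminus[of 1 x y] by simp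
      then show ?thesis using z n a by (intro exI[of _ 4]) simp
    qed
  qed
qed

lemma side_in_both_translates:
  assumes "i < 6" "z \<in> poly_side vertices i" "nbr i = (k, n)"
  shows "z \<in> poly_region vertices \<and> z - lat k n \<in> poly_region vertices"
proof
  define x where "x = X z"
  define y where "y = Y z"
  have z: "z = pt x y" by (simp add: x_def y_def)
  show "z \<in> poly_region vertices" using assms by (auto simp: poly_region_def poly_boundary_def)
  have upper: "hex (x - (0 + (1/2 + \<beta>))) (y - (1 + h))" if "pt x y \<in> poly_side vertices 0" for x y
    using that tau_upper_bounds[of y] unfolding pt_in_side by (subst hex_upper_shifted) (auto simp: field_simps)
  have upper': "hex (x - (-1 + (1/2 + \<beta>))) (y - (1 + h))" if "pt x y \<in> poly_side vertices 1" for x y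
    using that tau_upper_bounds[of y] unfolding pt_in_side by (subst hex_upper_shifted) (auto simp: field_simps)
  have "hex (x - (k + n * (1/2 + \<beta>))) (y - n * (1 + h))"
    using less_6_cases[OF assms(1)]
  proof (elim disjE)
    assume "i = 0" then show ?thesis using upper[of x y] assms z by auto
  next
    assume "i = 1" then show ?thesis using upper'[of x y] assms z by auto
  next
    assume "i = 2"
    then show ?thesis using assms z tau_middle[of y] by (auto simp: pt_in_side hex_def)
  next
    assume "i = 5"
    then show ?thesis using assms z tau_middle[of y] by (auto simp: pt_in_side hex_def)
  next
    assume i: "i = 3"
    then have "hex (- x - (0 + (1/2 + \<beta>))) (- y - (1 + h))"
      using upper[of "-x" "-y"] side_uminus[of 0 x y] assms z by auto
    moreover have "x - (k + n * (1/2 + \<beta>)) = - (- x - (0 + (1/2 + \<beta>)))" "y - n * (1 + h) = - (- y - (1 + h))"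
      using i assms by auto
    ultimately show ?thesis by (simp only: hex_uminus)
  next
    assume i: "i = 4"
    then have "hex (- x - (-1 + (1/2 + \<beta>))) (- y - (1 + h))"
      using upper'[of "-x" "-y"] side_uminus[of 1 x y] assms z by auto
    moreover have "x - (k + n * (1/2 + \<beta>)) = - (- x - (-1 + (1/2 + \<beta>)))" "y - n * (1 + h) = - (- y - (1 + h))"
      using i assms by auto
    ultimately show ?thesis by (simp only: hex_uminus)
  qed
  then show "z - lat k n \<in> poly_region vertices" using z in_hex_diff_lat by simp
qed

text \<open>With \<open>r\<close> the position relative to the axis of a row and \<open>k\<close>
  the integer nearest to it, the point is in tile \<open>k\<close> of the row or in a gap next to
  it. The gap on the right is filled by tile \<open>k\<close> of the next row, the one on the left
  by tile \<open>k - 1\<close>.\<close>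

lemma translates_cover: "\<exists>k n. z - lat k n \<in> poly_region vertices"
proof -
  \<comment> \<open>This choice reduces the height to the range from -1 to \<open>h\<close>, the
    parallelogram and its upper ear, so that only the rows \<open>n\<close> and \<open>n + 1\<close>
    matter.\<close>
  define n where "n = \<lfloor>(Y z + 1) / (1 + h)\<rfloor>"
  define y where "y = Y z - n * (1 + h)"
  define x where "x = X z - n * (1/2 + \<beta>)"
  have "real_of_int n \<le> (Y z + 1) / (1 + h)" "(Y z + 1) / (1 + h) < real_of_int n + 1"
    unfolding n_def by linarith+
  then have y: "-1 \<le> y" "y \<le> h"
    using h_gt_1 unfolding y_def by (auto simp: field_simps)
  have *: "z - lat k m \<in> poly_region vertices \<longleftrightarrow>
      hex (x - (k + (m - n) * (1/2 + \<beta>))) (y - (m - n) * (1 + h))" for k m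
  proof -
    have "X z - (k + m * (1/2 + \<beta>)) = x - (k + (m - n) * (1/2 + \<beta>))" "Y z - m * (1 + h) = y - (m - n) * (1 + h)"
      unfolding x_def y_def by (simp_all add: distrib_right left_diff_distrib)
    then show ?thesis using in_hex_diff_lat[of "X z" "Y z" k m] by (simp only: pt_X_Y)
  qed
  define r where "r = x - \<beta> * tau y"
  define k where "k = \<lfloor>r + 1/2\<rfloor>"
  have k: "k \<le> r + 1/2" "r + 1/2 < k + 1" unfolding k_def by linarith+
  have t: "0 \<le> tau y" "tau y \<le> 1"
    using y tau_upper_bounds[of y] tau_upper_1[of y] tau_middle[of y] by (cases "1 \<le> y"; simp)+
  consider "\<bar>r - k\<bar> \<le> (1 - tau y) / 2" | "r - k > (1 - tau y) / 2" | "r - k < - (1 - tau y) / 2"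
    by linarith
  then show ?thesis
  proof cases
    case 1
    then have "hex (x - (k + of_int (n - n) * (1/2 + \<beta>))) (y - of_int (n - n) * (1 + h))"
      using t by (simp add: hex_def r_def algebra_simps)
    then show ?thesis using *[of k n] by auto
  next
    case 2
    then have "tau y \<noteq> 0" using k by auto
    then have y1: "1 \<le> y" using y tau_middle[of y] by linarith
    have "\<bar>r - (k + 1/2)\<bar> \<le> tau y / 2" using 2 k t by (auto simp: abs_if)
    then have "hex (x - (k + (1/2 + \<beta>))) (y - (1 + h))"
      using hex_upper_shifted[OF y1 y(2)] by (simp add: r_def)
    then have "hex (x - (k + of_int ((n + 1) - n) * (1/2 + \<beta>))) (y - of_int ((n + 1) - n) * (1 + h))"
      by simp
    then show ?thesis using *[of k "n + 1"] by auto
  next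
    case 3
    then have "tau y \<noteq> 0" using k by auto
    then have y1: "1 \<le> y" using y tau_middle[of y] by linarith
    have "\<bar>r - (of_int (k - 1) + 1/2)\<bar> \<le> tau y / 2" using 3 k t by (auto simp: abs_if)
    then have "hex (x - (of_int (k - 1) + (1/2 + \<beta>))) (y - (1 + h))"
      using hex_upper_shifted[OF y1 y(2)] by (simp only: r_def)
    then have "hex (x - (of_int (k - 1) + of_int ((n + 1) - n) * (1/2 + \<beta>))) (y - of_int ((n + 1) - n) * (1 + h))"
      by simp
    then show ?thesis using *[of "k - 1" "n + 1"] by auto
  qed
qed

end

section \<open>Trivalent side-to-side tilings by polygons\<close>

text \<open>In a small disc about \<open>x\<close> the boundary stays on the line of the segment, so
  each open half disc \<open>H \<sigma>\<close> misses it and is either in the region or disjoint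
  from it. As the region is the closure of its interior, one half disc is inside. Several tiles
  along a common segment are compared by their signs \<open>\<sigma>\<close>.\<close>

lemma segment_in_boundary_normal_ray:
  assumes simp: "simple_polygon ws" and sub: "closed_segment p q \<subseteq> poly_boundary ws"
    and x: "x \<in> open_segment p q"
  obtains \<sigma> e :: real where "\<sigma> = 1 \<or> \<sigma> = -1" "0 < e"
    "\<And>\<eta>. 0 < \<eta> \<Longrightarrow> \<eta> < e \<Longrightarrow> x + (\<sigma> * \<eta>) *\<^sub>R (\<i> * (q - p)) \<in> interior (poly_region ws)"
proof -
  have pq: "p \<noteq> q" using x by auto
  let ?R = "poly_region ws"
  obtain i where i: "i < length ws" "closed_segment p q \<subseteq> poly_side ws i"
    using segment_in_boundary_imp_in_side[OF simp sub pq] by blast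
  define F where "F = (\<Union>j\<in>{..<length ws} - {i}. poly_side ws j)"
  have "closed F" unfolding F_def by (intro closed_UN) (auto simp: closed_poly_side)
  have xi: "x \<in> poly_side ws i" using x i(2) segment_open_subset_closed by blast
  have "x \<notin> F"
  proof
    assume "x \<in> F"
    then obtain j where j: "j < length ws" "j \<noteq> i" "x \<in> poly_side ws j" by (auto simp: F_def)
    with simple_polygon_side_Int[OF simp i(1), of j] xi
    have "x = ws ! i \<or> x = ws ! (Suc i mod length ws)" by blast
    moreover have "Suc i mod length ws < length ws" using i(1) by (rule Suc_mod_less)
    ultimately show False using no_corner_in_open_segment[OF simp sub] i(1) x by metis
  qed
  with \<open>closed F\<close> obtain e where e: "e > 0" "ball x e \<subseteq> - F"
    by (metis ComplI closed_def open_contains_ball)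
  define d where "d = q - p"
  define n where "n = \<i> * d"
  have n0: "n \<noteq> 0" using pq by (simp add: n_def d_def)
  have on_line: "n \<bullet> (z - x) = 0" if z: "z \<in> poly_side ws i" for z
  proof -
    define a where "a = ws ! i"
    define v where "v = ws ! (Suc i mod length ws) - a"
    have par: "\<exists>s. z = a + s *\<^sub>R v" if "z \<in> poly_side ws i" for z
      using that unfolding poly_side_def in_segment a_def v_def by (force simp: algebra_simps)
    have "p \<in> poly_side ws i" "q \<in> poly_side ws i" using i(2) by auto
    then obtain s1 s2 s3 s4 where "z = a + s1 *\<^sub>R v" "x = a + s2 *\<^sub>R v" "p = a + s3 *\<^sub>R v" "q = a + s4 *\<^sub>R v"
      using par[OF z] par[OF xi] par[of p] par[of q] by metis
    then have "z - x = (s1 - s2) *\<^sub>R v" "n = (s4 - s3) *\<^sub>R (\<i> * v)"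
      by (simp_all add: n_def d_def algebra_simps)
    then show ?thesis by (simp add: inner_complex_def)
  qed
  define H where "H \<sigma> = ball x e \<inter> {z. (\<sigma> *\<^sub>R n) \<bullet> z > (\<sigma> *\<^sub>R n) \<bullet> x}" for \<sigma> :: real
  have H_open: "open (H \<sigma>)" for \<sigma> unfolding H_def by (intro open_Int open_halfspace_gt) auto
  have H_conn: "connected (H \<sigma>)" for \<sigma>
    unfolding H_def by (intro convex_connected convex_Int convex_halfspace_gt convex_ball)
  have H_B: "H \<sigma> \<inter> poly_boundary ws = {}" for \<sigma>
  proof -
    have "z \<in> poly_side ws i" if "z \<in> ball x e" "z \<in> poly_boundary ws" for z
      using that e(2) unfolding poly_boundary_def F_def by auto
    with on_line show ?thesis unfolding H_def by (force simp: inner_diff_right)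
  qed
  have H_all: "H \<sigma> \<subseteq> interior ?R" if "H \<sigma> \<inter> ?R \<noteq> {}" for \<sigma>
  proof -
    have "H \<sigma> \<subseteq> ?R"
      using connected_Int_frontier[OF H_conn that] H_B[of \<sigma>] poly_region_frontier[OF simp] by auto
    then show ?thesis using H_open by (simp add: interior_maximal)
  qed
  have "\<exists>\<sigma>\<in>{1,-1}. H \<sigma> \<inter> ?R \<noteq> {}"
  proof -
    have "x \<in> closure (interior ?R)"
      using poly_region_regular[OF simp] xi poly_side_subset_boundary[OF i(1)] by (auto simp: poly_region_def)
    then obtain w where w: "w \<in> interior ?R" "w \<in> ball x e"
      using e(1) by (metis closure_approachable dist_commute mem_ball)
    then have "w \<in> interior ?R \<inter> ball x e" "open (interior ?R \<inter> ball x e)" by auto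
    then obtain \<delta> where \<delta>: "\<delta> > 0" "ball w \<delta> \<subseteq> interior ?R \<inter> ball x e"
      by (metis open_contains_ball)
    \<comment> \<open>An interior point on the line, or on the positive side of it, is pushed along
      \<open>n\<close> so that it lies strictly in one half disc.\<close>
    define w' where "w' = (if n \<bullet> (w - x) \<ge> 0 then w + (\<delta> / (2 * norm n)) *\<^sub>R n else w)"
    have "norm ((\<delta> / (2 * norm n)) *\<^sub>R n) < \<delta>" using \<delta>(1) n0 by simp
    then have "w' \<in> ball w \<delta>" using \<delta>(1) by (auto simp: w'_def dist_norm)
    then have w'R: "w' \<in> interior ?R" "w' \<in> ball x e" using \<delta>(2) by auto
    have "n \<bullet> (w' - x) \<noteq> 0"
    proof (cases "n \<bullet> (w - x) \<ge> 0")
      case True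
      have "n \<bullet> (w' - x) = n \<bullet> (w - x) + (\<delta> / (2 * norm n)) * (n \<bullet> n)"
        using True by (simp add: w'_def inner_diff_right inner_add_right)
      moreover have "(\<delta> / (2 * norm n)) * (n \<bullet> n) > 0" using \<delta>(1) n0 by simp
      ultimately show ?thesis using True by linarith
    qed (auto simp: w'_def)
    then have "w' \<in> H 1 \<or> w' \<in> H (-1)" using w'R(2) by (auto simp: H_def inner_diff_right)
    then show ?thesis using w'R(1) interior_subset by blast
  qed
  then obtain \<sigma> :: real where \<sigma>: "\<sigma> = 1 \<or> \<sigma> = -1" "H \<sigma> \<inter> ?R \<noteq> {}" by blast
  have "x + (\<sigma> * \<eta>) *\<^sub>R n \<in> interior ?R" if \<eta>: "0 < \<eta>" "\<eta> < e / norm n" for \<eta>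
  proof -
    have "\<eta> * norm n < e" using \<eta> n0 by (simp add: field_simps)
    then have "x + (\<sigma> * \<eta>) *\<^sub>R n \<in> ball x e" using \<sigma>(1) \<eta>(1) by (auto simp: dist_norm)
    moreover have "(\<sigma> *\<^sub>R n) \<bullet> (x + (\<sigma> * \<eta>) *\<^sub>R n) > (\<sigma> *\<^sub>R n) \<bullet> x"
    proof -
      have "(\<sigma> *\<^sub>R n) \<bullet> (x + (\<sigma> * \<eta>) *\<^sub>R n) = (\<sigma> *\<^sub>R n) \<bullet> x + (\<sigma> * \<sigma>) * \<eta> * (n \<bullet> n)"
        by (simp add: inner_add_right)
      moreover have "\<sigma> * \<sigma> = 1" using \<sigma>(1) by auto
      ultimately show ?thesis using \<eta>(1) n0 by simp
    qed
    ultimately have "x + (\<sigma> * \<eta>) *\<^sub>R n \<in> H \<sigma>" by (simp add: H_def)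
    then show ?thesis using H_all[OF \<sigma>(2)] by blast
  qed
  moreover have "0 < e / norm n" using e(1) n0 by simp
  ultimately show ?thesis using that[OF \<sigma>(1)] unfolding n_def d_def by blast
qed

lemma side_containing_corner_is_incident:
  assumes "simple_polygon ws" "i < length ws" "v \<in> set ws" "v \<in> poly_side ws i"
  shows "v = ws ! i \<or> v = ws ! (Suc i mod length ws)"
  using assms corner_in_side_iff by (metis in_set_conv_nth)

lemma two_sides_at_corner:
  assumes ws: "simple_polygon ws" and v: "v \<in> set ws"
    and "s1 \<in> sides (poly_region ws)" "s2 \<in> sides (poly_region ws)" "s3 \<in> sides (poly_region ws)"
    and "v \<in> s1" "v \<in> s2" "v \<in> s3"
  shows "s1 = s2 \<or> s1 = s3 \<or> s2 = s3"
proof -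
  obtain k where k: "k < length ws" "v = ws ! k" using v by (metis in_set_conv_nth)
  obtain i1 i2 i3 where i: "i1 < length ws" "s1 = poly_side ws i1" "i2 < length ws" "s2 = poly_side ws i2"
    "i3 < length ws" "s3 = poly_side ws i3"
    using assms(3-5) unfolding sides_poly_region[OF ws] by auto
  have "i1 = k \<or> Suc i1 mod length ws = k" "i2 = k \<or> Suc i2 mod length ws = k" "i3 = k \<or> Suc i3 mod length ws = k"
    using corner_in_side_iff[OF ws k(1)] i assms(6-8) k(2) by blast+
  then have "i1 = i2 \<or> i1 = i3 \<or> i2 = i3" using Suc_mod_inj i by metis
  then show ?thesis using i by auto
qed

lemma corner_of_shared_side:
  assumes ws: "simple_polygon ws" "simple_polygon ws'" and v: "v \<in> set ws" "v \<in> s"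
    and s: "s \<in> sides (poly_region ws)" "s \<in> sides (poly_region ws')"
  shows "v \<in> set ws'"
proof -
  obtain i j where ij: "i < length ws" "s = poly_side ws i" "j < length ws'" "s = poly_side ws' j"
    using s unfolding ws[THEN sides_poly_region] by auto
  have "v \<in> {ws ! i, ws ! (Suc i mod length ws)}"
    using side_containing_corner_is_incident[OF ws(1) ij(1) v(1)] v(2) ij(2) by blast
  also have "\<dots> = {ws' ! j, ws' ! (Suc j mod length ws')}"
    using ij by (simp add: poly_side_def)
  finally show ?thesis using ij(3) Suc_mod_less[OF ij(3), of j] by auto
qed

text \<open>The local rules of a trivalent side-to-side tiling, with the tiles arbitrary simple
  polygons. That there is a tile across each side is drawn from
  \<open>sides_are_edges\<close>.\<close>

locale polygon_tiling =
  fixes T :: "complex set set"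
  assumes polygonal: "t \<in> T \<Longrightarrow> \<exists>ws. simple_polygon ws \<and> t = poly_region ws"
    and interiors_disjoint: "t \<in> T \<Longrightarrow> t' \<in> T \<Longrightarrow> t \<noteq> t' \<Longrightarrow> interior t \<inter> interior t' = {}"
    and sides_are_edges: "t \<in> T \<Longrightarrow> sides t \<subseteq> tiling_edges T"
    and corner_degree: "t \<in> T \<Longrightarrow> v \<in> corners t \<Longrightarrow> vertex_degree T v = 3"
begin

text \<open>Each point of a tile is a limit of its interior points, so a common point in the
  interior of \<open>t\<close> would make the interiors overlap.\<close>

lemma common_points_in_frontier:
  assumes "t \<in> T" "t' \<in> T" "t \<noteq> t'"
  shows "t \<inter> t' \<subseteq> frontier t"
proof
  fix x assume x: "x \<in> t \<inter> t'"
  obtain ws' where ws': "simple_polygon ws'" "t' = poly_region ws'" using polygonal assms(2) by blast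
  have "x \<notin> interior t"
  proof
    assume "x \<in> interior t"
    moreover have "x \<in> closure (interior t')" using poly_region_regular ws' x by blast
    ultimately have "interior t \<inter> interior t' \<noteq> {}"
      by (metis IntI disjoint_iff empty_iff open_Int_closure_eq_empty open_interior)
    then show False using interiors_disjoint assms by blast
  qed
  then show "x \<in> frontier t" using x closure_subset by (auto simp: frontier_def)
qed

lemma side_in_tile: "t \<in> T \<Longrightarrow> s \<in> sides t \<Longrightarrow> s \<subseteq> t"
  using polygonal[of t] sides_poly_region poly_side_subset_boundary by (fastforce simp: poly_region_def)

lemma common_segment_in_side:
  assumes "t \<in> T" "t' \<in> T" "t \<noteq> t'" "p \<noteq> q" "closed_segment p q \<subseteq> t \<inter> t'"
  shows "\<exists>s\<in>sides t. closed_segment p q \<subseteq> s"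
proof -
  obtain ws where ws: "simple_polygon ws" "t = poly_region ws" using polygonal assms(1) by blast
  have "closed_segment p q \<subseteq> poly_boundary ws"
    using common_points_in_frontier[OF assms(1-3)] assms(5) poly_region_frontier[OF ws(1)] ws(2) by blast
  then show ?thesis
    using segment_in_boundary_imp_in_side[OF ws(1) _ assms(4)] sides_poly_region[OF ws(1)] ws(2) by auto
qed

lemma segment_normal_ray:
  assumes "t \<in> T" "t' \<in> T" "t \<noteq> t'" "p \<noteq> q" "closed_segment p q \<subseteq> t \<inter> t'"
  shows "\<exists>\<sigma> e. (\<sigma> = (1::real) \<or> \<sigma> = -1) \<and> 0 < e \<and>
    (\<forall>\<eta>. 0 < \<eta> \<longrightarrow> \<eta> < e \<longrightarrow> midpoint p q + (\<sigma> * \<eta>) *\<^sub>R (\<i> * (q - p)) \<in> interior t)"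
proof -
  obtain ws where ws: "simple_polygon ws" "t = poly_region ws" using polygonal assms(1) by blast
  have b: "closed_segment p q \<subseteq> poly_boundary ws"
    using common_points_in_frontier[OF assms(1-3)] assms(5) poly_region_frontier[OF ws(1)] ws(2) by blast
  have m: "midpoint p q \<in> open_segment p q" using assms(4) by simp
  show ?thesis using segment_in_boundary_normal_ray[OF ws(1) b m] ws(2) by metis
qed

text \<open>Each tile contains a short normal ray at the midpoint of the segment. There are only two
  directions, so two of three tiles would overlap.\<close>

lemma no_three_tiles_share_segment:
  assumes t: "t1 \<in> T" "t2 \<in> T" "t3 \<in> T" "t1 \<noteq> t2" "t1 \<noteq> t3" "t2 \<noteq> t3"
    and pq: "p \<noteq> q" "closed_segment p q \<subseteq> t1" "closed_segment p q \<subseteq> t2" "closed_segment p q \<subseteq> t3"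
  shows False
proof -
  let ?n = "\<lambda>\<sigma> \<eta>. midpoint p q + (\<sigma> * \<eta>) *\<^sub>R (\<i> * (q - p))"
  obtain \<sigma>1 e1 where 1: "\<sigma>1 = (1::real) \<or> \<sigma>1 = -1" "0 < e1" "\<And>\<eta>. 0 < \<eta> \<Longrightarrow> \<eta> < e1 \<Longrightarrow> ?n \<sigma>1 \<eta> \<in> interior t1"
    using segment_normal_ray[OF t(1,2,4) pq(1)] pq by blast
  obtain \<sigma>2 e2 where 2: "\<sigma>2 = (1::real) \<or> \<sigma>2 = -1" "0 < e2" "\<And>\<eta>. 0 < \<eta> \<Longrightarrow> \<eta> < e2 \<Longrightarrow> ?n \<sigma>2 \<eta> \<in> interior t2"
    using segment_normal_ray[OF t(2,1) _ pq(1)] pq t by blast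
  obtain \<sigma>3 e3 where 3: "\<sigma>3 = (1::real) \<or> \<sigma>3 = -1" "0 < e3" "\<And>\<eta>. 0 < \<eta> \<Longrightarrow> \<eta> < e3 \<Longrightarrow> ?n \<sigma>3 \<eta> \<in> interior t3"
    using segment_normal_ray[OF t(3,1) _ pq(1)] pq t by blast
  define \<eta> where "\<eta> = min e1 (min e2 e3) / 2"
  have "0 < \<eta>" "\<eta> < e1" "\<eta> < e2" "\<eta> < e3" using 1 2 3 by (auto simp: \<eta>_def min_def)
  then have "?n \<sigma>1 \<eta> \<in> interior t1" "?n \<sigma>2 \<eta> \<in> interior t2" "?n \<sigma>3 \<eta> \<in> interior t3" using 1 2 3 by blast+
  moreover have "\<sigma>1 = \<sigma>2 \<or> \<sigma>1 = \<sigma>3 \<or> \<sigma>2 = \<sigma>3" using 1 2 3 by auto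
  ultimately show False using interiors_disjoint[of t1 t2] interiors_disjoint[of t1 t3] interiors_disjoint[of t2 t3] t
    by auto
qed

lemma side_is_segment:
  assumes "t \<in> T" "s \<in> sides t"
  obtains p q where "p \<noteq> q" "s = closed_segment p q"
proof -
  obtain ws where ws: "simple_polygon ws" "t = poly_region ws" using polygonal assms(1) by blast
  then obtain i where "i < length ws" "s = poly_side ws i" using assms(2) sides_poly_region by auto
  then show ?thesis using that simple_polygon_side_endpoints_neq[OF ws(1)] unfolding poly_side_def by blast
qed

lemma no_three_tiles_share_side:
  assumes "t1 \<in> T" "t2 \<in> T" "t3 \<in> T" "t1 \<noteq> t2" "t1 \<noteq> t3" "t2 \<noteq> t3"
    and "s \<in> sides t1" "s \<in> sides t2" "s \<in> sides t3"
  shows False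
  using side_is_segment[OF assms(1,7)] no_three_tiles_share_segment[OF assms(1-6)]
    side_in_tile assms by metis

lemma edge_in_other_tile:
  assumes "t \<in> T" "s \<in> sides t"
  shows "\<exists>t'\<in>T. t' \<noteq> t \<and> s \<subseteq> t'"
proof -
  obtain S where S: "S \<subseteq> T" "finite S" "2 \<le> card S" "s \<in> components (\<Inter>S)"
    using sides_are_edges[OF assms(1)] assms(2) unfolding tiling_edges_def by auto
  have "\<not> S \<subseteq> {t}" using S(2,3) card_mono[of "{t}" S] by auto
  then obtain t' where "t' \<in> S" "t' \<noteq> t" by blast
  moreover have "s \<subseteq> \<Inter>S" using S(4) by (rule in_components_subset)
  ultimately show ?thesis using S(1) by blast
qed

text \<open>An edge is known only to lie in a second tile \<open>t'\<close>, hence in a side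
  \<open>s'\<close> of it. In turn \<open>s'\<close> lies in a tile other than \<open>t'\<close>,
  which must be \<open>t\<close>, as otherwise three tiles would share \<open>s\<close>. So
  \<open>s'\<close> lies in a side of \<open>t\<close> that contains \<open>s\<close>; nested sides
  of \<open>t\<close> coincide, which squeezes \<open>s'\<close> down to \<open>s\<close>.\<close>

lemma side_shared:
  assumes t: "t \<in> T" and s: "s \<in> sides t"
  obtains t' where "t' \<in> T" "t' \<noteq> t" "s \<in> sides t'"
proof -
  obtain t' where t': "t' \<in> T" "t' \<noteq> t" "s \<subseteq> t'" using edge_in_other_tile[OF t s] by blast
  obtain p q where pq: "p \<noteq> q" "s = closed_segment p q" using side_is_segment[OF t s] by blast
  have st: "s \<subseteq> t" using side_in_tile[OF t s] .
  obtain s' where s': "s' \<in> sides t'" "s \<subseteq> s'"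
    using common_segment_in_side[OF t'(1) t t'(2) pq(1)] st t' pq(2) by blast
  obtain t'' where t'': "t'' \<in> T" "t'' \<noteq> t'" "s' \<subseteq> t''" using edge_in_other_tile[OF t'(1) s'(1)] by blast
  have "t'' = t"
    using no_three_tiles_share_segment[OF t t'(1) t''(1) _ _ _ pq(1)] t' t'' st s' pq(2) by blast
  then have s't: "s' \<subseteq> t" using t'' by blast
  obtain p' q' where pq': "p' \<noteq> q'" "s' = closed_segment p' q'" using side_is_segment[OF t'(1) s'(1)] by blast
  obtain s2 where s2: "s2 \<in> sides t" "s' \<subseteq> s2"
    using common_segment_in_side[OF t t'(1) _ pq'(1)] s't side_in_tile[OF t'(1) s'(1)] t' pq'(2) by blast
  obtain ws where ws: "simple_polygon ws" "t = poly_region ws" using polygonal t by blast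
  have "s2 = s"
    using side_subset_imp_eq[OF ws(1)] s s2 s'(2) ws sides_poly_region[OF ws(1)] by (auto simp: subset_iff)
  then have "s' = s" using s2 s' by blast
  then show ?thesis using that t' s' by blast
qed

lemma at_most_three_tiles_at_corner:
  assumes "t \<in> T" "v \<in> corners t" "distinct us" "set us \<subseteq> {u \<in> T. v \<in> u}"
  shows "length us \<le> 3"
proof -
  have c: "card {u \<in> T. v \<in> u} = 3" using corner_degree[OF assms(1,2)] by (simp add: vertex_degree_def)
  \<comment> \<open>An infinite set would have \<open>card\<close> 0, so the degree 3 also gives
    finiteness.\<close>
  then have "finite {u \<in> T. v \<in> u}" by (metis card.infinite zero_neq_numeral)
  then have "card (set us) \<le> card {u \<in> T. v \<in> u}" using assms(4) by (intro card_mono) auto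
  then show ?thesis using assms(3) c by (simp add: distinct_card)
qed

text \<open>At a corner exactly three tiles meet, so the second side of the neighbour at that corner is
  also a side of the third tile.\<close>

lemma third_tile_at_corner:
  assumes t: "t \<in> T" "t' \<in> T" "t \<noteq> t'" and v: "v \<in> corners t"
    and s: "s \<in> sides t" "s \<in> sides t'" "v \<in> s"
    and r: "r \<in> sides t" "v \<in> r" "r \<noteq> s" and r': "r' \<in> sides t'" "v \<in> r'" "r' \<noteq> s"
  obtains t2 where "t2 \<in> T" "r \<in> sides t2" "r' \<in> sides t2" "r \<noteq> r'" "v \<in> corners t2"
proof -
  obtain ws where ws: "simple_polygon ws" "t = poly_region ws" using polygonal t by blast
  obtain ws' where ws': "simple_polygon ws'" "t' = poly_region ws'" using polygonal t by blast
  have v': "v \<in> corners t'"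
    using corner_of_shared_side[OF ws(1) ws'(1)] v s ws ws' by (simp add: corners_poly_region)
  have at_t: "x = s \<or> x = r" if "x \<in> sides t" "v \<in> x" for x
    using two_sides_at_corner[OF ws(1), of v x s r] that s r v ws by (auto simp: corners_poly_region)
  have at_t': "x = s \<or> x = r'" if "x \<in> sides t'" "v \<in> x" for x
    using two_sides_at_corner[OF ws'(1), of v x s r'] that s r' v' ws' by (auto simp: corners_poly_region)
  obtain t2 where t2: "t2 \<in> T" "t2 \<noteq> t" "r \<in> sides t2" using side_shared[OF t(1) r(1)] by blast
  have vt: "v \<in> t" "v \<in> t'" "v \<in> t2" using side_in_tile t t2 s r by blast+
  have deg: "card {u \<in> T. v \<in> u} = 3" using corner_degree[OF t(1) v] by (simp add: vertex_degree_def)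
  \<comment> \<open>Otherwise \<open>t\<close> and \<open>t'\<close> share both their sides at
    \<open>v\<close>. The third tile at \<open>v\<close> shares a side through \<open>v\<close> with
    one of them, hence with both, and three tiles have a side in common.\<close>
  have t2t': "t2 \<noteq> t'"
  proof
    assume "t2 = t'"
    then have "r = r'" using at_t'[of r] t2 r by auto
    have "\<not> {u \<in> T. v \<in> u} \<subseteq> {t, t'}"
    proof
      assume "{u \<in> T. v \<in> u} \<subseteq> {t, t'}"
      then have "card {u \<in> T. v \<in> u} \<le> card {t, t'}" by (intro card_mono) auto
      also have "\<dots> \<le> 2" by (simp add: card_insert_if)
      finally show False using deg by simp
    qed
    then obtain t3 where t3: "t3 \<in> T" "v \<in> t3" "t3 \<noteq> t" "t3 \<noteq> t'" by blast
    obtain ws3 where ws3: "simple_polygon ws3" "t3 = poly_region ws3" using polygonal t3 by blast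
    have "v \<in> frontier t3" using common_points_in_frontier[OF t3(1) t(1) t3(3)] t3 vt by blast
    then obtain s3 where s3: "s3 \<in> sides t3" "v \<in> s3"
      using poly_region_frontier[OF ws3(1)] ws3 sides_poly_region[OF ws3(1)] by (auto simp: poly_boundary_def)
    obtain t5 where t5: "t5 \<in> T" "t5 \<noteq> t3" "s3 \<in> sides t5" using side_shared[OF t3(1) s3(1)] by blast
    have "v \<in> t5" using side_in_tile t5 s3 by blast
    have "t5 = t \<or> t5 = t'"
    proof (rule ccontr)
      assume "\<not> ?thesis"
      then show False
        using at_most_three_tiles_at_corner[OF t(1) v, of "[t5, t3, t, t']"] t t3 t5 vt \<open>v \<in> t5\<close> by simp
    qed
    then have "s3 = s \<or> s3 = r" using at_t[of s3] at_t'[of s3] t5(3) s3(2) \<open>r = r'\<close> by blast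
    then show False
      using no_three_tiles_share_side[OF t(1,2) t3(1) t(3) t3(3)[symmetric] t3(4)[symmetric]]
        s r r' s3 \<open>r = r'\<close> by blast
  qed
  have all: "u \<in> {t, t', t2}" if "u \<in> T" "v \<in> u" for u
  proof (rule ccontr)
    assume n: "u \<notin> {t, t', t2}"
    then show False
      using at_most_three_tiles_at_corner[OF t(1) v, of "[u, t2, t, t']"] t t2 t2t' vt that by simp
  qed
  have rr': "r \<noteq> r'"
    using no_three_tiles_share_side[OF t(1,2) t2(1) t(3) t2(2)[symmetric] t2t'[symmetric]] r r' t2 by blast
  obtain t4 where t4: "t4 \<in> T" "t4 \<noteq> t'" "r' \<in> sides t4" using side_shared[OF t(2) r'(1)] by blast
  have "v \<in> t4" using side_in_tile t4 r' by blast
  have "t4 \<noteq> t" using at_t[of r'] t4 r' rr' by blast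
  then have "t4 = t2" using all[OF t4(1) \<open>v \<in> t4\<close>] t4 by blast
  obtain ws2 where ws2: "simple_polygon ws2" "t2 = poly_region ws2" using polygonal t2 by blast
  have "v \<in> corners t2"
    using corner_of_shared_side[OF ws(1) ws2(1)] v r t2 ws ws2 by (simp add: corners_poly_region)
  then show ?thesis using that[OF t2(1,3)] t4 \<open>t4 = t2\<close> rr' by blast
qed

end

section \<open>Neighbours of a tile\<close>

lemma side_length_eq_if_side_eq:
  "poly_side ws i = poly_side ws' j \<Longrightarrow> side_length ws i = side_length ws' j"
  by (auto simp: poly_side_def side_length_def doubleton_eq_iff dist_commute)

lemma opposite_index:
  assumes "i < 6" shows "Suc ((i + 3) mod 6) mod 6 = (Suc i mod 6 + 3) mod (6::nat)"
  using less_6_cases[OF assms] by (elim disjE) simp_all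

locale distinct_symmetric_hexagon =
  fixes vs :: "complex list" and P :: "complex set" and o' :: complex
  assumes simple: "simple_polygon vs" and length_6: "length vs = 6" and P_def: "P = poly_region vs"
    and symmetric: "(\<lambda>z. 2 * o' - z) ` P = P"
    and lengths: "distinct [side_length vs 0, side_length vs 1, side_length vs 2]"
begin

lemma opposite: "i < 6 \<Longrightarrow> vs ! ((i + 3) mod 6) = 2 * o' - vs ! i"
  using centrally_symmetric_hexagon_opposite[OF simple length_6] symmetric P_def by blast

lemma opposite_next: "i < 6 \<Longrightarrow> vs ! (Suc ((i + 3) mod 6) mod 6) = 2 * o' - vs ! (Suc i mod 6)"
  using opposite[of "Suc i mod 6"] opposite_index[of i] by simp

lemma side_length_opposite: "i < 6 \<Longrightarrow> side_length vs ((i + 3) mod 6) = side_length vs i"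
  unfolding side_length_def length_6 opposite_next opposite
  by (simp add: dist_norm norm_minus_commute)

lemma side_length_345:
  "side_length vs 3 = side_length vs 0" "side_length vs 4 = side_length vs 1" "side_length vs 5 = side_length vs 2"
  using side_length_opposite[of 0] side_length_opposite[of 1] side_length_opposite[of 2] by simp_all

lemma side_length_eq_imp:
  assumes "i < 6" "j < 6" "side_length vs i = side_length vs j"
  shows "j = i \<or> j = (i + 3) mod 6"
proof -
  define L where "L = side_length vs"
  have ne: "L 0 \<noteq> L 1" "L 0 \<noteq> L 2" "L 1 \<noteq> L 2" and eq: "L 3 = L 0" "L 4 = L 1" "L 5 = L 2"
    using lengths side_length_345 by (auto simp: L_def)
  have "L i = L j" using assms(3) by (simp add: L_def)
  then show ?thesis
    using less_6_cases[OF assms(1)] less_6_cases[OF assms(2)] ne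
    by (elim disjE) (simp_all add: eq)
qed

lemma adjacent_side_lengths_neq:
  assumes "i < 6" shows "side_length vs i \<noteq> side_length vs (Suc i mod 6)"
proof
  assume "side_length vs i = side_length vs (Suc i mod 6)"
  then have "Suc i mod 6 = i \<or> Suc i mod 6 = (i + 3) mod 6"
    using side_length_eq_imp[OF assms, of "Suc i mod 6"] by simp
  then show False using less_6_cases[OF assms] by (elim disjE) simp_all
qed

lemma isometric_tile:
  assumes "plane_isometry f"
  shows "simple_polygon (map f vs)" "poly_region (map f vs) = f ` P"
    and "corners (f ` P) = f ` set vs" "sides (f ` P) = poly_side (map f vs) ` {..<6}"
proof -
  show 1: "simple_polygon (map f vs)" by (rule simple_polygon_map[OF assms simple])
  show 2: "poly_region (map f vs) = f ` P" using poly_region_map[OF assms] P_def by simp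
  show "corners (f ` P) = f ` set vs" "sides (f ` P) = poly_side (map f vs) ` {..<6}"
    using corners_poly_region[OF 1] sides_poly_region[OF 1] 2 length_6 by simp_all
qed

lemma trivalent_tile:
  assumes "trivalent_tiling_by P T" "t \<in> T"
  shows "\<exists>f. plane_isometry f \<and> t = f ` P"
proof -
  have "\<forall>t\<in>T. \<exists>f. plane_isometry f \<and> t = f ` P"
    using assms(1) by (simp add: trivalent_tiling_by_def tiling_by_def)
  then show ?thesis using assms(2) by (rule bspec)
qed

lemma trivalent_polygon_tiling:
  assumes "trivalent_tiling_by P T"
  shows "polygon_tiling T"
proof
  have T: "side_to_side T" "\<forall>x\<in>tiling_vertices T. vertex_degree T x = 3"
    using assms by (simp_all add: trivalent_tiling_by_def)
  have disj: "\<forall>t\<in>T. \<forall>t'\<in>T. t \<noteq> t' \<longrightarrow> interior t \<inter> interior t' = {}"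
    using assms by (simp add: trivalent_tiling_by_def tiling_by_def)
  fix t assume t: "t \<in> T"
  obtain f where "plane_isometry f" "t = f ` P" using trivalent_tile[OF assms t] by blast
  then show "\<exists>ws. simple_polygon ws \<and> t = poly_region ws" using isometric_tile by metis
  show "sides t \<subseteq> tiling_edges T" using T(1) t unfolding side_to_side_def by blast
  show "vertex_degree T v = 3" if "v \<in> corners t" for v
    using T t that unfolding side_to_side_def by blast
  show "interior t \<inter> interior t' = {}" if "t' \<in> T" "t \<noteq> t'" for t'
    using disj t that by blast
qed

text \<open>The tile across a side is a translate of the given one or its mirror image in that side. The
  mirror image is impossible, as it would lie on the wrong side.\<close>

lemma opposite_isometry_overlaps:
  assumes h: "plane_isometry h" "\<And>z. h z = \<alpha> * cnj z + \<gamma>" and i: "i < 6"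
    and ends: "h (vs ! ((i + 3) mod 6)) = vs ! (Suc i mod 6)" "h (vs ! (Suc ((i + 3) mod 6) mod 6)) = vs ! i"
    and disj: "interior P \<inter> interior ((\<lambda>z. z + (vs ! i + vs ! (Suc i mod 6) - 2 * o')) ` P) = {}"
  shows "interior P \<inter> interior (h ` P) \<noteq> {}"
proof -
  define a where "a = vs ! i"
  define b where "b = vs ! (Suc i mod 6)"
  define N where "N = a + b - 2 * o'"
  let ?j = "(i + 3) mod 6"
  have a': "vs ! ?j = 2 * o' - a" and b': "vs ! (Suc ?j mod 6) = 2 * o' - b"
    using opposite[OF i] opposite_next[OF i] by (simp_all add: a_def b_def)
  have ab: "a \<noteq> b" using simple_polygon_side_endpoints_neq[OF simple, of i] i length_6 by (simp add: a_def b_def)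
  have tr: "plane_isometry (\<lambda>z. z + N)" by (rule plane_isometry_translation)
  have mid: "midpoint a b \<in> open_segment a b" using ab by simp
  have "closed_segment a b \<subseteq> poly_boundary vs"
    using poly_side_subset_boundary[of i vs] i length_6 by (simp add: poly_side_def a_def b_def)
  from segment_in_boundary_normal_ray[OF simple this mid]
  obtain \<sigma> e :: real where 1: "\<sigma> = 1 \<or> \<sigma> = -1" "0 < e"
    "\<And>\<eta>. 0 < \<eta> \<Longrightarrow> \<eta> < e \<Longrightarrow> midpoint a b + (\<sigma> * \<eta>) *\<^sub>R (\<i> * (b - a)) \<in> interior P"
    unfolding P_def by metis
  have "closed_segment a b \<subseteq> poly_boundary (map (\<lambda>z. z + N) vs)"
  proof -
    have "poly_side (map (\<lambda>z. z + N) vs) ?j = closed_segment b a"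
      using length_6 a' b' by (simp add: poly_side_def N_def)
    then show ?thesis
      using poly_side_subset_boundary[of ?j "map (\<lambda>z. z + N) vs"] length_6 by (simp add: closed_segment_commute)
  qed
  from segment_in_boundary_normal_ray[OF isometric_tile(1)[OF tr] this mid]
  obtain \<sigma>' e' :: real where 2: "\<sigma>' = 1 \<or> \<sigma>' = -1" "0 < e'"
    "\<And>\<eta>. 0 < \<eta> \<Longrightarrow> \<eta> < e' \<Longrightarrow> midpoint a b + (\<sigma>' * \<eta>) *\<^sub>R (\<i> * (b - a)) \<in> interior ((\<lambda>z. z + N) ` P)"
    unfolding isometric_tile(2)[OF tr] by metis
  define \<eta> where "\<eta> = min e e' / 2"
  have \<eta>: "0 < \<eta>" "\<eta> < e" "\<eta> < e'" using 1 2 by (auto simp: \<eta>_def min_def)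
  \<comment> \<open>Along the common side, \<open>P\<close> and its translate lie on different sides
    because their interiors are disjoint.\<close>
  have "\<sigma> \<noteq> \<sigma>'" using 1(3)[OF \<eta>(1,2)] 2(3)[OF \<eta>(1,3)] disj unfolding N_def a_def b_def by blast
  then have \<sigma>': "\<sigma>' = - \<sigma>" using 1(1) 2(1) by auto
  obtain w where w: "w \<in> interior P" "w + N = midpoint a b + (\<sigma>' * \<eta>) *\<^sub>R (\<i> * (b - a))"
    using 2(3)[OF \<eta>(1,3)] unfolding plane_isometry_interior[OF tr] by auto
  have ha: "\<alpha> * cnj (2 * o' - a) + \<gamma> = b" and hb: "\<alpha> * cnj (2 * o' - b) + \<gamma> = a"
    using ends h(2) a' b' by (simp_all add: a_def b_def)
  \<comment> \<open>The linear part of \<open>h\<close> fixes \<open>b - a\<close>; being opposite,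
    it reverses the normal \<open>\<i> * (b - a)\<close>. So \<open>h\<close> brings
    \<open>w\<close>, whose translate is beyond the side, to the side of \<open>P\<close>.\<close>
  have dir: "\<alpha> * cnj (b - a) = b - a" using ha hb by (simp add: algebra_simps)
  have wq: "w = (2 * o' - a) + (a - b) / 2 + of_real (\<sigma>' * \<eta>) * (\<i> * (b - a))"
    using w(2) by (simp add: N_def midpoint_def scaleR_conv_of_real field_simps)
  have "h w = \<alpha> * cnj ((2 * o' - a) + (a - b) / 2 + of_real (\<sigma>' * \<eta>) * (\<i> * (b - a))) + \<gamma>"
    unfolding h(2) by (subst wq) (rule refl)
  also have "\<dots> = (\<alpha> * cnj (2 * o' - a) + \<gamma>) - (\<alpha> * cnj (b - a)) / 2 - of_real (\<sigma>' * \<eta>) * (\<i> * (\<alpha> * cnj (b - a)))"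
    by (simp add: field_simps)
  also have "\<dots> = b - (b - a) / 2 - of_real (\<sigma>' * \<eta>) * (\<i> * (b - a))"
    unfolding dir ha ..
  also have "\<dots> = midpoint a b + (\<sigma> * \<eta>) *\<^sub>R (\<i> * (b - a))"
    by (simp add: midpoint_def scaleR_conv_of_real \<sigma>' field_simps)
  finally have "h w \<in> interior P" using 1(3)[OF \<eta>(1,2)] by simp
  moreover have "h w \<in> interior (h ` P)" using w(1) plane_isometry_interior[OF h(1)] by blast
  ultimately show ?thesis by blast
qed

text \<open>Side lengths determine the side of the neighbour up to passing to the opposite one, and
  central symmetry makes it the opposite one. Its ends can be matched in two ways; the degree 3
  excludes one, and for the other an isometry is fixed up to a reflection, which \<open>disj\<close>
  excludes. The lattice tiling will supply \<open>disj\<close>.\<close>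

lemma neighbour_translate:
  assumes T: "trivalent_tiling_by P T" and f: "plane_isometry f" "f ` P \<in> T" and i: "i < 6"
    and disj: "interior P \<inter> interior ((\<lambda>z. z + (vs ! i + vs ! (Suc i mod 6) - 2 * o')) ` P) = {}"
  shows "f ` (\<lambda>z. z + (vs ! i + vs ! (Suc i mod 6) - 2 * o')) ` P \<in> T"
proof -
  interpret polygon_tiling T by (rule trivalent_polygon_tiling[OF T])
  note tile = trivalent_tile[OF T]
  define a where "a = vs ! i"
  define b where "b = vs ! (Suc i mod 6)"
  define N where "N = a + b - 2 * o'"
  let ?j = "(i + 3) mod 6"
  have j: "?j < 6" by simp
  have a': "vs ! ?j = 2 * o' - a" and b': "vs ! (Suc ?j mod 6) = 2 * o' - b"
    using opposite[OF i] opposite_next[OF i] by (simp_all add: a_def b_def)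
  have ab: "a \<noteq> b" using simple_polygon_side_endpoints_neq[OF simple, of i] i length_6 by (simp add: a_def b_def)
  have len: "side_length (map g vs) k = side_length vs k" if "plane_isometry g" "k < 6" for g k
    using side_length_map[OF that(1)] that(2) length_6 by simp
  let ?s = "poly_side (map f vs) i"
  have s: "?s \<in> sides (f ` P)" using isometric_tile(4)[OF f(1)] i by simp
  then obtain t' where t': "t' \<in> T" "t' \<noteq> f ` P" "?s \<in> sides t'" using side_shared[OF f(2)] by blast
  obtain g0 where g0: "plane_isometry g0" "t' = g0 ` P" using tile[OF t'(1)] by blast
  obtain k where k: "k < 6" "?s = poly_side (map g0 vs) k"
    using t'(3) isometric_tile(4)[OF g0(1)] g0(2) by auto
  have "side_length vs i = side_length vs k"
    using side_length_eq_if_side_eq[OF k(2)] len[OF f(1) i] len[OF g0(1) k(1)] by simp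
  then have "k = i \<or> k = ?j" by (rule side_length_eq_imp[OF i k(1)])
  then obtain g where g: "plane_isometry g" "t' = g ` P" "?s = poly_side (map g vs) ?j"
  proof
    assume ki: "k = i"
    \<comment> \<open>\<open>P\<close> is invariant under the half turn, so composing with it
      describes the same tile while replacing the index of the shared side by the opposite
      one.\<close>
    let ?r = "\<lambda>z. 2 * o' - z"
    have "plane_isometry (g0 \<circ> ?r)" by (intro plane_isometry_comp g0 plane_isometry_point_reflection)
    moreover have "t' = (g0 \<circ> ?r) ` P" using g0(2) symmetric by (metis image_comp)
    moreover have "?s = poly_side (map (g0 \<circ> ?r) vs) ?j"
      using k(2) ki length_6 i a' b' unfolding poly_side_def by (simp add: a_def b_def)
    ultimately show ?thesis using that by blast
  next
    assume "k = ?j" then show ?thesis using that g0 k by blast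
  qed
  have "{f a, f b} = {g (2 * o' - a), g (2 * o' - b)}"
    using g(3) length_6 i a' b' unfolding poly_side_def by (simp add: a_def b_def)
  then consider (bad) "g (2 * o' - a) = f a" "g (2 * o' - b) = f b"
    | (good) "g (2 * o' - a) = f b" "g (2 * o' - b) = f a"
    by (auto simp: doubleton_eq_iff)
  then have "g ` P = f ` (\<lambda>z. z + N) ` P"
  proof cases
    case bad
    \<comment> \<open>At \<open>f a\<close> both tiles continue with a side of the length of side
      \<open>k\<close>. The third tile there has both as adjacent sides, which contradicts
      \<open>adjacent_side_lengths_neq\<close>.\<close>
    obtain k where k: "k < 6" "Suc k mod 6 = i" using cyclic_predecessor[OF i] by blast
    let ?l = "(k + 3) mod 6"
    have l: "?l < 6" by simp
    have Sl: "Suc ?l mod 6 = ?j" using opposite_index[OF k(1)] k(2) by simp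
    have ki: "k \<noteq> i" using k Suc_mod_neq[of 6 k] by auto
    have lj: "?l \<noteq> ?j" using Sl Suc_mod_neq[of 6 ?l] by auto
    let ?r = "poly_side (map f vs) k" and ?r' = "poly_side (map g vs) ?l"
    have v: "f a \<in> corners (f ` P)" using isometric_tile(3)[OF f(1)] i length_6 by (simp add: a_def)
    have "f a \<in> ?s" using i length_6 by (simp add: poly_side_def a_def)
    moreover have "?r \<in> sides (f ` P)" using isometric_tile(4)[OF f(1)] k by simp
    moreover have "f a \<in> ?r" using k i length_6 by (simp add: poly_side_def a_def)
    moreover have "?r \<noteq> ?s"
      using side_subset_imp_eq[OF isometric_tile(1)[OF f(1)], of k i] k i ki length_6 by auto
    moreover have "?r' \<in> sides t'" using isometric_tile(4)[OF g(1)] g(2) by simp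
    moreover have "f a \<in> ?r'" using Sl bad(1) length_6 a' l j by (simp add: poly_side_def)
    moreover have "?r' \<noteq> ?s"
      using side_subset_imp_eq[OF isometric_tile(1)[OF g(1)], of ?l ?j] lj length_6 unfolding g(3) by auto
    ultimately obtain t2 where t2: "t2 \<in> T" "?r \<in> sides t2" "?r' \<in> sides t2" "?r \<noteq> ?r'" "f a \<in> corners t2"
      using third_tile_at_corner[OF f(2) t'(1) t'(2)[symmetric] v s t'(3)] by blast
    obtain q where q: "plane_isometry q" "t2 = q ` P" using tile[OF t2(1)] by blast
    obtain m m' where m: "m < 6" "?r = poly_side (map q vs) m" "m' < 6" "?r' = poly_side (map q vs) m'"
      using t2(2,3) isometric_tile(4)[OF q(1)] q(2) by auto
    obtain c where c: "c < 6" "f a = map q vs ! c"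
      using t2(5) isometric_tile(3)[OF q(1)] q(2) length_6 by (auto simp: in_set_conv_nth)
    have "m = c \<or> Suc m mod 6 = c" "m' = c \<or> Suc m' mod 6 = c"
      using corner_in_side_iff[OF isometric_tile(1)[OF q(1)], of c] c m length_6 \<open>f a \<in> ?r\<close> \<open>f a \<in> ?r'\<close> by auto
    moreover have "m \<noteq> m'" using m t2(4) by auto
    ultimately have "m' = Suc m mod 6 \<or> m = Suc m' mod 6" using m Suc_mod_inj by metis
    moreover have "side_length vs m = side_length vs m'"
      using side_length_eq_if_side_eq[OF m(2)] side_length_eq_if_side_eq[OF m(4)] len[OF f(1) k(1)] len[OF g(1) l]
        len[OF q(1) m(1)] len[OF q(1) m(3)] side_length_opposite[OF k(1)] by simp
    ultimately show ?thesis using adjacent_side_lengths_neq m by metis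
  next
    case good
    \<comment> \<open>The position of the neighbour as seen from \<open>P\<close>. It agrees with
      the translation by \<open>N\<close> on the two ends of the opposite side, so a direct
      \<open>h\<close> is this translation.\<close>
    define h where "h = inv f \<circ> g"
    have h: "plane_isometry h" unfolding h_def by (intro plane_isometry_comp plane_isometry_inv f g)
    have fh: "f (h z) = g z" for z
      using plane_isometry_bij[OF f(1)] by (simp add: h_def bij_is_surj surj_f_inv_f)
    have h1: "h (2 * o' - a) = b" and h2: "h (2 * o' - b) = a"
      using good plane_isometry_bij[OF f(1)] by (simp_all add: h_def bij_is_inj)
    from h show ?thesis
    proof (cases rule: plane_isometry_cases)
      case (direct \<alpha> \<gamma>)
      have "\<alpha> * (b - a) = b - a" using h1 h2 direct(2) by (simp add: algebra_simps)
      then have "\<alpha> = 1" using ab by simp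
      then have "h z = z + N" for z using h1 direct(2) by (simp add: N_def algebra_simps)
      then have "g z = f (z + N)" for z using fh[of z] by simp
      then show ?thesis by (simp add: image_image)
    next
      case (opposite \<alpha> \<gamma>)
      have "interior P \<inter> interior (h ` P) \<noteq> {}"
        by (rule opposite_isometry_overlaps[OF h opposite(2) i _ _ disj])
          (use h1 h2 a' b' in \<open>simp_all add: a_def b_def\<close>)
      then obtain z where "z \<in> interior P" "z \<in> interior (h ` P)" by blast
      then have "f z \<in> interior (f ` P)" "f z \<in> interior (f ` h ` P)"
        using plane_isometry_interior[OF f(1)] by blast+
      moreover have "f ` h ` P = t'" using g(2) by (simp add: image_image fh)
      ultimately show ?thesis using interiors_disjoint[OF f(2) t'(1)] t'(2) by blast
    qed
  qed
  then show ?thesis using t'(1) g(2) unfolding N_def a_def b_def by simp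
qed

end

section \<open>The lattice tiling\<close>

text \<open>The interface between coordinates and combinatorics. \<open>meet\<close>,
  \<open>side_in_both\<close> and the injectivity of \<open>N\<close> say that a translate of
  \<open>P\<close> by a nonzero lattice vector meets \<open>P\<close> in exactly one whole side,
  side \<open>i\<close> for the vector \<open>N i\<close>, or not at all.\<close>

locale lattice_hexagon =
  fixes vs :: "complex list" and P \<Lambda> :: "complex set" and N :: "nat \<Rightarrow> complex"
  assumes simple: "simple_polygon vs" and length_6: "length vs = 6" and P_def: "P = poly_region vs"
    and zero: "0 \<in> \<Lambda>" and add: "a \<in> \<Lambda> \<Longrightarrow> b \<in> \<Lambda> \<Longrightarrow> a + b \<in> \<Lambda>" and uminus: "a \<in> \<Lambda> \<Longrightarrow> - a \<in> \<Lambda>"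
    and N_in: "i < 6 \<Longrightarrow> N i \<in> \<Lambda>" and N_nz: "i < 6 \<Longrightarrow> N i \<noteq> 0" and N_inj: "inj_on N {..<6}"
    and cover: "\<exists>l\<in>\<Lambda>. z - l \<in> P"
    and meet: "l \<in> \<Lambda> \<Longrightarrow> l \<noteq> 0 \<Longrightarrow> z \<in> P \<Longrightarrow> z - l \<in> P \<Longrightarrow> \<exists>i<6. l = N i \<and> z \<in> poly_side vs i"
    and side_in_both: "i < 6 \<Longrightarrow> z \<in> poly_side vs i \<Longrightarrow> z \<in> P \<and> z - N i \<in> P"
begin

definition tile :: "complex \<Rightarrow> complex set" where
  "tile l = (\<lambda>z. z + l) ` P"

definition tiles :: "complex set set" where
  "tiles = tile ` \<Lambda>"

lemma diff: "a \<in> \<Lambda> \<Longrightarrow> b \<in> \<Lambda> \<Longrightarrow> a - b \<in> \<Lambda>"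
  using add[of a "- b"] uminus[of b] by simp

lemma mem_tile: "z \<in> tile l \<longleftrightarrow> z - l \<in> P"
  unfolding tile_def by (force simp: image_iff)

lemma tile_0: "tile 0 = P"
  by (simp add: tile_def)

lemma translate_tile: "(\<lambda>z. z + m) ` tile l = tile (l + m)"
  by (simp add: tile_def image_image add.assoc)

lemma translate_tiles:
  assumes "m \<in> \<Lambda>" shows "move_tiling (\<lambda>z. z + m) tiles = tiles"
proof -
  have "move_tiling (\<lambda>z. z + m) tiles = (\<lambda>l. tile (l + m)) ` \<Lambda>"
    by (simp add: move_tiling_def tiles_def image_image translate_tile)
  also have "\<dots> = tile ` (\<lambda>l. l + m) ` \<Lambda>" by (simp add: image_image)
  also have "(\<lambda>l. l + m) ` \<Lambda> = \<Lambda>"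
  proof
    show "\<Lambda> \<subseteq> (\<lambda>l. l + m) ` \<Lambda>" using diff[OF _ assms] by (force simp: image_iff)
  qed (use add assms in auto)
  finally show ?thesis by (simp add: tiles_def)
qed

lemma P_compact: "compact P"
  using poly_region_compact[OF simple] P_def by simp

lemma P_nonempty: "P \<noteq> {}"
  using cover by blast

text \<open>A nonempty compact set contains no translate of itself by \<open>d\<close> unless
  \<open>d = 0\<close>: a point that is extreme in direction \<open>d\<close> would be moved
  further.\<close>

lemma tile_inj: "tile l = tile l' \<longleftrightarrow> l = l'"
proof
  assume eq: "tile l = tile l'"
  define d where "d = l - l'"
  have step: "z + d \<in> P" if "z \<in> P" for z
  proof -
    have "z + l \<in> tile l'" using that eq mem_tile[of "z + l" l] by simp
    then show ?thesis by (simp add: mem_tile d_def algebra_simps)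
  qed
  have "continuous_on P (\<lambda>z. d \<bullet> z)" by (intro continuous_intros)
  then obtain z where z: "z \<in> P" "\<forall>y\<in>P. d \<bullet> y \<le> d \<bullet> z"
    using continuous_attains_sup[OF P_compact P_nonempty] by blast
  then have "d \<bullet> (z + d) \<le> d \<bullet> z" using step by blast
  then have "d \<bullet> d \<le> 0" by (simp add: inner_add_right)
  then have "d = 0" by (metis inner_gt_zero_iff not_less)
  then show "l = l'" by (simp add: d_def)
qed simp

lemma tile_topology:
  shows "corners (tile l) = (\<lambda>z. z + l) ` set vs"
    and "sides (tile l) = (\<lambda>i. (\<lambda>z. z + l) ` poly_side vs i) ` {..<6}"
    and "interior (tile l) = (\<lambda>z. z + l) ` interior P"
proof -
  let ?f = "\<lambda>z. z + l"
  have f: "plane_isometry ?f" by (rule plane_isometry_translation)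
  have s: "simple_polygon (map ?f vs)" by (rule simple_polygon_map[OF f simple])
  have r: "tile l = poly_region (map ?f vs)" unfolding tile_def poly_region_map[OF f] P_def[symmetric] ..
  show "corners (tile l) = ?f ` set vs" unfolding r corners_poly_region[OF s] by simp
  show "sides (tile l) = (\<lambda>i. ?f ` poly_side vs i) ` {..<6}"
    unfolding r sides_poly_region[OF s] by (auto simp: length_6 poly_side_map[OF f])
  show "interior (tile l) = ?f ` interior P" unfolding tile_def by (rule plane_isometry_interior[OF f])
qed

section \<open>Intersections of the lattice tiles, vertices and edges\<close>

lemma neighbour_Int:
  assumes "i < 6" shows "tile l \<inter> tile (l + N i) = (\<lambda>z. z + l) ` poly_side vs i"
proof (intro set_eqI iffI)
  fix z assume "z \<in> tile l \<inter> tile (l + N i)"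
  then have "z - l \<in> P" "z - l - N i \<in> P" by (auto simp: mem_tile algebra_simps)
  then obtain j where "j < 6" "N i = N j" "z - l \<in> poly_side vs j"
    using meet[OF N_in N_nz] assms by blast
  then have "z - l \<in> poly_side vs i" using N_inj assms by (auto dest: inj_onD)
  then show "z \<in> (\<lambda>z. z + l) ` poly_side vs i" by (force simp: image_iff)
next
  fix z assume "z \<in> (\<lambda>z. z + l) ` poly_side vs i"
  then show "z \<in> tile l \<inter> tile (l + N i)"
    using side_in_both[OF assms] by (auto simp: mem_tile algebra_simps)
qed

lemma tiles_meet:
  assumes "l \<in> \<Lambda>" "l' \<in> \<Lambda>" "l \<noteq> l'" "z \<in> tile l" "z \<in> tile l'"
  shows "\<exists>i<6. l' = l + N i \<and> z - l \<in> poly_side vs i"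
proof -
  have "z - l \<in> P" "z - l - (l' - l) \<in> P" using assms by (simp_all add: mem_tile)
  then obtain i where "i < 6" "l' - l = N i" "z - l \<in> poly_side vs i"
    using meet[of "l' - l"] diff assms by (metis eq_iff_diff_eq_0)
  then show ?thesis by (metis add.commute diff_add_cancel)
qed

lemma tiling: "tiling_by P tiles"
  unfolding tiling_by_def
proof (intro conjI ballI impI)
  fix t assume "t \<in> tiles"
  then show "\<exists>f. plane_isometry f \<and> t = f ` P"
    using plane_isometry_translation by (auto simp: tiles_def tile_def)
next
  show "\<Union>tiles = UNIV" using cover by (force simp: tiles_def mem_tile)
next
  fix t t' assume t: "t \<in> tiles" "t' \<in> tiles" "t \<noteq> t'"
  then obtain l l' where l: "l \<in> \<Lambda>" "l' \<in> \<Lambda>" "t = tile l" "t' = tile l'" by (auto simp: tiles_def)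
  show "interior t \<inter> interior t' = {}"
  proof (rule ccontr)
    assume "\<not> ?thesis"
    then obtain z where z: "z \<in> interior t" "z \<in> interior t'" by blast
    then have "z \<in> t" "z \<in> t'" using interior_subset by blast+
    then obtain i where i: "i < 6" "z - l \<in> poly_side vs i" using tiles_meet[OF l(1,2)] t l by blast
    have "z - l \<in> interior P" using z(1) l(3) tile_topology(3) by auto
    moreover have "z - l \<in> frontier P"
      using i poly_side_subset_boundary[of i vs] length_6 poly_region_frontier[OF simple] P_def by auto
    ultimately show False by (simp add: frontier_def)
  qed
qed

text \<open>Two distinct sides with both ends in common would each have to follow the other, which
  is impossible in a 6-cycle.\<close>

lemma distinct_sides_Int:
  assumes "i < 6" "j < 6" "i \<noteq> j" "x \<in> poly_side vs i" "x \<in> poly_side vs j"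
  shows "x \<in> set vs \<and> poly_side vs i \<inter> poly_side vs j = {x}"
proof
  let ?E = "{vs ! i, vs ! (Suc i mod 6)} \<inter> {vs ! j, vs ! (Suc j mod 6)}"
  have sub: "poly_side vs i \<inter> poly_side vs j \<subseteq> ?E"
    using simple_polygon_side_Int[OF simple, of i j] assms length_6 by simp
  have m: "Suc i mod 6 < 6" "Suc j mod 6 < 6" by simp_all
  show "x \<in> set vs" using sub assms m length_6 by (auto simp del: mod_less_divisor)
  have idx: "(vs ! a = vs ! b) = (a = b)" if "a < 6" "b < 6" for a b
    using simple_polygon_distinct[OF simple] that length_6 by (simp add: nth_eq_iff_index_eq)
  have "Suc (Suc i mod 6) mod 6 \<noteq> i" using less_6_cases[OF assms(1)] by (elim disjE) simp_all
  then have "\<not> (i = Suc j mod 6 \<and> Suc i mod 6 = j)" by auto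
  moreover have "Suc i mod 6 \<noteq> Suc j mod 6" using Suc_mod_inj assms(1-3) by blast
  ultimately have "\<not> (vs ! i = vs ! (Suc j mod 6) \<and> vs ! (Suc i mod 6) = vs ! j)"
    "vs ! i \<noteq> vs ! j" "vs ! (Suc i mod 6) \<noteq> vs ! (Suc j mod 6)"
    using idx[OF assms(1) m(2)] idx[OF assms(1,2)] idx[OF m] idx[OF m(1) assms(2)] assms(3) by blast+
  then have "y = x" if "x \<in> ?E" "y \<in> ?E" for y using that by blast
  then show "poly_side vs i \<inter> poly_side vs j = {x}" using sub assms(4,5) by blast
qed

text \<open>Two tiles that meet share a whole side. A further tile through the same point cuts one
  of them in a different side, and two sides have only a corner in common.\<close>

lemma tiles_Inter_cases:
  assumes S: "S \<subseteq> tiles" "2 \<le> card S" and ne: "x \<in> \<Inter>S"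
  shows "\<Inter>S \<in> (\<Union>t\<in>tiles. sides t) \<or> x \<in> (\<Union>t\<in>tiles. corners t) \<and> \<Inter>S = {x}"
proof -
  obtain t t' where t: "t \<in> S" "t' \<in> S" "t \<noteq> t'"
    using S(2) by (metis card_le_Suc0_iff_eq card.infinite not_numeral_le_zero not_less_eq_eq numeral_2_eq_2)
  obtain l l' where l: "l \<in> \<Lambda>" "t = tile l" "l' \<in> \<Lambda>" "t' = tile l'"
    using t(1,2) S(1) unfolding tiles_def by blast
  have xt: "x \<in> t" "x \<in> t'" using ne t by auto
  obtain i where i: "i < 6" "l' = l + N i" "x - l \<in> poly_side vs i"
    using tiles_meet[OF l(1,3)] t l xt by blast
  have int: "t \<inter> t' = (\<lambda>z. z + l) ` poly_side vs i" using neighbour_Int[OF i(1)] l i by simp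
  show ?thesis
  proof (cases "S = {t, t'}")
    case True
    then have "\<Inter>S = (\<lambda>z. z + l) ` poly_side vs i" using int by simp
    then have "\<Inter>S \<in> sides (tile l)" using i(1) by (auto simp: tile_topology)
    then show ?thesis using l by (auto simp: tiles_def)
  next
    case False
    then obtain t'' where t'': "t'' \<in> S" "t'' \<noteq> t" "t'' \<noteq> t'" using t by blast
    obtain l'' where l'': "l'' \<in> \<Lambda>" "t'' = tile l''" using t'' S by (auto simp: tiles_def)
    have "x \<in> t''" using ne t'' by auto
    then obtain j where j: "j < 6" "l'' = l + N j" "x - l \<in> poly_side vs j"
      using tiles_meet[OF l(1) l''(1)] t'' l l'' xt by blast
    have "i \<noteq> j" using t'' l'' l i j by auto
    from distinct_sides_Int[OF i(1) j(1) this i(3) j(3)]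
    have 1: "x - l \<in> set vs" and 2: "poly_side vs i \<inter> poly_side vs j = {x - l}" by auto
    have "\<Inter>S \<subseteq> (t \<inter> t') \<inter> (t \<inter> t'')" using t t'' by blast
    also have "\<dots> = (\<lambda>z. z + l) ` poly_side vs i \<inter> (\<lambda>z. z + l) ` poly_side vs j"
      using int neighbour_Int[OF j(1), of l] l l'' j by simp
    also have "\<dots> = (\<lambda>z. z + l) ` (poly_side vs i \<inter> poly_side vs j)" by (simp add: image_Int)
    also have "\<dots> = {x}" using 2 by simp
    finally have "\<Inter>S = {x}" using ne by blast
    moreover have "x \<in> corners (tile l)" using 1 by (force simp: tile_topology image_iff)
    ultimately show ?thesis using l by (auto simp: tiles_def)
  qed
qed

lemma side_components:
  assumes "s \<in> (\<Union>t\<in>tiles. sides t)"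
  shows "components s = {s}" "s \<noteq> {x}"
proof -
  obtain l i where s: "i < 6" "s = (\<lambda>z. z + l) ` poly_side vs i"
    using assms by (auto simp: tiles_def tile_topology)
  then have s': "s = closed_segment (vs ! i + l) (vs ! (Suc i mod 6) + l)"
    using plane_isometry_closed_segment[OF plane_isometry_translation] length_6 by (simp add: poly_side_def)
  have "vs ! i \<noteq> vs ! (Suc i mod 6)"
    using simple_polygon_side_endpoints_neq[OF simple, of i] s(1) length_6 by simp
  then show "s \<noteq> {x}" unfolding s' closed_segment_eq_sing by auto
  have "connected s" "s \<noteq> {}" unfolding s' by auto
  then show "components s = {s}" by (metis components_eq_sing_iff)
qed

text \<open>Corner \<open>k\<close> lies on just two sides, \<open>k\<close> and its predecessor
  \<open>j\<close>. Any other tile at this corner touches the given tile along a side through it, so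
  it is one of the two translates across these sides.\<close>

lemma tiles_at_corner:
  assumes "k < 6" "l \<in> \<Lambda>" "j < 6" "Suc j mod 6 = k"
  shows "{t \<in> tiles. vs ! k + l \<in> t} = {tile l, tile (l + N k), tile (l + N j)}"
    and "card {tile l, tile (l + N k), tile (l + N j)} = 3"
    and "\<Inter>{tile l, tile (l + N k), tile (l + N j)} = {vs ! k + l}"
proof -
  have jk: "j \<noteq> k" using assms Suc_mod_neq[of 6 j] by auto
  have vk: "vs ! k \<in> poly_side vs k" "vs ! k \<in> poly_side vs j"
    using assms length_6 by (simp_all add: poly_side_def)
  have on: "i = k \<or> i = j" if "i < 6" "vs ! k \<in> poly_side vs i" for i
    using corner_in_side_iff[OF simple, of k i] that assms length_6 Suc_mod_inj[of i 6 j] by auto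
  have kP: "vs ! k \<in> P" using side_in_both[OF assms(1) vk(1)] by blast
  show "{t \<in> tiles. vs ! k + l \<in> t} = {tile l, tile (l + N k), tile (l + N j)}"
  proof (intro set_eqI iffI)
    fix t assume t: "t \<in> {t \<in> tiles. vs ! k + l \<in> t}"
    then obtain m where m: "m \<in> \<Lambda>" "t = tile m" by (auto simp: tiles_def)
    show "t \<in> {tile l, tile (l + N k), tile (l + N j)}"
    proof (cases "m = l")
      case False
      then obtain i where "i < 6" "m = l + N i" "vs ! k \<in> poly_side vs i"
        using tiles_meet[OF assms(2) m(1), of "vs ! k + l"] t m kP by (auto simp: mem_tile)
      then show ?thesis using on m by blast
    qed (use m in simp)
  next
    fix t assume "t \<in> {tile l, tile (l + N k), tile (l + N j)}"
    then show "t \<in> {t \<in> tiles. vs ! k + l \<in> t}"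
      using assms kP side_in_both[OF assms(1) vk(1)] side_in_both[OF assms(3) vk(2)] add N_in
      by (auto simp: tiles_def mem_tile)
  qed
  have "N k \<noteq> N j" using N_inj jk assms by (auto dest: inj_onD)
  then show "card {tile l, tile (l + N k), tile (l + N j)} = 3"
    using N_nz assms by (simp add: tile_inj card_insert_if)
  have "\<Inter>{tile l, tile (l + N k), tile (l + N j)} = (tile l \<inter> tile (l + N k)) \<inter> (tile l \<inter> tile (l + N j))" by auto
  also have "\<dots> = (\<lambda>z. z + l) ` (poly_side vs k \<inter> poly_side vs j)"
    by (simp only: neighbour_Int[OF assms(1)] neighbour_Int[OF assms(3)]) (simp add: image_Int)
  also have "\<dots> = {vs ! k + l}"
    using distinct_sides_Int[OF assms(1,3) jk[symmetric] vk] by simp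
  finally show "\<Inter>{tile l, tile (l + N k), tile (l + N j)} = {vs ! k + l}" .
qed

lemma corner_cases:
  assumes "x \<in> (\<Union>t\<in>tiles. corners t)"
  obtains k j l where "k < 6" "l \<in> \<Lambda>" "j < 6" "Suc j mod 6 = k" "x = vs ! k + l"
proof -
  obtain l v where l: "l \<in> \<Lambda>" "v \<in> set vs" "x = v + l" using assms by (auto simp: tiles_def tile_topology)
  then obtain k where k: "k < 6" "v = vs ! k" using length_6 by (metis in_set_conv_nth)
  obtain j where "j < 6" "Suc j mod 6 = k" using cyclic_predecessor[OF k(1)] by blast
  then show ?thesis using that k l by blast
qed

lemma vertices_are_corners: "tiling_vertices tiles = (\<Union>t\<in>tiles. corners t)"
proof
  show "tiling_vertices tiles \<subseteq> (\<Union>t\<in>tiles. corners t)"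
  proof
    fix x assume "x \<in> tiling_vertices tiles"
    then obtain S where S: "S \<subseteq> tiles" "2 \<le> card S" "{x} \<in> components (\<Inter>S)"
      by (auto simp: tiling_vertices_def)
    then have "x \<in> \<Inter>S" using in_components_subset by blast
    from tiles_Inter_cases[OF S(1,2) this] show "x \<in> (\<Union>t\<in>tiles. corners t)"
    proof
      assume "\<Inter>S \<in> (\<Union>t\<in>tiles. sides t)"
      from side_components[OF this] S(3) show ?thesis by (metis singletonD)
    qed blast
  qed
  show "(\<Union>t\<in>tiles. corners t) \<subseteq> tiling_vertices tiles"
  proof
    fix x assume "x \<in> (\<Union>t\<in>tiles. corners t)"
    then obtain k j l where k: "k < 6" "l \<in> \<Lambda>" "j < 6" "Suc j mod 6 = k" "x = vs ! k + l"
      by (rule corner_cases)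
    note C = tiles_at_corner[OF k(1-4)]
    let ?S = "{tile l, tile (l + N k), tile (l + N j)}"
    have "?S \<subseteq> tiles" using add N_in k by (auto simp: tiles_def)
    moreover have "{x} \<in> components (\<Inter>?S)" unfolding C(3) k(5)
      using components_eq_sing_iff[of "{vs ! k + l}"] by simp
    moreover have "2 \<le> card ?S" using C(2) by simp
    moreover have "finite ?S" by simp
    ultimately show "x \<in> tiling_vertices tiles" unfolding tiling_vertices_def by blast
  qed
qed

lemma edges_are_sides: "tiling_edges tiles = (\<Union>t\<in>tiles. sides t)"
proof
  show "tiling_edges tiles \<subseteq> (\<Union>t\<in>tiles. sides t)"
  proof
    fix e assume "e \<in> tiling_edges tiles"
    then obtain S where S: "S \<subseteq> tiles" "2 \<le> card S" "e \<in> components (\<Inter>S)" "\<And>x. e \<noteq> {x}"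
      by (auto simp: tiling_edges_def)
    then obtain x where "x \<in> \<Inter>S" using in_components_subset in_components_nonempty by blast
    from tiles_Inter_cases[OF S(1,2) this] show "e \<in> (\<Union>t\<in>tiles. sides t)"
    proof
      assume a: "\<Inter>S \<in> (\<Union>t\<in>tiles. sides t)"
      then show ?thesis using side_components(1)[OF a] S(3) by simp
    next
      assume "x \<in> (\<Union>t\<in>tiles. corners t) \<and> \<Inter>S = {x}"
      then have "e \<subseteq> {x}" "e \<noteq> {}" using S(3) in_components_subset in_components_nonempty by blast+
      then show ?thesis using S(4) by blast
    qed
  qed
  show "(\<Union>t\<in>tiles. sides t) \<subseteq> tiling_edges tiles"
  proof
    fix e assume e: "e \<in> (\<Union>t\<in>tiles. sides t)"
    then obtain l i where l: "l \<in> \<Lambda>" "i < 6" "e = (\<lambda>z. z + l) ` poly_side vs i"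
      by (auto simp: tiles_def tile_topology)
    let ?S = "{tile l, tile (l + N i)}"
    have "?S \<subseteq> tiles" using add N_in l by (auto simp: tiles_def)
    moreover have "\<Inter>?S = e" using neighbour_Int[OF l(2), of l] l(3) by simp
    then have "e \<in> components (\<Inter>?S)" using side_components(1)[OF e] by simp
    moreover have "card ?S = 2" using N_nz[OF l(2)] by (simp add: tile_inj)
    then have "2 \<le> card ?S" by simp
    moreover have "finite ?S" by simp
    ultimately show "e \<in> tiling_edges tiles"
      unfolding tiling_edges_def using side_components(2)[OF e] by blast
  qed
qed

lemma trivalent: "trivalent_tiling_by P tiles"
  unfolding trivalent_tiling_by_def side_to_side_def
proof (intro conjI ballI tiling vertices_are_corners edges_are_sides)
  fix x assume "x \<in> tiling_vertices tiles"
  then obtain k j l where k: "k < 6" "l \<in> \<Lambda>" "j < 6" "Suc j mod 6 = k" "x = vs ! k + l"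
    unfolding vertices_are_corners by (rule corner_cases)
  show "vertex_degree tiles x = 3"
    unfolding vertex_degree_def k(5) tiles_at_corner(1)[OF k(1-4)] by (rule tiles_at_corner(2)[OF k(1-4)])
qed

section \<open>Symmetries of the lattice tiling and its torus quotient\<close>

lemma tiles_isohedral: "isohedral tiles"
  unfolding isohedral_def
proof (intro ballI)
  fix t t' assume "t \<in> tiles" "t' \<in> tiles"
  then obtain l l' where l: "l \<in> \<Lambda>" "l' \<in> \<Lambda>" "t = tile l" "t' = tile l'" by (auto simp: tiles_def)
  then show "\<exists>f. plane_isometry f \<and> move_tiling f tiles = tiles \<and> f ` t = t'"
    using translate_tiles[OF diff[OF l(2,1)]] translate_tile[of "l' - l" l] plane_isometry_translation
    by (intro exI[of _ "\<lambda>z. z + (l' - l)"]) simp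
qed

lemma tiles_invariant: "lattice_invariant \<Lambda> tiles"
  unfolding lattice_invariant_def using translate_tiles by blast

lemma orbit_eq_tiles:
  assumes "t \<in> tiles" shows "{(\<lambda>z. z + l) ` t |l. l \<in> \<Lambda>} = tiles"
proof -
  obtain m where m: "m \<in> \<Lambda>" "t = tile m" using assms by (auto simp: tiles_def)
  have "{(\<lambda>z. z + l) ` t |l. l \<in> \<Lambda>} = (\<lambda>l. tile (m + l)) ` \<Lambda>"
    unfolding m(2) translate_tile by blast
  also have "\<dots> = tiles"
  proof
    show "tiles \<subseteq> (\<lambda>l. tile (m + l)) ` \<Lambda>"
    proof
      fix t assume "t \<in> tiles"
      then obtain n where "n \<in> \<Lambda>" "t = tile n" by (auto simp: tiles_def)
      then show "t \<in> (\<lambda>l. tile (m + l)) ` \<Lambda>"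
        using diff[of n m] m(1) by (intro image_eqI[of _ _ "n - m"]) auto
    qed
  qed (use add m in \<open>auto simp: tiles_def\<close>)
  finally show ?thesis .
qed

lemma induced_single: "induced_tiling \<Lambda> tiles = (\<Lambda>, {tiles})"
proof -
  have "tiles \<noteq> {}" using zero by (auto simp: tiles_def)
  then have "(\<lambda>t. {(\<lambda>z. z + l) ` t |l. l \<in> \<Lambda>}) ` tiles = {tiles}"
    using orbit_eq_tiles by auto
  then show ?thesis by (simp add: induced_tiling_def)
qed

text \<open>A torus tiling carries its lattice, so any covering presents this one by the same
  \<open>\<Lambda>\<close>, and its plane tiling, a union of orbits equal to \<open>tiles\<close>,
  is \<open>tiles\<close> itself. A translation in the larger lattice takes tile 0 to a tile of
  \<open>tiles\<close>; since distinct vectors give distinct tiles, it is already in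
  \<open>\<Lambda>\<close>.\<close>

lemma induced_minimal:
  assumes "plane_lattice \<Lambda>"
  shows "minimal_torus_tiling P (induced_tiling \<Lambda> tiles)"
  unfolding minimal_torus_tiling_def
proof (intro conjI allI impI)
  show "\<exists>T. plane_covers P T (induced_tiling \<Lambda> tiles)"
    using tiling assms tiles_invariant unfolding plane_covers_def by blast
  fix \<T>' assume "torus_covers P (induced_tiling \<Lambda> tiles) \<T>'"
  then obtain T \<Lambda>0 \<Lambda>' where a: "plane_lattice \<Lambda>'" "\<Lambda>0 \<subseteq> \<Lambda>'" "lattice_invariant \<Lambda>' T"
    "induced_tiling \<Lambda> tiles = induced_tiling \<Lambda>0 T" "\<T>' = induced_tiling \<Lambda>' T"
    unfolding torus_covers_def by blast
  from a(4) have eq: "\<Lambda> = \<Lambda>0 \<and> {tiles} = (\<lambda>t. {(\<lambda>z. z + l) ` t |l. l \<in> \<Lambda>0}) ` T"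
    unfolding induced_single unfolding induced_tiling_def prod.inject .
  have \<Lambda>0: "\<Lambda>0 = \<Lambda>" using eq[THEN conjunct1] by (rule sym)
  have orb: "(\<lambda>t. {(\<lambda>z. z + l) ` t |l. l \<in> \<Lambda>}) ` T = {tiles}"
    using eq[THEN conjunct2] unfolding \<Lambda>0 by (rule sym)
  have orbit: "{(\<lambda>z. z + l) ` t |l. l \<in> \<Lambda>} = tiles" if "t \<in> T" for t
    using imageI[OF that, of "\<lambda>t. {(\<lambda>z. z + l) ` t |l. l \<in> \<Lambda>}"] unfolding orb by (rule singletonD)
  have "T = tiles"
  proof
    show "T \<subseteq> tiles"
    proof
      fix t assume "t \<in> T"
      have "t = (\<lambda>z. z + 0) ` t" by simp
      then have "t \<in> {(\<lambda>z. z + l) ` t |l. l \<in> \<Lambda>}" using zero by blast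
      then show "t \<in> tiles" using orbit[OF \<open>t \<in> T\<close>] by simp
    qed
    have "T \<noteq> {}"
    proof
      assume "T = {}"
      with orb show False unfolding \<open>T = {}\<close> by simp
    qed
    then obtain t where t: "t \<in> T" by blast
    show "tiles \<subseteq> T"
    proof
      fix u assume "u \<in> tiles"
      then have "u \<in> {(\<lambda>z. z + l) ` t |l. l \<in> \<Lambda>}" unfolding orbit[OF t] .
      then obtain l where "l \<in> \<Lambda>" "u = (\<lambda>z. z + l) ` t" by blast
      moreover have "move_tiling (\<lambda>z. z + l) T = T"
        using a(2,3) \<Lambda>0 \<open>l \<in> \<Lambda>\<close> unfolding lattice_invariant_def by blast
      ultimately show "u \<in> T" using t unfolding move_tiling_def by blast
    qed
  qed
  moreover have "\<Lambda>' = \<Lambda>"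
  proof
    show "\<Lambda>' \<subseteq> \<Lambda>"
    proof
      fix l assume "l \<in> \<Lambda>'"
      then have "move_tiling (\<lambda>z. z + l) tiles = tiles"
        using a(3) \<open>T = tiles\<close> unfolding lattice_invariant_def by blast
      moreover have "tile 0 \<in> tiles" using zero by (simp add: tiles_def)
      ultimately have "tile (0 + l) \<in> tiles" using translate_tile[of l 0] unfolding move_tiling_def by blast
      then show "l \<in> \<Lambda>" by (auto simp: tiles_def tile_inj)
    qed
  qed (use a(2) \<Lambda>0 in blast)
  ultimately show "induced_tiling \<Lambda> tiles = \<T>'" using a(5) by simp
qed

lemma tiles_periodic:
  assumes "plane_lattice \<Lambda>" shows "periodic tiles"
proof -
  obtain u w where uw: "u \<noteq> w" "independent {u, w}" "\<Lambda> = {of_int m * u + of_int n * w |m n. True}"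
    using assms unfolding plane_lattice_def by blast
  have "u = of_int 1 * u + of_int 0 * w" "w = of_int 0 * u + of_int 1 * w" by simp_all
  then have "u \<in> \<Lambda>" "w \<in> \<Lambda>" unfolding uw(3) by blast+
  then show ?thesis unfolding periodic_def using uw translate_tiles by blast
qed

text \<open>A tiling that contains an isometric image of the lattice tiling equals it, because the
  interiors of the lattice tiles are dense.\<close>

lemma isometric_if_contains_tiles:
  assumes T: "tiling_by P T" and f: "plane_isometry f" and sub: "\<And>l. l \<in> \<Lambda> \<Longrightarrow> f ` tile l \<in> T"
  shows "isometric_tilings tiles T"
proof -
  have "move_tiling f tiles = T"
  proof
    show "move_tiling f tiles \<subseteq> T" using sub by (auto simp: move_tiling_def tiles_def)
    have disj: "\<forall>t\<in>T. \<forall>t'\<in>T. t \<noteq> t' \<longrightarrow> interior t \<inter> interior t' = {}"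
      and copy: "\<forall>t\<in>T. \<exists>f. plane_isometry f \<and> t = f ` P"
      using T by (simp_all add: tiling_by_def)
    show "T \<subseteq> move_tiling f tiles"
    proof
      fix t assume t: "t \<in> T"
      then obtain g where g: "plane_isometry g" "t = g ` P" using copy by blast
      have "interior P \<noteq> {}"
        using poly_region_regular[OF simple] P_nonempty P_def by auto
      then obtain z where z: "z \<in> interior t" using plane_isometry_interior[OF g(1)] g(2) by blast
      obtain l where l: "l \<in> \<Lambda>" "inv f z - l \<in> P" using cover by blast
      then have "inv f z \<in> tile l" by (simp add: mem_tile)
      then have "f (inv f z) \<in> f ` tile l" by blast
      then have zl: "z \<in> f ` tile l" using plane_isometry_bij[OF f] by (simp add: bij_is_surj surj_f_inv_f)
      let ?g = "f \<circ> (\<lambda>z. z + l)"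
      have gi: "plane_isometry ?g" by (intro plane_isometry_comp f plane_isometry_translation)
      have "f ` tile l = poly_region (map ?g vs)"
        unfolding poly_region_map[OF gi] tile_def P_def[symmetric] image_comp ..
      then have "f ` tile l \<subseteq> closure (interior (f ` tile l))"
        using poly_region_regular[OF simple_polygon_map[OF gi simple]] by simp
      then have "z \<in> closure (interior (f ` tile l))" using zl by (rule subsetD)
      then have "interior t \<inter> interior (f ` tile l) \<noteq> {}"
        using z by (metis IntI empty_iff open_Int_closure_eq_empty open_interior)
      then have "t = f ` tile l" using disj t sub[OF l(1)] by blast
      then show "t \<in> move_tiling f tiles" using l by (auto simp: move_tiling_def tiles_def)
    qed
  qed
  then show ?thesis unfolding isometric_tilings_def using f by blast
qed

end

section \<open>Change of the starting corner\<close>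

lemma poly_side_rotate1:
  assumes "i < length vs" shows "poly_side (rotate1 vs) i = poly_side vs (Suc i mod length vs)"
  using assms Suc_mod_less[OF assms, of i] by (simp add: poly_side_def nth_rotate1)

lemma side_length_rotate1:
  assumes "i < length vs" shows "side_length (rotate1 vs) i = side_length vs (Suc i mod length vs)"
  using assms Suc_mod_less[OF assms, of i] by (simp add: side_length_def nth_rotate1)

lemma poly_region_rotate1: "poly_region (rotate1 vs) = poly_region vs"
proof -
  have "poly_boundary (rotate1 vs) = (\<Union>i\<in>(\<lambda>i. Suc i mod length vs) ` {..<length vs}. poly_side vs i)"
    unfolding poly_boundary_def by (auto simp: poly_side_rotate1)
  also have "(\<lambda>i. Suc i mod length vs) ` {..<length vs} = {..<length vs}"
  proof
    show "{..<length vs} \<subseteq> (\<lambda>i. Suc i mod length vs) ` {..<length vs}"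
      by (auto simp: image_iff) (metis cyclic_predecessor lessThan_iff)
  qed (auto intro: Suc_mod_less)
  finally show ?thesis unfolding poly_region_def poly_boundary_def by simp
qed

lemma simple_polygon_rotate1:
  assumes "simple_polygon vs" shows "simple_polygon (rotate1 vs)"
proof -
  let ?n = "length vs"
  have n: "3 \<le> ?n" using assms by (rule simple_polygon_length)
  have m: "k mod ?n < ?n" for k using n by (intro mod_less_divisor) linarith
  have nth: "rotate1 vs ! k = vs ! (Suc k mod ?n)" if "k < ?n" for k using nth_rotate1[OF that] .
  have "poly_side (rotate1 vs) i \<inter> poly_side (rotate1 vs) j
      \<subseteq> {rotate1 vs ! i, rotate1 vs ! (Suc i mod ?n)} \<inter> {rotate1 vs ! j, rotate1 vs ! (Suc j mod ?n)}"
    if "i < ?n" "j < ?n" "i \<noteq> j" for i j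
  proof -
    have "Suc i mod ?n \<noteq> Suc j mod ?n" using Suc_mod_inj that by blast
    then show ?thesis
      using simple_polygon_side_Int[OF assms m m, of "Suc i" "Suc j"]
      unfolding poly_side_rotate1[OF that(1)] poly_side_rotate1[OF that(2)] nth[OF that(1)] nth[OF that(2)] nth[OF m] by blast
  qed
  moreover have "\<not> collinear {rotate1 vs ! i, rotate1 vs ! ((i + 1) mod ?n), rotate1 vs ! ((i + 2) mod ?n)}"
    if "i < ?n" for i
  proof -
    have "\<not> collinear {vs ! (Suc i mod ?n), vs ! ((Suc i mod ?n + 1) mod ?n), vs ! ((Suc i mod ?n + 2) mod ?n)}"
      using assms m unfolding simple_polygon_def by blast
    moreover have "(Suc i mod ?n + 1) mod ?n = Suc ((i + 1) mod ?n) mod ?n"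
      "(Suc i mod ?n + 2) mod ?n = Suc ((i + 2) mod ?n) mod ?n"
      by (simp_all add: mod_simps)
    ultimately show ?thesis unfolding nth[OF that] nth[OF m] by simp
  qed
  ultimately show ?thesis using assms unfolding simple_polygon_def by simp
qed

text \<open>Allows the apex of the ear to be taken as corner 1. The rotated lengths are those of
  sides 1, 2, 3, and side 3 is as long as side 0.\<close>

lemma (in distinct_symmetric_hexagon) rotate1: "distinct_symmetric_hexagon (rotate1 vs) P o'"
proof
  show "simple_polygon (rotate1 vs)" by (rule simple_polygon_rotate1[OF simple])
  show "length (rotate1 vs) = 6" by (simp add: length_6)
  show "P = poly_region (rotate1 vs)" by (simp add: poly_region_rotate1 P_def)
  show "(\<lambda>z. 2 * o' - z) ` P = P" by (rule symmetric)
  show "distinct [side_length (rotate1 vs) 0, side_length (rotate1 vs) 1, side_length (rotate1 vs) 2]"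
  proof -
    have "side_length (rotate1 vs) 0 = side_length vs 1" "side_length (rotate1 vs) 2 = side_length vs 3"
      using side_length_rotate1[of 0 vs] side_length_rotate1[of 2 vs] length_6 by simp_all
    moreover have "side_length (rotate1 vs) 1 = side_length vs 2"
      using side_length_rotate1[of 1 vs] length_6 by (simp add: numeral_2_eq_2)
    ultimately show ?thesis using lengths side_length_345(1) by auto
  qed
qed

lemma independent_if_cross2_nz:
  assumes "cross2 u w \<noteq> 0" shows "u \<noteq> w \<and> independent {u, w}"
proof
  show ne: "u \<noteq> w" using assms by (auto simp: cross2_def)
  have "w \<noteq> 0" using assms by (auto simp: cross2_def)
  moreover have "u \<notin> span {w}" using assms by (auto simp: span_singleton cross2_def)
  ultimately show "independent {u, w}" using ne by (simp add: independent_insert)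
qed

text \<open>The equation says that the cross product of \<open>A - B\<close> and
  \<open>C - B\<close> is 0. Then \<open>C - B\<close> equals its orthogonal projection onto
  \<open>A - B\<close>. In contrapositive form this turns the absence of straight angles into the
  inequalities needed for an ear.\<close>

lemma collinear_if_cross2_0:
  assumes "cross2 A B + cross2 B C = cross2 A C"
  shows "collinear {c + A, c + B, c + C}"
proof -
  define u where "u = A - B"
  define w where "w = C - B"
  have "cross2 u w = 0" using assms by (simp add: u_def w_def cross2_def algebra_simps)
  then have cr: "Re u * Im w = Im u * Re w" by (simp add: cross2_def)
  have "(u \<bullet> u) *\<^sub>R w = (u \<bullet> w) *\<^sub>R u"
  proof (rule complex_eqI)
    show "Re ((u \<bullet> u) *\<^sub>R w) = Re ((u \<bullet> w) *\<^sub>R u)"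
      unfolding scaleR_complex.sel inner_complex_def using cr by algebra
    show "Im ((u \<bullet> u) *\<^sub>R w) = Im ((u \<bullet> w) *\<^sub>R u)"
      unfolding scaleR_complex.sel inner_complex_def using cr by algebra
  qed
  then have "(1 / (u \<bullet> u)) *\<^sub>R ((u \<bullet> u) *\<^sub>R w) = (1 / (u \<bullet> u)) *\<^sub>R ((u \<bullet> w) *\<^sub>R u)" by simp
  then have "u = 0 \<or> w = ((u \<bullet> w) / (u \<bullet> u)) *\<^sub>R u" by (cases "u = 0") simp_all
  then have "collinear {0, u, w}" using collinear_lemma by blast
  then show ?thesis using collinear_3[of "c + A" "c + B" "c + C"] by (simp add: u_def w_def NO_MATCH_def)
qed

section \<open>The translations form a lattice generated by steps to neighbours\<close>

context ear_hexagon
begin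

lemma lat_add: "lat k n + lat k' n' = lat (k + k') (n + n')"
  by (simp add: lat_def scaleR_conv_of_real field_simps)

lemma lat_uminus: "- lat k n = lat (- k) (- n)"
  by (simp add: lat_def algebra_simps)

lemma lat_zero: "lat 0 0 = 0"
  by (simp add: lat_def)

lemma lat_eq_iff: "lat k n = lat k' n' \<longleftrightarrow> k = k' \<and> n = n'"
proof
  assume "lat k n = lat k' n'"
  then have "pt 0 0 + lat k n = pt 0 0 + lat k' n'" by simp
  then have "k + n * (1/2 + \<beta>) = k' + n' * (1/2 + \<beta>)" "n * (1 + h) = n' * (1 + h)"
    unfolding lat_def pt_add pt_eq_iff by simp_all
  moreover from this(2) have "n = n'" using h_gt_1 by simp
  ultimately show "k = k' \<and> n = n'" by simp
qed simp

lemma lat_decompose: "lat k n = of_int k * lat 1 0 + of_int n * lat 0 1"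
  by (simp add: lat_def scaleR_conv_of_real algebra_simps)

lemma plane_lattice_lat: "plane_lattice (range (\<lambda>(k, n). lat k n))"
proof -
  have "cross2 (lat 1 0) (lat 0 1) = (1 + h) * cross2 e1 e2"
    by (simp add: lat_def cross2_def algebra_simps)
  then have "cross2 (lat 1 0) (lat 0 1) \<noteq> 0" using cross_nz h_gt_1 by simp
  from independent_if_cross2_nz[OF this] show ?thesis
    unfolding plane_lattice_def
    by (intro exI[of _ "lat 1 0"] exI[of _ "lat 0 1"]) (auto simp flip: lat_decompose)
qed

text \<open>The translation across a side is twice the vector from the centre to the midpoint of
  that side. This form is free of coordinates and matches the one in
  \<open>neighbour_translate\<close>.\<close>

lemma lat_nbr:
  assumes "i < 6"
  shows "(case nbr i of (k, n) \<Rightarrow> lat k n) = vertices ! i + vertices ! (Suc i mod 6) - 2 * c"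
  using less_6_cases[OF assms]
  by (elim disjE) (simp_all add: vertices_def lat_def pt_def scaleR_conv_of_real field_simps)

lemma nbr_inj: "inj_on nbr {..<6}"
proof (rule inj_onI)
  fix i j assume "i \<in> {..<6}" "j \<in> {..<6}" "nbr i = nbr j"
  then have ij: "i < 6" "j < 6" "nbr i = nbr j" by simp_all
  from less_6_cases[OF ij(1)] less_6_cases[OF ij(2)] ij(3) show "i = j" by (elim disjE) simp_all
qed

lemma nbr_nz: assumes "i < 6" shows "nbr i \<noteq> (0, 0)"
  using less_6_cases[OF assms] by (elim disjE) simp_all

lemma lattice_hexagon:
  assumes "simple_polygon vertices"
  shows "lattice_hexagon vertices (poly_region vertices) (range (\<lambda>(k, n). lat k n)) (\<lambda>i. case nbr i of (k, n) \<Rightarrow> lat k n)"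
proof
  let ?L = "range (\<lambda>(k, n). lat k n)" and ?N = "\<lambda>i. case nbr i of (k, n) \<Rightarrow> lat k n"
  show "simple_polygon vertices" "length vertices = 6" "poly_region vertices = poly_region vertices"
    using assms by simp_all
  show "0 \<in> ?L" using lat_zero by (metis case_prod_conv rangeI)
  have lat_in: "lat k n \<in> ?L" for k n by (rule range_eqI[of _ _ "(k, n)"]) simp
  show "a + b \<in> ?L" if "a \<in> ?L" "b \<in> ?L" for a b using that lat_in by (auto simp: lat_add)
  show "- a \<in> ?L" if "a \<in> ?L" for a using that lat_in by (auto simp: lat_uminus)
  show "?N i \<in> ?L" if "i < 6" for i using lat_in by (auto split: prod.split)
  show "?N i \<noteq> 0" if "i < 6" for i
    using nbr_nz[OF that] lat_eq_iff[of _ _ 0 0] by (auto simp: lat_zero split: prod.split)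
  show "inj_on ?N {..<6}"
    by (rule inj_onI) (auto simp: lat_eq_iff split: prod.splits intro: inj_onD[OF nbr_inj])
  show "\<exists>l\<in>?L. z - l \<in> poly_region vertices" for z using translates_cover[of z] by auto
  show "\<exists>i<6. l = ?N i \<and> z \<in> poly_side vertices i"
    if l: "l \<in> ?L" "l \<noteq> 0" and z: "z \<in> poly_region vertices" "z - l \<in> poly_region vertices" for l z
  proof -
    obtain k n where lat: "l = lat k n" using l(1) by auto
    have "(k, n) \<noteq> (0, 0)" using l(2) lat lat_zero by auto
    then obtain i where "i < 6" "(k, n) = nbr i" "z \<in> poly_side vertices i"
      using translates_meet_in_sides z lat by blast
    then show ?thesis using lat by (metis case_prod_conv)
  qed
  show "z \<in> poly_region vertices \<and> z - ?N i \<in> poly_region vertices"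
    if "i < 6" "z \<in> poly_side vertices i" for i z
    using side_in_both_translates[OF that] by (auto split: prod.split)
qed

text \<open>Carries membership in a tiling from a tile to its neighbours and so to the whole
  lattice. The neighbours across sides 5 and 2 change \<open>k\<close> by one, those across sides 0
  and 3 change \<open>n\<close>.\<close>

lemma lat_induct:
  assumes "Q 0" and step: "\<And>k n i. i < 6 \<Longrightarrow> Q (lat k n) \<Longrightarrow> Q (lat k n + (case nbr i of (k, n) \<Rightarrow> lat k n))"
  shows "Q (lat k n)"
proof -
  have k: "Q (lat k 0)" for k
  proof (induction k rule: int_induct[where k = 0])
    case base show ?case using assms(1) by (simp add: lat_zero)
  next
    case (step1 k) then show ?case using step[of 5 k 0] by (simp add: lat_add)
  next
    case (step2 k) then show ?case using step[of 2 k 0] by (simp add: lat_add)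
  qed
  show ?thesis
  proof (induction n rule: int_induct[where k = 0])
    case base show ?case by (rule k)
  next
    case (step1 n) then show ?case using step[of 0 k n] by (simp add: lat_add)
  next
    case (step2 n) then show ?case using step[of 3 k n] by (simp add: lat_add)
  qed
qed

end

lemma ear_imp_ear_hexagon:
  assumes "ear A B C"
  obtains e1 e2 \<beta> h where "ear_hexagon e1 e2 h"
    "ear_hexagon.vertices c e1 e2 \<beta> h = [c + A, c + B, c + C, c - A, c - B, c - C]"
proof -
  \<comment> \<open>With these basis vectors \<open>A\<close> and \<open>C\<close> get the
    coordinates \<open>(1/2, 1)\<close> and \<open>(-1/2, 1)\<close>. By Cramer's rule
    \<open>\<beta>\<close> and \<open>h\<close> are the coordinates of \<open>B\<close>, and the ear
    condition reads \<open>1 < h\<close>.\<close>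
  define e1 where "e1 = A - C"
  define e2 where "e2 = (A + C) / 2"
  define \<beta> where "\<beta> = cross2 B e2 / cross2 A C"
  define h where "h = (cross2 A B + cross2 B C) / cross2 A C"
  have cr: "cross2 e1 e2 = cross2 A C" by (simp add: e1_def e2_def cross2_def field_simps)
  have eh: "ear_hexagon e1 e2 h" using assms cr by unfold_locales (simp_all add: ear_def h_def)
  interpret ear_hexagon c e1 e2 \<beta> h by (rule eh)
  have "Y (c + B) = h" unfolding Y_def h_def cr by (simp add: e1_def cross2_def algebra_simps)
  moreover have "X (c + B) = \<beta>" unfolding X_def \<beta>_def cr by simp
  ultimately have B: "pt \<beta> h = c + B" using pt_X_Y[of "c + B"] by simp
  have neg: "pt (- x) (- y) = 2 * c - pt x y" for x y by (simp add: pt_def)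
  have "pt (- \<beta>) (- h) = c - B" unfolding neg B by simp
  moreover have "pt (1/2) 1 = c + A" "pt (-1/2) 1 = c + C" "pt (-1/2) (-1) = c - A" "pt (1/2) (-1) = c - C"
    unfolding pt_def unfolding e1_def e2_def by (simp_all add: scaleR_conv_of_real field_simps)
  ultimately have "vertices = [c + A, c + B, c + C, c - A, c - B, c - C]"
    unfolding vertices_def using B by simp
  with eh show ?thesis by (rule that)
qed

section \<open>Putting existence and uniqueness together\<close>

context distinct_symmetric_hexagon
begin

lemma vertex_list: "vs = [vs ! 0, vs ! 1, vs ! 2, 2 * o' - vs ! 0, 2 * o' - vs ! 1, 2 * o' - vs ! 2]"
proof (rule nth_equalityI)
  fix i assume "i < length vs"
  then have "i < 6" by (simp add: length_6)
  then show "vs ! i = [vs ! 0, vs ! 1, vs ! 2, 2 * o' - vs ! 0, 2 * o' - vs ! 1, 2 * o' - vs ! 2] ! i"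
    using opposite[of 0] opposite[of 1] opposite[of 2] less_6_cases[OF \<open>i < 6\<close>] by (elim disjE) simp_all
qed (simp add: length_6)

lemma theorem_if_ear:
  assumes "ear (vs ! 0 - o') (vs ! 1 - o') (vs ! 2 - o')"
  shows "\<exists>T. trivalent_tiling_by P T \<and>
           (\<forall>T'. trivalent_tiling_by P T' \<longrightarrow> isometric_tilings T T') \<and>
           isohedral T \<and> periodic T \<and>
           (\<exists>\<T>. plane_covers P T \<T> \<and> minimal_torus_tiling P \<T> \<and> card (torus_tiles \<T>) = 1)"
proof -
  obtain e1 e2 \<beta> h where eh: "ear_hexagon e1 e2 h"
    and v: "ear_hexagon.vertices o' e1 e2 \<beta> h = [o' + (vs ! 0 - o'), o' + (vs ! 1 - o'), o' + (vs ! 2 - o'),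
      o' - (vs ! 0 - o'), o' - (vs ! 1 - o'), o' - (vs ! 2 - o')]"
    using ear_imp_ear_hexagon[OF assms, of o'] by blast
  interpret E: ear_hexagon o' e1 e2 \<beta> h by (rule eh)
  have vs: "E.vertices = vs" unfolding v by (subst (7) vertex_list) simp
  define \<Lambda> where "\<Lambda> = range (\<lambda>(k, n). E.lat k n)"
  define N where "N = (\<lambda>i. case E.nbr i of (k, n) \<Rightarrow> E.lat k n)"
  interpret L: lattice_hexagon vs P \<Lambda> N
    using E.lattice_hexagon simple unfolding vs P_def[symmetric] \<Lambda>_def N_def by blast
  have N: "N i = vs ! i + vs ! (Suc i mod 6) - 2 * o'" if "i < 6" for i
    using E.lat_nbr[OF that] unfolding vs N_def .
  have lattice: "plane_lattice \<Lambda>" unfolding \<Lambda>_def by (rule E.plane_lattice_lat)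
  have unique: "isometric_tilings L.tiles T'" if T': "trivalent_tiling_by P T'" for T'
  proof -
    have tb: "tiling_by P T'" using T' by (simp add: trivalent_tiling_by_def)
    then have "\<Union>T' = UNIV" by (simp add: tiling_by_def)
    then obtain t where t: "t \<in> T'" by blast
    obtain f where f: "plane_isometry f" "t = f ` P" using trivalent_tile[OF T' t] by blast
    \<comment> \<open>Any one tile of \<open>T'\<close> serves as the origin; each lattice translate
      of it is reached through a chain of neighbours.\<close>
    have "f ` L.tile (E.lat k n) \<in> T'" for k n
    proof (rule E.lat_induct[where Q = "\<lambda>l. f ` L.tile l \<in> T'"])
      show "f ` L.tile 0 \<in> T'" using t f(2) by (simp add: L.tile_0)
    next
      fix k n i assume i: "i < (6::nat)" and in_T: "f ` L.tile (E.lat k n) \<in> T'"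
      let ?l = "E.lat k n"
      let ?f = "f \<circ> (\<lambda>z. z + ?l)"
      have f': "plane_isometry ?f" by (intro plane_isometry_comp f plane_isometry_translation)
      have "L.tile 0 \<noteq> L.tile (N i)" using L.N_nz[OF i] L.tile_inj by metis
      moreover have "L.tile 0 \<in> L.tiles" "L.tile (N i) \<in> L.tiles"
        using L.zero L.N_in[OF i] by (simp_all add: L.tiles_def)
      ultimately have "interior (L.tile 0) \<inter> interior (L.tile (N i)) = {}"
        using L.tiling unfolding tiling_by_def by metis
      \<comment> \<open>Here the existing lattice tiling enters the uniqueness proof: it shows that
        the translate across a side does not overlap the tile.\<close>
      then have disj: "interior P \<inter> interior ((\<lambda>z. z + N i) ` P) = {}"
        unfolding L.tile_0 by (simp add: L.tile_def)
      have "?f ` P \<in> T'" using in_T by (simp add: L.tile_def image_comp)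
      from neighbour_translate[OF T' f' this i] disj have "?f ` (\<lambda>z. z + N i) ` P \<in> T'"
        unfolding N[OF i] by blast
      moreover have "?f ` (\<lambda>z. z + N i) ` P = f ` L.tile (?l + N i)"
        by (simp add: L.tile_def image_image ac_simps)
      ultimately show "f ` L.tile (?l + (case E.nbr i of (k, n) \<Rightarrow> E.lat k n)) \<in> T'"
        by (simp add: N_def)
    qed
    then show ?thesis
      by (intro L.isometric_if_contains_tiles[OF tb f(1)]) (auto simp: \<Lambda>_def)
  qed
  have "plane_covers P L.tiles (induced_tiling \<Lambda> L.tiles)"
    unfolding plane_covers_def using L.tiling lattice L.tiles_invariant by blast
  moreover have "card (torus_tiles (induced_tiling \<Lambda> L.tiles)) = 1"
    by (simp add: L.induced_single torus_tiles_def)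
  ultimately show ?thesis
    using L.trivalent unique L.tiles_isohedral L.tiles_periodic[OF lattice] L.induced_minimal[OF lattice]
    by blast
qed

text \<open>With the centre moved to 0, the disjointness assumptions of
  \<open>symmetric_hexagon_has_ear\<close> hold since nonadjacent sides of a simple polygon are
  disjoint, the corners are nonzero since opposite corners differ, and the inequalities exclude
  straight angles.\<close>

lemma has_ear:
  "ear (vs ! 0 - o') (vs ! 1 - o') (vs ! 2 - o') \<or>
   ear (vs ! 1 - o') (vs ! 2 - o') (- (vs ! 0 - o')) \<or>
   ear (vs ! 2 - o') (- (vs ! 0 - o')) (- (vs ! 1 - o'))"
proof -
  define A where "A = vs ! 0 - o'"
  define B where "B = vs ! 1 - o'"
  define C where "C = vs ! 2 - o'"
  have v: "vs ! 0 = o' + A" "vs ! 1 = o' + B" "vs ! 2 = o' + C" "vs ! 3 = o' + (- A)" "vs ! 4 = o' + (- B)" "vs ! 5 = o' + (- C)"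
    using opposite[of 0] opposite[of 1] opposite[of 2] by (simp_all add: A_def B_def C_def)
  have ne: "vs ! i \<noteq> vs ! j" if "i < 6" "j < 6" "i \<noteq> j" for i j
    using simple_polygon_distinct[OF simple] that length_6 by (simp add: nth_eq_iff_index_eq)
  have disj: "closed_segment (vs ! i) (vs ! (Suc i mod 6)) \<inter> closed_segment (vs ! j) (vs ! (Suc j mod 6)) = {}"
    if "i < 6" "j < 6" "i \<noteq> j" "Suc i mod 6 \<noteq> j" "Suc j mod 6 \<noteq> i" for i j
  proof -
    have "Suc i mod 6 \<noteq> Suc j mod 6" using Suc_mod_inj that by blast
    then have "{vs ! i, vs ! (Suc i mod 6)} \<inter> {vs ! j, vs ! (Suc j mod 6)} = {}"
      using ne[of i j] ne[of i "Suc j mod 6"] ne[of "Suc i mod 6" j] ne[of "Suc i mod 6" "Suc j mod 6"] that by auto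
    then show ?thesis
      using simple_polygon_side_Int[OF simple, of i j] that length_6 unfolding poly_side_def by auto
  qed
  have tr: "closed_segment p q \<inter> closed_segment p' q' = {}"
    if "closed_segment (o' + p) (o' + q) \<inter> closed_segment (o' + p') (o' + q') = {}" for p q p' q'
  proof -
    have "(+) o' ` (closed_segment p q \<inter> closed_segment p' q') = {}"
      using that by (simp add: closed_segment_translation_eq image_Int closed_segment_translation)
    then show ?thesis by simp
  qed
  have m: "Suc 0 mod 6 = (1::nat)" "Suc 1 mod 6 = (2::nat)" "Suc 2 mod 6 = (3::nat)" "Suc 4 mod 6 = (5::nat)"
    "Suc 5 mod 6 = (0::nat)" by simp_all
  have "closed_segment A B \<inter> closed_segment (- B) (- C) = {}"
    by (rule tr) (use disj[of 0 4, unfolded m] v in simp)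
  moreover have "closed_segment B C \<inter> closed_segment (- C) A = {}"
    by (rule tr) (use disj[of 1 5, unfolded m] v in simp)
  moreover have "closed_segment C (- A) \<inter> closed_segment A B = {}"
    by (rule tr) (use disj[of 2 0, unfolded m] v in simp)
  moreover have "A \<noteq> 0" "B \<noteq> 0" "C \<noteq> 0" using ne[of 0 3] ne[of 1 4] ne[of 2 5] v by auto
  moreover have "cross2 A B + cross2 B C \<noteq> cross2 A C" "cross2 B C + cross2 A C \<noteq> cross2 A B"
    "cross2 A C + cross2 A B \<noteq> cross2 B C"
  proof -
    have nc: "\<not> collinear {vs ! i, vs ! ((i + 1) mod 6), vs ! ((i + 2) mod 6)}" if "i < 6" for i
      using simple that unfolding simple_polygon_def length_6 by blast
    have i: "(0 + 1) mod 6 = (1::nat)" "(0 + 2) mod 6 = (2::nat)" "(1 + 1) mod 6 = (2::nat)"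
      "(1 + 2) mod 6 = (3::nat)" "(2 + 1) mod 6 = (3::nat)" "(2 + 2) mod 6 = (4::nat)" by simp_all
    have s: "cross2 C (- A) = cross2 A C" "cross2 B (- A) = cross2 A B"
      "cross2 (- A) (- B) = cross2 A B" "cross2 C (- B) = cross2 B C"
      by (simp_all add: cross2_def)
    show "cross2 A B + cross2 B C \<noteq> cross2 A C"
      using collinear_if_cross2_0[of A B C o'] nc[of 0, unfolded i] unfolding v by auto
    show "cross2 B C + cross2 A C \<noteq> cross2 A B"
      using collinear_if_cross2_0[of B C "- A" o', unfolded s] nc[of 1, unfolded i] unfolding v by auto
    show "cross2 A C + cross2 A B \<noteq> cross2 B C"
      using collinear_if_cross2_0[of C "- A" "- B" o', unfolded s] nc[of 2, unfolded i] unfolding v by auto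
  qed
  ultimately have "ear A B C \<or> ear B C (- A) \<or> ear C (- A) (- B)"
    by (rule symmetric_hexagon_has_ear)
  then show ?thesis unfolding A_def B_def C_def .
qed

end

theorem theorem3p1:
  fixes vs :: "complex list" and P :: "complex set"
  assumes "simple_polygon vs" and "length vs = 6" and "P = poly_region vs"
    and "centrally_symmetric P"
    and "distinct [side_length vs 0, side_length vs 1, side_length vs 2]"
  shows "\<exists>T. trivalent_tiling_by P T \<and>
           (\<forall>T'. trivalent_tiling_by P T' \<longrightarrow> isometric_tilings T T') \<and>
           isohedral T \<and> periodic T \<and>
           (\<exists>\<T>. plane_covers P T \<T> \<and> minimal_torus_tiling P \<T> \<and> card (torus_tiles \<T>) = 1)"
proof -
  obtain c where c: "(\<lambda>z. 2 * c - z) ` P = P" using assms(4) unfolding centrally_symmetric_def by blast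
  \<comment> \<open>By central symmetry three consecutive corners represent all six as possible
    apexes; the three starting points of the vertex list bring each of them to corner 1.\<close>
  interpret H0: distinct_symmetric_hexagon vs P c using assms c by unfold_locales
  interpret H1: distinct_symmetric_hexagon "rotate1 vs" P c by (rule H0.rotate1)
  interpret H2: distinct_symmetric_hexagon "rotate1 (rotate1 vs)" P c by (rule H1.rotate1)
  have m: "Suc 0 mod 6 = (1::nat)" "Suc 1 mod 6 = (2::nat)" "Suc 2 mod 6 = (3::nat)" "Suc 3 mod 6 = (4::nat)"
    by simp_all
  have r1: "rotate1 vs ! 0 = vs ! 1" "rotate1 vs ! 1 = vs ! 2" "rotate1 vs ! 2 = vs ! 3" "rotate1 vs ! 3 = vs ! 4"
    using nth_rotate1[of 0 vs] nth_rotate1[of 1 vs] nth_rotate1[of 2 vs] nth_rotate1[of 3 vs]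
    unfolding assms(2) m by simp_all
  have r2: "rotate1 (rotate1 vs) ! 0 = vs ! 2" "rotate1 (rotate1 vs) ! 1 = vs ! 3" "rotate1 (rotate1 vs) ! 2 = vs ! 4"
    using nth_rotate1[of 0 "rotate1 vs"] nth_rotate1[of 1 "rotate1 vs"] nth_rotate1[of 2 "rotate1 vs"]
    unfolding length_rotate1 assms(2) m r1 by simp_all
  have opp: "vs ! 3 - c = - (vs ! 0 - c)" "vs ! 4 - c = - (vs ! 1 - c)"
    using H0.opposite[of 0] H0.opposite[of 1] by simp_all
  from H0.has_ear show ?thesis
  proof (elim disjE)
    assume "ear (vs ! 0 - c) (vs ! 1 - c) (vs ! 2 - c)"
    then show ?thesis by (rule H0.theorem_if_ear)
  next
    assume "ear (vs ! 1 - c) (vs ! 2 - c) (- (vs ! 0 - c))"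
    then have "ear (rotate1 vs ! 0 - c) (rotate1 vs ! 1 - c) (rotate1 vs ! 2 - c)"
      unfolding opp[symmetric] r1 .
    then show ?thesis by (rule H1.theorem_if_ear)
  next
    assume "ear (vs ! 2 - c) (- (vs ! 0 - c)) (- (vs ! 1 - c))"
    then have "ear (rotate1 (rotate1 vs) ! 0 - c) (rotate1 (rotate1 vs) ! 1 - c) (rotate1 (rotate1 vs) ! 2 - c)"
      unfolding opp[symmetric] r2 .
    then show ?thesis by (rule H2.theorem_if_ear)
  qed
qed

end
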